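(* Fix vertex conditions $(P,T)$ (independent of $\varepsilon$), let $\mathcal{H}_\varepsilon$ be the corresponding operator and let $\mathcal{R}_s(\varepsilon,\lambda)$, $\mathcal{R}_e(\varepsilon,\lambda)$ be the operators defined in the context. For a fixed $\lambda\in\mathbb{C}\setminus\mathbb{R}$ the operators $\mathcal{R}_s$ and $\mathcal{R}_e$ are holomorphic in $\varepsilon$ (in a neighbourhood of $\varepsilon=0$) as operators from $L_2(s)\oplus L_2(e)$ into $L_2(s)$ and $L_2(e)$ correspondingly. For all choices of vertex conditions at $v_c$, the leading order of $\mathcal{R}_e$ is given, for $f=(f_s,f_e)\in L_2(s)\oplus L_2(e)$, by $$\mathcal{R}_e(\varepsilon,\lambda)f=(\mathcal{B}f_e)\,\sin(\sqrt{\lambda}\,x)+\mathcal{L}f_e+O(\varepsilon),$$ where $\mathcal{B}:L_2(e)\to\mathbb{C}$ is a bounded linear functional and $\mathcal{L}:L_2(e)\to H^2(e)$ is the operator $$(\mathcal{L}f_e)(x):=-\frac{1}{\sqrt{\lambda}}\int_0^x\sin\big(\sqrt{\lambda}(x-t)\big)f_e(t)\,dt.$$ The leading terms of the Taylor series (in $\varepsilon$) for the operator $\mathcal{R}_s$ are $$\mathcal{R}_s(\varepsilon,\lambda)f=\begin{cases}O(\varepsilon^2), & \text{if }\operatorname{rank}P=2,\\[2pt] \varepsilon\,\mathcal{B}_sf_s+O(\varepsilon^2), & \text{if }\operatorname{rank}P=1,\ z=\infty,\ \mu\neq0,\\[2pt] \mathcal{B}_sf_s+O(\varepsilon), & \text{if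 either }\operatorname{rank}P=1,\ z=\infty,\ \mu=0,\ \text{ or }\operatorname{rank}P=0,\ a=c=0,\\[2pt] \mathcal{B}_ef_e+O(\varepsilon), & \text{if either }\operatorname{rank}P=1,\ z\neq\infty,\ \text{ or }\operatorname{rank}P=0,\ (a,c)\neq(0,0),\end{cases}$$ where $\mathcal{B}_e$ and $\mathcal{B}_s$ are some bounded linear functionals on $L_2(e)$ and on $L_2(s)$, correspondingly (their values being regarded as constant functions on $s$).
   Context: Let $\varepsilon>0$ be a small parameter. The metric graph $\Gamma_\varepsilon$ consists of a short edge $s_\varepsilon=(0,\varepsilon)$ (coordinate $x_\varepsilon$) and an edge $e=(0,1)$ (coordinate $x$), joined at a central vertex $v_c$ corresponding to $x_\varepsilon=\varepsilon$ and $x=1$. Set $L_2(\Gamma_\varepsilon)=L_2(s_\varepsilon)\oplus L_2(e)$. Let $P$ be an orthogonal projection in $\mathbb{C}^2$, $Q:=I-P$, and let $T$ be a self-adjoint operator on the range of $Q$; $P$ and $T$ do not depend on $\varepsilon$. The self-adjoint operator $\mathcal{H}_\varepsilon$ on $L_2(\Gamma_\varepsilon)$ acts as $$\mathcal{H}_\varepsilon(u_\varepsilon,u)=\left(-\frac{d^2u_\varepsilon}{dx_\varepsilon^2},\,-\frac{d^2u}{dx^2}\right)$$ on the domain of all $(u_\varepsilon,u)\in H^2(s_\varepsilon)\oplus H^2(e)$ with $$u_\varepsilon'(0)=0,\qquad u(0)=0,\qquad PU=0,\qquad QU'=TQU,$$ $$U:=\begin{pmatrix}u_\varepsilon(\varepsilon)\\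 u(1)\end{pmatrix},\qquad U':=\begin{pmatrix}-u_\varepsilon'(\varepsilon)\\ -u'(1)\end{pmatrix}.$$ Parametrization of the conditions at $v_c$: - If $\operatorname{rank}P=2$: $P=I$, $Q=0$, $T=0$. - If $\operatorname{rank}P=1$: for some $z\in\mathbb{C}\cup\{\infty\}$, $$P=\frac{1}{1+|z|^2}\begin{pmatrix}1&z\\ \bar z&|z|^2\end{pmatrix},\qquad Q=\frac{1}{1+|z|^2}\begin{pmatrix}|z|^2&-z\\ -\bar z&1\end{pmatrix},$$ and $T$ is multiplication by a number $\mu\in\mathbb{R}$; for $z=\infty$ this means $P=\begin{pmatrix}0&0\\0&1\end{pmatrix}$, $Q=\begin{pmatrix}1&0\\0&0\end{pmatrix}$. - If $\operatorname{rank}P=0$: $P=0$, $Q=I$, and $T=\begin{pmatrix}a&c\\ \bar c&b\end{pmatrix}$ with $a,b\in\mathbb{R}$, $c\in\mathbb{C}$. Let $s:=(0,1)$ and let $\mathcal{S}_\varepsilon:L_2(s)\to L_2(s_\varepsilon)$ be the bounded operator $(\mathcal{S}_\varepsilon u)(x):=u(x/\varepsilon)$. Let $\mathcal{I}$ be the identity on $L_2(e)$, and let $\mathcal{P}_s:L_2(\Gamma_\varepsilon)\to L_2(s_\varepsilon)$, $\mathcal{P}_s(u_\varepsilon,u)=u_\varepsilon$, and $\mathcal{P}_e:L_2(\Gamma_\varepsilon)\to L_2(e)$, $\mathcal{P}_e(u_\varepsilon,u)=u$. For $\lambda\in\mathbb{C}\setminus\mathbb{R}$ define on $L_2(s)\oplus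 L_2(e)$ the operators $$\mathcal{R}_e(\varepsilon,\lambda):=\mathcal{P}_e(\mathcal{H}_\varepsilon-\lambda)^{-1}(\mathcal{S}_\varepsilon\oplus\mathcal{I}),\qquad \mathcal{R}_s(\varepsilon,\lambda):=\mathcal{S}_\varepsilon^{-1}\mathcal{P}_s(\mathcal{H}_\varepsilon-\lambda)^{-1}(\mathcal{S}_\varepsilon\oplus\mathcal{I}),$$ with values in $L_2(e)$ and $L_2(s)$ respectively. Conventions: $\sqrt\lambda$ denotes either (fixed) branch of the square root. "Holomorphic in $\varepsilon$" means that the operator-valued function of small $\varepsilon>0$ extends to a function holomorphic (in operator norm) in a complex neighbourhood of $\varepsilon=0$. The symbols $O(\varepsilon)$, $O(\varepsilon^2)$ are understood in the sense of the operator norm from $L_2(s)\oplus L_2(e)$ into $L_2(e)$ or $L_2(s)$ respectively, as $\varepsilon\to0$. The functionals $\mathcal{B},\mathcal{B}_s,\mathcal{B}_e$ do not depend on $\varepsilon$ (they may depend on $\lambda$ and on the vertex conditions). *)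

theory Defs
  imports "HOL-Analysis.Analysis" "HOL-Library.Landau_Symbols"
begin

text \<open>
  Elements of an \<open>L\<^sub>2\<close> space are represented by functions \<open>real \<Rightarrow> complex\<close>; as elements of the space
  they are identified by \<open>aeq\<close>. Hence \<open>norm_L2\<close> is only a seminorm on functions, and linearity of
  operators is required up to \<open>aeq\<close>.
\<close>

definition L2 :: "real \<Rightarrow> (real \<Rightarrow> complex) set" where
  "L2 l = {f. f \<in> borel_measurable (lebesgue_on {0<..<l}) \<and>
              integrable (lebesgue_on {0<..<l}) (\<lambda>x. (cmod (f x))\<^sup>2)}"

definition norm_L2 :: "real \<Rightarrow> (real \<Rightarrow> complex) \<Rightarrow> real" where
  "norm_L2 l f = sqrt (LINT x|lebesgue_on {0<..<l}. (cmod (f x))\<^sup>2)"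

definition aeq :: "real \<Rightarrow> (real \<Rightarrow> complex) \<Rightarrow> (real \<Rightarrow> complex) \<Rightarrow> bool" where
  "aeq l f g \<longleftrightarrow> (AE x in lebesgue_on {0<..<l}. f x = g x)"

text \<open>
  The Sobolev space \<open>H\<^sup>2(0,l)\<close>: functions whose first derivative is absolutely continuous with
  square-integrable derivative. An element is represented by its continuously differentiable
  version on the closed interval, so that boundary values make sense; values outside \<open>[0,l]\<close>
  are irrelevant.
\<close>

definition deriv1 :: "real \<Rightarrow> (real \<Rightarrow> complex) \<Rightarrow> real \<Rightarrow> complex" where
  "deriv1 l u x = vector_derivative u (at x within {0..l})"

definition has_deriv2 :: "real \<Rightarrow> (real \<Rightarrow> complex) \<Rightarrow> (real \<Rightarrow> complex) \<Rightarrow> bool" where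
  "has_deriv2 l u w \<longleftrightarrow> w \<in> L2 l \<and> u differentiable_on {0..l} \<and>
     (\<forall>x\<in>{0..l}. deriv1 l u x = deriv1 l u 0 + integral {0..x} w)"

definition H2 :: "real \<Rightarrow> (real \<Rightarrow> complex) set" where
  "H2 l = {u. \<exists>w. has_deriv2 l u w}"

text \<open>The second derivative of an \<open>H\<^sup>2\<close> function is unique up to \<open>aeq\<close>.\<close>

definition deriv2 :: "real \<Rightarrow> (real \<Rightarrow> complex) \<Rightarrow> real \<Rightarrow> complex" where
  "deriv2 l u = (SOME w. has_deriv2 l u w)"

text \<open>
  Functions on the graph with edges \<open>(0,l)\<close> and \<open>(0,1)\<close> are pairs. The case \<open>l = \<epsilon>\<close> is
  \<open>L\<^sub>2(\<Gamma>\<^sub>\<epsilon>)\<close>, the case \<open>l = 1\<close> is \<open>L\<^sub>2(s) \<oplus> L\<^sub>2(e)\<close>.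
\<close>

type_synonym gfun = "(real \<Rightarrow> complex) \<times> (real \<Rightarrow> complex)"

definition L2G :: "real \<Rightarrow> gfun set" where
  "L2G l = L2 l \<times> L2 1"

definition norm_L2G :: "real \<Rightarrow> gfun \<Rightarrow> real" where
  "norm_L2G l f = sqrt ((norm_L2 l (fst f))\<^sup>2 + (norm_L2 1 (snd f))\<^sup>2)"

subsection \<open>Vertex conditions and the operator on the graph\<close>

definition hermitian :: "complex^2^2 \<Rightarrow> bool" where
  "hermitian A \<longleftrightarrow> (\<forall>i j. A $ i $ j = cnj (A $ j $ i))"

text \<open>
  A self-adjoint operator on the range of \<open>Q = I - P\<close> is represented by the matrix that agrees
  with it on the range of \<open>Q\<close> and vanishes on the range of \<open>P\<close>.
\<close>

definition vertex_conditions :: "complex^2^2 \<Rightarrow> complex^2^2 \<Rightarrow> bool" where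
  "vertex_conditions P T \<longleftrightarrow>
     P ** P = P \<and> hermitian P \<and>
     hermitian T \<and> (mat 1 - P) ** T ** (mat 1 - P) = T"

text \<open>The rank one projections, parametrized by \<open>z \<in> \<complex> \<union> {\<infinity>}\<close>, with \<open>None\<close> for \<open>z = \<infinity>\<close>.\<close>

fun rank1_proj :: "complex option \<Rightarrow> complex^2^2" where
  "rank1_proj (Some z) = (1 / (1 + (cmod z)\<^sup>2)) *\<^sub>R
     vector [vector [1, z], vector [cnj z, of_real ((cmod z)\<^sup>2)]]"
| "rank1_proj None = vector [vector [0, 0], vector [0, 1]]"

definition vtx_val :: "real \<Rightarrow> gfun \<Rightarrow> complex^2" where
  "vtx_val \<epsilon> u = vector [fst u \<epsilon>, snd u 1]"

definition vtx_deriv :: "real \<Rightarrow> gfun \<Rightarrow> complex^2" where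
  "vtx_deriv \<epsilon> u = vector [- deriv1 \<epsilon> (fst u) \<epsilon>, - deriv1 1 (snd u) 1]"

definition H_dom :: "complex^2^2 \<Rightarrow> complex^2^2 \<Rightarrow> real \<Rightarrow> gfun set" where
  "H_dom P T \<epsilon> = {u. fst u \<in> H2 \<epsilon> \<and> snd u \<in> H2 1 \<and>
     deriv1 \<epsilon> (fst u) 0 = 0 \<and> snd u 0 = 0 \<and>
     P *v vtx_val \<epsilon> u = 0 \<and>
     (mat 1 - P) *v vtx_deriv \<epsilon> u = T *v ((mat 1 - P) *v vtx_val \<epsilon> u)}"

definition H_op :: "real \<Rightarrow> gfun \<Rightarrow> gfun" where
  "H_op \<epsilon> u = ((\<lambda>x. - deriv2 \<epsilon> (fst u) x), (\<lambda>x. - deriv2 1 (snd u) x))"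

text \<open>
  \<open>(H\<^sub>\<epsilon> - \<lambda>)\<^sup>-\<^sup>1 f\<close>: a representative of the element \<open>u\<close> of the domain with \<open>(H\<^sub>\<epsilon> - \<lambda>) u = f\<close>.
  For nonreal \<open>\<lambda>\<close> and \<open>f \<in> L\<^sub>2(\<Gamma>\<^sub>\<epsilon>)\<close> it exists and is unique on the closed edges, since \<open>H\<^sub>\<epsilon>\<close> is
  self-adjoint.
\<close>

definition H_resolvent ::
  "complex^2^2 \<Rightarrow> complex^2^2 \<Rightarrow> complex \<Rightarrow> real \<Rightarrow> gfun \<Rightarrow> gfun" where
  "H_resolvent P T lam \<epsilon> f = (SOME u. u \<in> H_dom P T \<epsilon> \<and>
     aeq \<epsilon> (\<lambda>x. fst (H_op \<epsilon> u) x - lam * fst u x) (fst f) \<and>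
     aeq 1 (\<lambda>x. snd (H_op \<epsilon> u) x - lam * snd u x) (snd f))"

definition S_scale :: "real \<Rightarrow> (real \<Rightarrow> complex) \<Rightarrow> real \<Rightarrow> complex" where
  "S_scale \<epsilon> u = (\<lambda>x. u (x / \<epsilon>))"

definition R_e :: "complex^2^2 \<Rightarrow> complex^2^2 \<Rightarrow> complex \<Rightarrow> real \<Rightarrow> gfun \<Rightarrow> real \<Rightarrow> complex" where
  "R_e P T lam \<epsilon> f = snd (H_resolvent P T lam \<epsilon> (S_scale \<epsilon> (fst f), snd f))"

definition R_s :: "complex^2^2 \<Rightarrow> complex^2^2 \<Rightarrow> complex \<Rightarrow> real \<Rightarrow> gfun \<Rightarrow> real \<Rightarrow> complex" where
  "R_s P T lam \<epsilon> f = inv (S_scale \<epsilon>) (fst (H_resolvent P T lam \<epsilon> (S_scale \<epsilon> (fst f), snd f)))"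

subsection \<open>Bounded operators and functionals\<close>

text \<open>Bounded linear operators \<open>L\<^sub>2(0,1) \<oplus> L\<^sub>2(0,1) \<rightarrow> L\<^sub>2(0,1)\<close> and their operator norm.\<close>

type_synonym gop = "gfun \<Rightarrow> real \<Rightarrow> complex"

definition bounded_op :: "gop \<Rightarrow> bool" where
  "bounded_op A \<longleftrightarrow>
     (\<forall>f\<in>L2G 1. A f \<in> L2 1) \<and>
     (\<forall>f\<in>L2G 1. \<forall>g\<in>L2G 1. \<forall>c.
        aeq 1 (A ((\<lambda>x. c * fst f x + fst g x), (\<lambda>x. c * snd f x + snd g x)))
              (\<lambda>x. c * A f x + A g x)) \<and>
     (\<exists>K. \<forall>f\<in>L2G 1. norm_L2 1 (A f) \<le> K * norm_L2G 1 f)"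

definition op_norm :: "gop \<Rightarrow> real" where
  "op_norm A = (SUP f\<in>{f \<in> L2G 1. norm_L2G 1 f \<le> 1}. norm_L2 1 (A f))"

definition op_holomorphic_on :: "(complex \<Rightarrow> gop) \<Rightarrow> complex set \<Rightarrow> bool" where
  "op_holomorphic_on F S \<longleftrightarrow>
     (\<forall>z\<in>S. bounded_op (F z)) \<and>
     (\<forall>z\<in>S. \<exists>D. bounded_op D \<and>
        ((\<lambda>w. op_norm (\<lambda>f x. (F w f x - F z f x) / (w - z) - D f x)) \<longlongrightarrow> 0) (at z))"

definition op_holomorphic_at_0 :: "(real \<Rightarrow> gop) \<Rightarrow> bool" where
  "op_holomorphic_at_0 R \<longleftrightarrow>
     (\<exists>r>0. \<exists>F. op_holomorphic_on F (ball 0 r) \<and>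
        (\<forall>\<epsilon>\<in>{0<..<r}. \<forall>f\<in>L2G 1. aeq 1 (R \<epsilon> f) (F (of_real \<epsilon>) f)))"

text \<open>\<open>A \<epsilon> = O(\<epsilon>\<^sup>n)\<close> in operator norm. The first conjunct makes \<open>op_norm\<close> meaningful.\<close>

definition op_bigO :: "nat \<Rightarrow> (real \<Rightarrow> gop) \<Rightarrow> bool" where
  "op_bigO n A \<longleftrightarrow>
     (\<forall>\<^sub>F \<epsilon> in at_right 0. bounded_op (A \<epsilon>)) \<and>
     (\<lambda>\<epsilon>. op_norm (A \<epsilon>)) \<in> O[at_right 0](\<lambda>\<epsilon>. \<epsilon> ^ n)"

definition bounded_functional :: "((real \<Rightarrow> complex) \<Rightarrow> complex) \<Rightarrow> bool" where
  "bounded_functional B \<longleftrightarrow>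
     (\<forall>f\<in>L2 1. \<forall>g\<in>L2 1. \<forall>c. B (\<lambda>x. c * f x + g x) = c * B f + B g) \<and>
     (\<exists>K. \<forall>f\<in>L2 1. cmod (B f) \<le> K * norm_L2 1 f)"

definition L_op :: "complex \<Rightarrow> (real \<Rightarrow> complex) \<Rightarrow> real \<Rightarrow> complex" where
  "L_op k f x = - (1 / k) * integral {0..x} (\<lambda>t. sin (k * of_real (x - t)) * f t)"

end

theory Submission
  imports Defs "HOL-Complex_Analysis.Complex_Analysis"
begin

text \<open>
  The resolvent is explicit up to two numbers. Put \<open>k\<^sup>2 = \<lambda>\<close>. Variation of constants and the conditions at the
  two free endpoints leave one amplitude on each edge: on the long edge the solution is
  \<open>B sin (k x) + L f\<^sub>e x\<close>, and on the short edge, in the rescaled variable \<open>\<xi> = x / \<epsilon>\<close>, it is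
  \<open>A cos (k \<epsilon> \<xi>) - (\<epsilon> / k) \<integral>\<^sub>0\<^sup>\<xi> sin (k \<epsilon> (\<xi> - t)) f\<^sub>s t dt\<close>. Rescaling the short edge puts
  \<open>\<epsilon>\<close> into the frequency, and apart from \<open>A\<close> and \<open>B\<close> everything is entire in \<open>\<epsilon>\<close>.

  The conditions at the central vertex are two linear equations for \<open>(A, B)\<close>. Their coefficients are
  entire in \<open>\<epsilon>\<close>, and their right-hand side is a combination of two functionals of \<open>f\<^sub>s\<close>, each multiplied
  by \<open>\<epsilon>\<close>, and two fixed functionals of \<open>f\<^sub>e\<close>. If the determinant does not vanish at \<open>\<epsilon> = 0\<close>, Cramer's
  rule (\<open>regular_solution_coeffs\<close>) gives amplitudes holomorphic in \<open>\<epsilon>\<close> whose value at \<open>0\<close> involves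
  \<open>f\<^sub>e\<close> only. If moreover the amplitude on the short edge decouples from the long edge, as in the cases
  \<open>P = I\<close> and \<open>z = \<infinity>\<close>, \<open>\<mu> \<noteq> 0\<close>, no functional of \<open>f\<^sub>e\<close> occurs in \<open>A\<close>, and the extra factor \<open>\<epsilon>\<close> in
  front of \<open>f\<^sub>s\<close> becomes visible.

  The determinant vanishes at \<open>0\<close> exactly when the short edge carries a Neumann condition at the
  central vertex (\<open>z = \<infinity>\<close>, \<open>\<mu> = 0\<close>, or \<open>P = 0\<close>, \<open>a = c = 0\<close>). Then \<open>A\<close> solves
  \<open>k sin (k \<epsilon>) A = - \<epsilon> \<integral>\<^sub>0\<^sup>1 cos (k \<epsilon> (1 - t)) f\<^sub>s t dt\<close>. The zero of the sine cancels the factor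
  \<open>\<epsilon>\<close>, so the singularity is removable, and a functional of \<open>f\<^sub>s\<close> of order one survives
  (\<open>neumann_solution_coeffs\<close>). In all other cases the determinant at \<open>0\<close> is a nonzero multiple of
  \<open>sin k\<close> or of \<open>k cos k + \<mu> sin k\<close> with real \<open>\<mu>\<close>. These numbers are characteristic functions of
  self-adjoint Dirichlet and Robin problems on \<open>(0, 1)\<close>, so they cannot vanish for nonreal \<open>\<lambda>\<close>;
  \<open>robin_nonzero\<close> proves this by an elementary inequality.

  What remains is to pass from formulas to operator norms. All operators in sight are families
  \<open>F z f x\<close> that are holomorphic in \<open>z\<close> for fixed \<open>f\<close> and \<open>x\<close> and bounded by a constant times the norm of
  \<open>f\<close>, uniformly in \<open>z\<close> and \<open>x\<close>. Cauchy's estimates turn such pointwise holomorphy into difference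
  quotients and Taylor remainders that are uniform in \<open>f\<close> and \<open>x\<close>, hence into holomorphy and
  \<open>O(\<epsilon>)\<close>, \<open>O(\<epsilon>\<^sup>2)\<close> bounds in operator norm (\<open>hol_family\<close> and the results on it).
\<close>

section \<open>Square-integrable functions on an interval\<close>

text \<open>
  A square-integrable function on a bounded interval is integrable because \<open>y \<le> 1 + y\<^sup>2\<close>; the endpoints form a
  null set. Absolute integrability on the closed interval is what the calculus of the gauge integral needs.
\<close>
lemma L2_absolutely_integrable:
  assumes "f \<in> L2 l"
  shows "f absolutely_integrable_on {0..l}"
proof -
  interpret finite_measure "lebesgue_on {0<..<l}"
    by (simp add: finite_measure_lebesgue_on)
  have f: "f \<in> borel_measurable (lebesgue_on {0<..<l})"
    and i: "integrable (lebesgue_on {0<..<l}) (\<lambda>x. (cmod (f x))\<^sup>2)"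
    using assms by (auto simp: L2_def)
  have b: "cmod (f x) \<le> 1 + (cmod (f x))\<^sup>2" for x
  proof -
    have "0 \<le> (cmod (f x) - 1/2)\<^sup>2" by simp
    then show ?thesis by (simp add: power2_eq_square field_simps)
  qed
  have "integrable (lebesgue_on {0<..<l}) f"
  proof (rule Bochner_Integration.integrable_bound[OF _ f])
    show "integrable (lebesgue_on {0<..<l}) (\<lambda>x. 1 + (cmod (f x))\<^sup>2)"
      using i by simp
  qed (use b in \<open>auto intro!: AE_I2\<close>)
  then have "f absolutely_integrable_on {0<..<l}"
    by (simp add: integrable_restrict_space set_integrable_def)
  moreover have "{0..l} - {0<..<l} \<subseteq> {0, l}"
    by auto
  then have "negligible ({0..l} - {0<..<l})"
    by (rule negligible_subset[rotated]) auto
  then have "negligible {x \<in> {0..l} - {0<..<l}. f x \<noteq> 0}"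
    by (rule negligible_subset) auto
  moreover have "negligible {x \<in> {0<..<l} - {0..l}. f x \<noteq> 0}"
    by (rule negligible_subset[of "{}"]) auto
  ultimately show ?thesis
    using absolutely_integrable_spike_set_eq[of "{0<..<l}" "{0..l}" f] by blast
qed

lemma absolutely_integrable_continuous_mult:
  fixes f :: "real \<Rightarrow> complex"
  assumes "f absolutely_integrable_on {a..b}" "continuous_on {a..b} g"
  shows "(\<lambda>t. g t * f t) absolutely_integrable_on {a..b}"
proof (rule absolutely_integrable_bounded_measurable_product[OF bilinear_times _ _ _ assms(1)])
  show "g \<in> borel_measurable (lebesgue_on {a..b})"
    using assms(2) by (intro continuous_imp_measurable_on_sets_lebesgue) auto
  show "bounded (g ` {a..b})"
    using assms(2) by (intro compact_imp_bounded compact_continuous_image) auto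
qed auto

lemma absolutely_integrable_sub:
  fixes f :: "real \<Rightarrow> complex"
  assumes "f absolutely_integrable_on {a..b}" "a \<le> c" "d \<le> b"
  shows "f absolutely_integrable_on {c..d}"
  using assms by (intro set_integrable_subset[OF assms(1)]) auto

lemma norm_L2_nonneg [simp]: "0 \<le> norm_L2 l f"
  by (simp add: norm_L2_def)

text \<open>
  The Cauchy-Schwarz inequality against the constant \<open>1\<close> on an interval of length one, in the form that a variance is
  nonnegative.
\<close>
lemma integral_norm_le_norm_L2:
  assumes f: "f \<in> L2 1"
  shows "integral {0..1} (\<lambda>t. cmod (f t)) \<le> norm_L2 1 f"
proof -
  let ?M = "lebesgue_on {0<..<1::real}"
  interpret prob: finite_measure ?M
    by (simp add: finite_measure_lebesgue_on)
  have sp: "measure ?M (space ?M) = 1"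
    by (simp add: measure_restrict_space)
  have ai: "f absolutely_integrable_on {0..1}"
    by (rule L2_absolutely_integrable[OF f])
  then have "f absolutely_integrable_on {0<..<1}"
    by (rule set_integrable_subset) auto
  then have i1: "integrable ?M (\<lambda>x. cmod (f x))"
    using absolutely_integrable_measurable[of "{0<..<1::real}" f] by (simp add: o_def)
  have i2: "integrable ?M (\<lambda>x. (cmod (f x))\<^sup>2)"
    using f by (simp add: L2_def)
  let ?m = "\<integral>x. cmod (f x) \<partial>?M"
  have "0 \<le> (\<integral>x. (cmod (f x) - ?m)\<^sup>2 \<partial>?M)"
    by simp
  also have "\<dots> = (\<integral>x. (cmod (f x))\<^sup>2 - 2 * ?m * cmod (f x) + ?m\<^sup>2 \<partial>?M)"
    by (simp add: power2_diff algebra_simps)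
  also have "\<dots> = (\<integral>x. (cmod (f x))\<^sup>2 \<partial>?M) - 2 * ?m * ?m + ?m\<^sup>2"
    using i1 i2 sp by simp
  finally have "?m\<^sup>2 \<le> (\<integral>x. (cmod (f x))\<^sup>2 \<partial>?M)"
    by (simp add: power2_eq_square)
  then have "?m \<le> norm_L2 1 f"
    unfolding norm_L2_def by (rule real_le_rsqrt)
  moreover have "?m = integral {0<..<1} (\<lambda>x. cmod (f x))"
    by (rule lebesgue_integral_eq_integral[OF i1]) simp
  moreover have "\<dots> = integral {0..1} (\<lambda>x. cmod (f x))"
    using integral_open_interval[of "0::real" 1] by simp
  ultimately show ?thesis by simp
qed

text \<open>
  All functionals and operators below are integrals of \<open>f\<close> against bounded continuous kernels, so this is the
  source of every norm bound.
\<close>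
lemma norm_integral_kernel_le:
  assumes f: "f \<in> L2 1" and x: "0 \<le> x" "x \<le> 1"
    and g: "continuous_on {0..x} g" and M: "\<And>t. t \<in> {0..x} \<Longrightarrow> cmod (g t) \<le> M"
  shows "cmod (integral {0..x} (\<lambda>t. g t * f t)) \<le> M * norm_L2 1 f"
proof -
  have ai1: "f absolutely_integrable_on {0..1}"
    by (rule L2_absolutely_integrable[OF f])
  have ai: "f absolutely_integrable_on {0..x}"
    using absolutely_integrable_sub[OF ai1] x by auto
  have M0: "0 \<le> M"
    using M[of 0] x norm_ge_zero[of "g 0"] by (metis atLeastAtMost_iff order_refl order_trans)
  have "cmod (integral {0..x} (\<lambda>t. g t * f t)) \<le> integral {0..x} (\<lambda>t. M * cmod (f t))"
  proof (rule integral_norm_bound_integral)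
    show "(\<lambda>t. g t * f t) integrable_on {0..x}"
      using absolutely_integrable_continuous_mult[OF ai g] set_lebesgue_integral_eq_integral(1) by blast
    show "(\<lambda>t. M * cmod (f t)) integrable_on {0..x}"
      using ai unfolding absolutely_integrable_on_def by (intro integrable_on_mult_right) auto
    show "\<And>t. t \<in> {0..x} \<Longrightarrow> cmod (g t * f t) \<le> M * cmod (f t)"
      using M by (simp add: norm_mult mult_right_mono)
  qed
  also have "\<dots> = M * integral {0..x} (\<lambda>t. cmod (f t))"
    by simp
  also have "\<dots> \<le> M * integral {0..1} (\<lambda>t. cmod (f t))"
    using ai ai1 x M0 unfolding absolutely_integrable_on_def
    by (intro mult_left_mono integral_subset_le) auto
  also have "\<dots> \<le> M * norm_L2 1 f"
    using integral_norm_le_norm_L2[OF f] M0 by (rule mult_left_mono)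
  finally show ?thesis .
qed

lemma L2_bounded:
  assumes "f \<in> borel_measurable (lebesgue_on {0<..<l})" "\<And>x. x \<in> {0<..<l} \<Longrightarrow> cmod (f x) \<le> K"
  shows "f \<in> L2 l"
proof -
  interpret finite_measure "lebesgue_on {0<..<l}"
    by (simp add: finite_measure_lebesgue_on)
  have "integrable (lebesgue_on {0<..<l}) (\<lambda>x. (cmod (f x))\<^sup>2)"
  proof (rule integrable_const_bound)
    show "AE x in lebesgue_on {0<..<l}. norm ((cmod (f x))\<^sup>2) \<le> K\<^sup>2"
      using assms(2) by (intro AE_I2) (auto intro!: power_mono)
  qed (use assms(1) in measurable)
  with assms(1) show ?thesis by (simp add: L2_def)
qed

lemma L2_continuous:
  assumes "continuous_on {0..l} f"
  shows "f \<in> L2 l"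
proof -
  have "bounded (f ` {0..l})"
    using assms by (intro compact_imp_bounded compact_continuous_image) auto
  then obtain K where "\<And>x. x \<in> {0..l} \<Longrightarrow> cmod (f x) \<le> K"
    unfolding bounded_iff by blast
  moreover have "continuous_on {0<..<l} f"
    using assms by (rule continuous_on_subset) auto
  then have "f \<in> borel_measurable (lebesgue_on {0<..<l})"
    by (intro continuous_imp_measurable_on_sets_lebesgue) auto
  ultimately show ?thesis by (intro L2_bounded[of f l K]) auto
qed

lemma L2_lincomb:
  assumes "f \<in> L2 l" "g \<in> L2 l"
  shows "(\<lambda>x. c * f x + g x) \<in> L2 l"
proof -
  have m: "f \<in> borel_measurable (lebesgue_on {0<..<l})" "g \<in> borel_measurable (lebesgue_on {0<..<l})"
    and i: "integrable (lebesgue_on {0<..<l}) (\<lambda>x. (cmod (f x))\<^sup>2)"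
      "integrable (lebesgue_on {0<..<l}) (\<lambda>x. (cmod (g x))\<^sup>2)"
    using assms by (auto simp: L2_def)
  have b: "(cmod (c * f x + g x))\<^sup>2 \<le> 2 * (cmod c)\<^sup>2 * (cmod (f x))\<^sup>2 + 2 * (cmod (g x))\<^sup>2" for x
  proof -
    have "(cmod (c * f x + g x))\<^sup>2 \<le> (cmod (c * f x) + cmod (g x))\<^sup>2"
      by (intro power_mono norm_triangle_ineq) auto
    also have "\<dots> \<le> 2 * (cmod (c * f x))\<^sup>2 + 2 * (cmod (g x))\<^sup>2"
      using sum_squares_bound[of "cmod (c * f x)" "cmod (g x)"] by (simp add: power2_sum)
    finally show ?thesis by (simp add: norm_mult power_mult_distrib)
  qed
  have "integrable (lebesgue_on {0<..<l}) (\<lambda>x. (cmod (c * f x + g x))\<^sup>2)"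
  proof (rule Bochner_Integration.integrable_bound)
    show "integrable (lebesgue_on {0<..<l})
        (\<lambda>x. 2 * (cmod c)\<^sup>2 * (cmod (f x))\<^sup>2 + 2 * (cmod (g x))\<^sup>2)"
      using i by simp
    show "AE x in lebesgue_on {0<..<l}. norm ((cmod (c * f x + g x))\<^sup>2)
       \<le> norm (2 * (cmod c)\<^sup>2 * (cmod (f x))\<^sup>2 + 2 * (cmod (g x))\<^sup>2)"
      using b by (intro AE_I2) (simp add: abs_of_nonneg)
  qed (use m in measurable)
  then show ?thesis using m by (simp add: L2_def)
qed

lemma L2_scale:
  assumes f: "f \<in> L2 1" and e: "0 < e"
  shows "S_scale e f \<in> L2 e"
proof -
  \<comment> \<open>Extension by zero makes the measurability and scaling results for the whole line applicable.\<close>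
  define h where "h = (\<lambda>x. if x \<in> {0<..<1} then f x else 0)"
  have h1: "h \<in> borel_measurable lebesgue"
    using f unfolding h_def by (intro borel_measurable_if_I) (auto simp: L2_def)
  have i: "integrable (lebesgue_on {0<..<1}) (\<lambda>x. (cmod (f x))\<^sup>2)"
    using f by (simp add: L2_def)
  have "(\<lambda>x. (cmod (h x))\<^sup>2) = (\<lambda>x. indicator {0<..<1} x *\<^sub>R (cmod (f x))\<^sup>2)"
    by (auto simp: h_def fun_eq_iff)
  then have h2: "integrable lebesgue (\<lambda>x. (cmod (h x))\<^sup>2)"
    using i by (simp add: integrable_restrict_space)
  have hs: "h (0 + inverse e * x) = (if x \<in> {0<..<e} then S_scale e f x else 0)" for x
    using e by (auto simp: h_def S_scale_def field_simps)
  have "(\<lambda>x. h (0 + inverse e *\<^sub>R x)) \<in> borel_measurable lebesgue"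
    by (rule borel_measurable_affine[OF h1]) (use e in auto)
  then have "(\<lambda>x. if x \<in> {0<..<e} then S_scale e f x else 0) \<in> borel_measurable lebesgue"
    using hs by simp
  then have m: "S_scale e f \<in> borel_measurable (lebesgue_on {0<..<e})"
    by (rule borel_measurable_if_D)
  have "integrable lebesgue (\<lambda>x. (cmod (h (0 + inverse e * x)))\<^sup>2)"
    by (rule lebesgue_integrable_real_affine[OF h2]) (use e in auto)
  moreover have "(\<lambda>x. (cmod (h (0 + inverse e * x)))\<^sup>2)
      = (\<lambda>x. indicator {0<..<e} x *\<^sub>R (cmod (S_scale e f x))\<^sup>2)"
    unfolding hs by (auto simp: fun_eq_iff)
  ultimately show ?thesis
    using m by (simp add: L2_def integrable_restrict_space)
qed

lemma aeq_negligible: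
  "aeq l f g \<longleftrightarrow> (\<exists>N. negligible N \<and> (\<forall>x\<in>{0..l} - N. f x = g x))"
proof
  assume "aeq l f g"
  then have "AE x in lebesgue. x \<in> {0<..<l} \<longrightarrow> f x = g x"
    unfolding aeq_def by (subst (asm) AE_restrict_space_iff) auto
  then obtain N where N: "N \<in> null_sets lebesgue" "{x. \<not> (x \<in> {0<..<l} \<longrightarrow> f x = g x)} \<subseteq> N"
    by (auto simp: eventually_ae_filter)
  then have "negligible (N \<union> {0, l})"
    by (intro negligible_Un) (auto simp: negligible_iff_null_sets)
  moreover have "\<forall>x\<in>{0..l} - (N \<union> {0, l}). f x = g x"
    using N(2) by (auto simp: less_le)
  ultimately show "\<exists>N. negligible N \<and> (\<forall>x\<in>{0..l} - N. f x = g x)" by blast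
next
  assume "\<exists>N. negligible N \<and> (\<forall>x\<in>{0..l} - N. f x = g x)"
  then obtain N where N: "negligible N" "\<forall>x\<in>{0..l} - N. f x = g x" by blast
  have "AE x in lebesgue. x \<in> {0<..<l} \<longrightarrow> f x = g x"
    by (rule AE_I'[of N]) (use N in \<open>auto simp: negligible_iff_null_sets\<close>)
  then show "aeq l f g"
    unfolding aeq_def by (subst AE_restrict_space_iff) auto
qed

text \<open>
  Lebesgue's differentiation theorem recovers an integrable function almost everywhere from its indefinite
  integral. It makes second derivatives of \<open>H\<^sup>2\<close> functions unique.
\<close>
lemma indefinite_integral_unique:
  fixes f :: "real \<Rightarrow> complex"
  assumes f: "f integrable_on {0..l}" and g: "g integrable_on {0..l}"
    and eq: "\<And>x. x \<in> {0..l} \<Longrightarrow> integral {0..x} f = integral {0..x} g"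
  shows "aeq l f g"
proof -
  define h where "h = (\<lambda>x. if x \<in> {0..l} then f x - g x else 0)"
  have fg: "(\<lambda>x. f x - g x) integrable_on {0..l}"
    using f g by (rule integrable_diff)
  have hU: "h integrable_on UNIV"
    unfolding h_def using fg by (simp only: integrable_restrict_UNIV)
  then have hc: "h integrable_on cbox a b" for a b
    by (rule integrable_on_subcbox) auto
  obtain N where N: "negligible N"
    and lim: "\<And>x e. \<lbrakk>x \<notin> N; 0 < e\<rbrakk> \<Longrightarrow> \<exists>d>0. \<forall>t. 0 < t \<and> t < d \<longrightarrow>
        norm (integral (cbox x (x + t *\<^sub>R One)) h /\<^sub>R t ^ DIM(real) - h x) < e"
    using integrable_ccontinuous_explicit[OF hc] by blast
  have h0: "integral {0..x} h = 0" if "x \<in> {0..l}" for x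
  proof -
    have "integral {0..x} h = integral {0..x} (\<lambda>x. f x - g x)"
      by (rule integral_cong) (use that in \<open>auto simp: h_def\<close>)
    also have "\<dots> = integral {0..x} f - integral {0..x} g"
      using that by (intro integral_diff integrable_on_subinterval[OF f] integrable_on_subinterval[OF g]) auto
    finally show ?thesis using eq[OF that] by simp
  qed
  have "f x = g x" if x: "x \<in> {0..l} - insert l N" for x
  proof (rule ccontr)
    assume "f x \<noteq> g x"
    then have "h x \<noteq> 0" using x by (auto simp: h_def)
    then obtain d where d: "d > 0" and D: "\<And>t. 0 < t \<Longrightarrow> t < d \<Longrightarrow>
        norm (integral (cbox x (x + t *\<^sub>R One)) h /\<^sub>R t ^ DIM(real) - h x) < norm (h x)"
      using lim[of x "norm (h x)"] x by auto
    \<comment> \<open>A step short enough for the differentiation theorem that does not leave the interval.\<close>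
    define t where "t = min (d/2) (l - x)"
    have t: "0 < t" "t < d" "x + t \<le> l" using d x by (auto simp: t_def)
    have "integral {0..x} h + integral {x..x + t} h = integral {0..x+t} h"
      using t x by (intro Henstock_Kurzweil_Integration.integral_combine) (auto intro: hc[unfolded cbox_interval])
    then have "integral {x..x + t} h = 0"
      using h0[of x] h0[of "x + t"] t x by auto
    then show False using D[OF t(1,2)] by simp
  qed
  moreover have "negligible (insert l N)" using N by simp
  ultimately show ?thesis unfolding aeq_negligible by blast
qed

lemma integral_cong_aeq:
  assumes "aeq l f g" "x \<in> {0..l}"
  shows "integral {0..x} f = integral {0..x} g"
proof -
  obtain N where "negligible N" "\<And>x. x\<in>{0..l} - N \<Longrightarrow> f x = g x"
    using assms(1) unfolding aeq_negligible by blast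
  then show ?thesis using assms(2) by (intro integral_spike[of N]) auto
qed

section \<open>The equation on a single edge\<close>

lemma sin_cos_has_vector_derivative:
  fixes k :: complex and x :: real
  shows "((\<lambda>x. sin (k * of_real x)) has_vector_derivative (k * cos (k * of_real x))) (at x within A)"
    and "((\<lambda>x. cos (k * of_real x)) has_vector_derivative (- k * sin (k * of_real x))) (at x within A)"
proof -
  show "((\<lambda>x. sin (k * of_real x)) has_vector_derivative (k * cos (k * of_real x))) (at x within A)"
    by (rule has_vector_derivative_real_field) (auto intro!: derivative_eq_intros)
  show "((\<lambda>x. cos (k * of_real x)) has_vector_derivative (- k * sin (k * of_real x))) (at x within A)"
    by (rule has_vector_derivative_real_field) (auto intro!: derivative_eq_intros)
qed

definition sin_conv :: "complex \<Rightarrow> (real \<Rightarrow> complex) \<Rightarrow> real \<Rightarrow> complex" where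
  "sin_conv k f x = integral {0..x} (\<lambda>t. sin (k * of_real (x - t)) * f t)"

definition cos_conv :: "complex \<Rightarrow> (real \<Rightarrow> complex) \<Rightarrow> real \<Rightarrow> complex" where
  "cos_conv k f x = integral {0..x} (\<lambda>t. cos (k * of_real (x - t)) * f t)"

lemma continuous_on_trig [continuous_intros]:
  fixes k :: complex
  shows "continuous_on A (\<lambda>t::real. sin (k * of_real (x - t)))"
    and "continuous_on A (\<lambda>t::real. cos (k * of_real (x - t)))"
  by (intro continuous_intros)+

text \<open>
  The addition theorems separate \<open>x\<close> from the integration variable: for a fixed upper limit the integrals depend
  on \<open>x\<close> through \<open>sin (k x)\<close> and \<open>cos (k x)\<close> alone, which can be differentiated directly.
\<close>
lemma conv_split:
  fixes k :: complex
  assumes f: "f absolutely_integrable_on {0..b}"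
  shows "integral {0..b} (\<lambda>t. sin (k * of_real (x - t)) * f t) =
      sin (k * of_real x) * integral {0..b} (\<lambda>t. cos (k * of_real t) * f t)
      - cos (k * of_real x) * integral {0..b} (\<lambda>t. sin (k * of_real t) * f t)"
    and "integral {0..b} (\<lambda>t. cos (k * of_real (x - t)) * f t) =
      cos (k * of_real x) * integral {0..b} (\<lambda>t. cos (k * of_real t) * f t)
      + sin (k * of_real x) * integral {0..b} (\<lambda>t. sin (k * of_real t) * f t)"
proof -
  have c: "(\<lambda>t. cos (k * of_real t) * f t) integrable_on {0..b}"
    by (intro set_lebesgue_integral_eq_integral(1) absolutely_integrable_continuous_mult f continuous_intros)
  have s: "(\<lambda>t. sin (k * of_real t) * f t) integrable_on {0..b}"
    by (intro set_lebesgue_integral_eq_integral(1) absolutely_integrable_continuous_mult f continuous_intros)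
  show "integral {0..b} (\<lambda>t. sin (k * of_real (x - t)) * f t) =
      sin (k * of_real x) * integral {0..b} (\<lambda>t. cos (k * of_real t) * f t)
      - cos (k * of_real x) * integral {0..b} (\<lambda>t. sin (k * of_real t) * f t)"
    using c s
    by (subst integral_mult_right[symmetric] integral_diff[symmetric])+
       (auto intro!: integral_cong integrable_on_mult_right
         simp: right_diff_distrib sin_diff left_diff_distrib)
  show "integral {0..b} (\<lambda>t. cos (k * of_real (x - t)) * f t) =
      cos (k * of_real x) * integral {0..b} (\<lambda>t. cos (k * of_real t) * f t)
      + sin (k * of_real x) * integral {0..b} (\<lambda>t. sin (k * of_real t) * f t)"
    using c s
    by (subst integral_mult_right[symmetric] integral_add[symmetric])+
       (auto intro!: integral_cong integrable_on_mult_right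
         simp: right_diff_distrib cos_diff distrib_right)
qed

text \<open>
  An indefinite integral of an integrable \<open>f\<close> need not be differentiable at a given point. If the kernel
  vanishes on the diagonal, however, moving the upper limit from \<open>x\<close> to \<open>y\<close> changes the integral by at most
  \<open>K |y - x|\<close> times the integral of \<open>|f|\<close> between \<open>x\<close> and \<open>y\<close>. The second factor tends to zero, so only the
  dependence of the kernel on \<open>y\<close> contributes to the derivative, and it does so at every point.
\<close>
lemma moving_limit_has_vector_derivative:
  fixes f :: "real \<Rightarrow> complex" and G :: "real \<Rightarrow> real \<Rightarrow> complex"
  assumes f: "f absolutely_integrable_on {0..l}"
    and x: "x \<in> {0..l}"
    and G: "\<And>y. continuous_on {0..l} (G y)"
    and K: "\<And>y t. y \<in> {0..l} \<Longrightarrow> t \<in> {0..l} \<Longrightarrow> cmod (G y t) \<le> K * \<bar>y - t\<bar>"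
    and D: "((\<lambda>y. integral {0..x} (\<lambda>t. G y t * f t)) has_vector_derivative D) (at x within {0..l})"
  shows "((\<lambda>y. integral {0..y} (\<lambda>t. G y t * f t)) has_vector_derivative D) (at x within {0..l})"
proof -
  define N where "N = (\<lambda>y. integral {0..y} (\<lambda>t. cmod (f t)))"
  define R where "R = (\<lambda>y. integral {0..y} (\<lambda>t. G y t * f t) - integral {0..x} (\<lambda>t. G y t * f t))"
  have nf: "(\<lambda>t. cmod (f t)) integrable_on {0..l}"
    using f unfolding absolutely_integrable_on_def by auto
  have Gf: "(\<lambda>t. G y t * f t) integrable_on {0..l}" for y
    by (intro set_lebesgue_integral_eq_integral(1) absolutely_integrable_continuous_mult f G)
  have "continuous_on {0..l} N"
    unfolding N_def using nf by (rule indefinite_integral_continuous_1)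
  then have N: "(N \<longlongrightarrow> N x) (at x within {0..l})"
    using x by (simp add: continuous_on_def)
  have piece: "cmod (integral {a..b} (\<lambda>t. G y t * f t)) \<le> K * (b - a) * (N b - N a)"
    if "0 \<le> a" "a \<le> b" "b \<le> l" "y = a \<or> y = b" and K0: "0 \<le> K" for a b y
  proof -
    have "cmod (integral {a..b} (\<lambda>t. G y t * f t)) \<le> integral {a..b} (\<lambda>t. K * (b - a) * cmod (f t))"
    proof (rule integral_norm_bound_integral)
      show "(\<lambda>t. G y t * f t) integrable_on {a..b}"
        using that by (intro integrable_on_subinterval[OF Gf]) auto
      show "(\<lambda>t. K * (b - a) * cmod (f t)) integrable_on {a..b}"
        using that by (intro integrable_on_mult_right integrable_on_subinterval[OF nf]) auto
      fix t assume t: "t \<in> {a..b}"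
      have "cmod (G y t) \<le> K * \<bar>y - t\<bar>" using that t by (intro K) auto
      also have "\<dots> \<le> K * (b - a)" using that t by (intro mult_left_mono) auto
      finally show "cmod (G y t * f t) \<le> K * (b - a) * cmod (f t)"
        by (simp add: norm_mult mult_right_mono)
    qed
    also have "\<dots> = K * (b - a) * integral {a..b} (\<lambda>t. cmod (f t))" by simp
    also have "integral {a..b} (\<lambda>t. cmod (f t)) = N b - N a"
      using Henstock_Kurzweil_Integration.integral_combine[of 0 a b "\<lambda>t. cmod (f t)"] that
        integrable_on_subinterval[OF nf, of 0 b]
      by (simp add: N_def)
    finally show ?thesis .
  qed
  have bound: "cmod (R y) \<le> \<bar>K\<bar> * \<bar>y - x\<bar> * \<bar>N y - N x\<bar>" if y: "y \<in> {0..l}" for y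
  proof (cases "x = y")
    case False
    have K0: "0 \<le> K"
    proof -
      have "0 \<le> K * \<bar>y - x\<bar>" using K[of y x] x y norm_ge_zero order_trans by blast
      then show ?thesis using False by (simp add: zero_le_mult_iff)
    qed
    show ?thesis
    proof (cases "x \<le> y")
      case True
      have "R y = integral {x..y} (\<lambda>t. G y t * f t)"
        using Henstock_Kurzweil_Integration.integral_combine[of 0 x y "\<lambda>t. G y t * f t"] x y True
          integrable_on_subinterval[OF Gf[of y], of 0 y] by (simp add: R_def algebra_simps)
      then have "cmod (R y) \<le> K * (y - x) * (N y - N x)"
        using piece[of x y y] x y True K0 by simp
      also have "\<dots> \<le> K * (y - x) * \<bar>N y - N x\<bar>"
        using True K0 by (intro mult_left_mono) auto
      finally show ?thesis using K0 True by simp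
    next
      case c: False
      have "R y = - integral {y..x} (\<lambda>t. G y t * f t)"
        using Henstock_Kurzweil_Integration.integral_combine[of 0 y x "\<lambda>t. G y t * f t"] x y c
          integrable_on_subinterval[OF Gf[of y], of 0 x] by (simp add: R_def algebra_simps)
      then have "cmod (R y) \<le> K * (x - y) * (N x - N y)"
        using piece[of y x y] x y c K0 by simp
      also have "\<dots> \<le> K * (x - y) * \<bar>N y - N x\<bar>"
        using c K0 by (intro mult_left_mono) auto
      finally show ?thesis using K0 c by simp
    qed
  qed (simp add: R_def)
  have Rx: "R x = 0" by (simp add: R_def)
  have "((\<lambda>y. R y) has_vector_derivative 0) (at x within {0..l})"
    unfolding has_vector_derivative_def has_derivative_within
  proof (intro conjI)
    have lim: "((\<lambda>y. \<bar>K\<bar> * \<bar>N y - N x\<bar>) \<longlongrightarrow> 0) (at x within {0..l})"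
    proof -
      have "((\<lambda>y. \<bar>K\<bar> * \<bar>N y - N x\<bar>) \<longlongrightarrow> \<bar>K\<bar> * \<bar>N x - N x\<bar>) (at x within {0..l})"
        by (intro tendsto_intros N)
      then show ?thesis by simp
    qed
    show "((\<lambda>y. (1 / norm (y - x)) *\<^sub>R (R y - (R x + (y - x) *\<^sub>R 0))) \<longlongrightarrow> 0) (at x within {0..l})"
    proof (rule Lim_null_comparison[OF _ lim], unfold eventually_at_filter, rule always_eventually, intro allI impI)
      fix y assume "y \<noteq> x" "y \<in> {0..l}"
      then show "norm ((1 / norm (y - x)) *\<^sub>R (R y - (R x + (y - x) *\<^sub>R 0))) \<le> \<bar>K\<bar> * \<bar>N y - N x\<bar>"
        using bound[of y] Rx by (simp add: divide_simps mult_ac)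
    qed
  qed (rule bounded_linear_scaleR_left)
  from has_vector_derivative_add[OF D this] show ?thesis
    by (simp add: R_def)
qed

text \<open>
  The two kernels to which the preceding lemma is applied vanish on the diagonal at a Lipschitz rate.
\<close>
lemma sin_lipschitz_at_0:
  fixes k :: complex
  shows "\<exists>K. \<forall>s::real. \<bar>s\<bar> \<le> l \<longrightarrow> cmod (sin (k * of_real s)) \<le> K * \<bar>s\<bar> \<and>
            cmod (1 - cos (k * of_real s)) \<le> K * \<bar>s\<bar>"
proof -
  obtain B where B: "\<And>z. z \<in> cball 0 (cmod k * l) \<Longrightarrow> cmod (sin z) \<le> B"
  proof -
    have "bounded ((sin :: complex \<Rightarrow> complex) ` cball 0 (cmod k * l))"
      by (intro compact_imp_bounded compact_continuous_image continuous_intros) auto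
    then show ?thesis using that unfolding bounded_iff by blast
  qed
  obtain C where C: "\<And>z. z \<in> cball 0 (cmod k * l) \<Longrightarrow> cmod (cos z) \<le> C"
  proof -
    have "bounded ((cos :: complex \<Rightarrow> complex) ` cball 0 (cmod k * l))"
      by (intro compact_imp_bounded compact_continuous_image continuous_intros) auto
    then show ?thesis using that unfolding bounded_iff by blast
  qed
  have "cmod (sin (k * of_real s)) \<le> (max B C * cmod k) * \<bar>s\<bar> \<and>
            cmod (1 - cos (k * of_real s)) \<le> (max B C * cmod k) * \<bar>s\<bar>" if s: "\<bar>s\<bar> \<le> l" for s
  proof -
    have z: "k * of_real s \<in> cball 0 (cmod k * l)" and 0: "0 \<in> cball 0 (cmod k * l)"
      using s by (auto simp: norm_mult mult_left_mono)
    have "cmod (sin (k * of_real s) - sin 0) \<le> max B C * cmod (k * of_real s - 0)"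
    proof (rule field_differentiable_bound[OF convex_cball _ _ z 0])
      show "\<And>z. z \<in> cball 0 (cmod k * l) \<Longrightarrow> (sin has_field_derivative cos z) (at z within cball 0 (cmod k * l))"
        by (auto intro!: derivative_eq_intros)
      show "\<And>z. z \<in> cball 0 (cmod k * l) \<Longrightarrow> cmod (cos z) \<le> max B C" using C by (simp add: le_max_iff_disj)
    qed
    moreover have "cmod (cos (k * of_real s) - cos 0) \<le> max B C * cmod (k * of_real s - 0)"
    proof (rule field_differentiable_bound[OF convex_cball _ _ z 0])
      show "\<And>z. z \<in> cball 0 (cmod k * l) \<Longrightarrow> (cos has_field_derivative - sin z) (at z within cball 0 (cmod k * l))"
        by (auto intro!: derivative_eq_intros)
      show "\<And>z. z \<in> cball 0 (cmod k * l) \<Longrightarrow> cmod (- sin z) \<le> max B C" using B by (simp add: le_max_iff_disj)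
    qed
    ultimately show ?thesis by (simp add: norm_mult mult_ac norm_minus_commute)
  qed
  then show ?thesis by blast
qed

text \<open>
  The second part uses the kernel \<open>1 - cos\<close> instead of \<open>cos\<close>: subtracting the convolution from the indefinite
  integral of \<open>f\<close> removes the term \<open>f x\<close> that a formal differentiation would produce.
\<close>
lemma sin_conv_derivative:
  fixes k :: complex
  assumes f: "f absolutely_integrable_on {0..l}" and x: "x \<in> {0..l}"
  shows "(sin_conv k f has_vector_derivative k * cos_conv k f x) (at x within {0..l})"
    and "((\<lambda>y. integral {0..y} f - cos_conv k f y) has_vector_derivative k * sin_conv k f x) (at x within {0..l})"
proof -
  obtain K where K: "\<And>s::real. \<bar>s\<bar> \<le> l \<Longrightarrow> cmod (sin (k * of_real s)) \<le> K * \<bar>s\<bar> \<and>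
            cmod (1 - cos (k * of_real s)) \<le> K * \<bar>s\<bar>"
    using sin_lipschitz_at_0 by blast
  have fx: "f absolutely_integrable_on {0..x}"
    using absolutely_integrable_sub[OF f] x by auto
  have f1: "f integrable_on {0..x}"
    using fx by (rule set_lebesgue_integral_eq_integral(1))
  show "(sin_conv k f has_vector_derivative k * cos_conv k f x) (at x within {0..l})"
    unfolding sin_conv_def[abs_def]
  proof (rule moving_limit_has_vector_derivative[OF f x])
    show "\<And>y t. y \<in> {0..l} \<Longrightarrow> t \<in> {0..l} \<Longrightarrow> cmod (sin (k * complex_of_real (y - t))) \<le> K * \<bar>y - t\<bar>"
      by (rule conjunct1[OF K]) auto
    show "((\<lambda>y. integral {0..x} (\<lambda>t. sin (k * complex_of_real (y - t)) * f t)) has_vector_derivative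
        k * cos_conv k f x) (at x within {0..l})"
      unfolding conv_split[OF fx] cos_conv_def
      by (auto intro!: derivative_eq_intros sin_cos_has_vector_derivative simp: algebra_simps)
  qed (rule continuous_intros)
  have "((\<lambda>y. integral {0..y} (\<lambda>t. (1 - cos (k * complex_of_real (y - t))) * f t)) has_vector_derivative
        k * sin_conv k f x) (at x within {0..l})"
  proof (rule moving_limit_has_vector_derivative[OF f x])
    show "\<And>y t. y \<in> {0..l} \<Longrightarrow> t \<in> {0..l} \<Longrightarrow> cmod (1 - cos (k * complex_of_real (y - t))) \<le> K * \<bar>y - t\<bar>"
      by (rule conjunct2[OF K]) auto
    have c: "(\<lambda>t. cos (k * of_real (y - t)) * f t) integrable_on {0..x}" for y
      by (intro set_lebesgue_integral_eq_integral(1) absolutely_integrable_continuous_mult fx continuous_on_trig)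
    have "integral {0..x} (\<lambda>t. (1 - cos (k * complex_of_real (y - t))) * f t)
        = integral {0..x} f - integral {0..x} (\<lambda>t. cos (k * complex_of_real (y - t)) * f t)" for y
      unfolding left_diff_distrib mult_1 by (rule integral_diff[OF f1 c])
    note eq = this
    show "((\<lambda>y. integral {0..x} (\<lambda>t. (1 - cos (k * complex_of_real (y - t))) * f t)) has_vector_derivative
        k * sin_conv k f x) (at x within {0..l})"
      unfolding sin_conv_def eq conv_split[OF fx]
      by (auto intro!: derivative_eq_intros sin_cos_has_vector_derivative simp: algebra_simps)
  qed (intro continuous_intros)
  then show "((\<lambda>y. integral {0..y} f - cos_conv k f y) has_vector_derivative k * sin_conv k f x) (at x within {0..l})"
  proof (rule has_vector_derivative_transform[rotated 2])
    show "x \<in> {0..l}" by fact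
    fix y assume y: "y \<in> {0..l}"
    have fy: "f absolutely_integrable_on {0..y}"
      using absolutely_integrable_sub[OF f] y by auto
    have c: "(\<lambda>t. cos (k * of_real (y - t)) * f t) integrable_on {0..y}"
      by (intro set_lebesgue_integral_eq_integral(1) absolutely_integrable_continuous_mult fy continuous_on_trig)
    show "integral {0..y} f - cos_conv k f y = integral {0..y} (\<lambda>t. (1 - cos (k * complex_of_real (y - t))) * f t)"
      unfolding left_diff_distrib mult_1 cos_conv_def
      by (rule integral_diff[symmetric, OF set_lebesgue_integral_eq_integral(1)[OF fy] c])
  qed
qed

lemma conv_0 [simp]: "sin_conv k f 0 = 0" "cos_conv k f 0 = 0"
  by (simp_all add: sin_conv_def cos_conv_def)

lemma sin_conv_integral:
  assumes f: "f absolutely_integrable_on {0..l}" and x: "x \<in> {0..l}"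
  shows "((\<lambda>t. k * sin_conv k f t) has_integral (integral {0..x} f - cos_conv k f x)) {0..x}"
proof -
  have "((\<lambda>t. k * sin_conv k f t) has_integral
      ((integral {0..x} f - cos_conv k f x) - (integral {0..0} f - cos_conv k f 0))) {0..x}"
  proof (rule fundamental_theorem_of_calculus)
    fix y assume "y \<in> {0..x}"
    then show "((\<lambda>x. integral {0..x} f - cos_conv k f x) has_vector_derivative k * sin_conv k f y) (at y within {0..x})"
      using x by (intro has_vector_derivative_within_subset[OF sin_conv_derivative(2)[OF f]]) auto
  qed (use x in auto)
  then show ?thesis by simp
qed

text \<open>
  Variation of constants: the solution of \<open>- u'' - k\<^sup>2 u = f\<close> with \<open>u 0 = a\<close> and \<open>u' 0 = b\<close>, and its derivative.
\<close>
definition edge_sol :: "complex \<Rightarrow> complex \<Rightarrow> complex \<Rightarrow> (real \<Rightarrow> complex) \<Rightarrow> real \<Rightarrow> complex" where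
  "edge_sol k a b f x = a * cos (k * of_real x) + b / k * sin (k * of_real x) - sin_conv k f x / k"

definition edge_sol' :: "complex \<Rightarrow> complex \<Rightarrow> complex \<Rightarrow> (real \<Rightarrow> complex) \<Rightarrow> real \<Rightarrow> complex" where
  "edge_sol' k a b f x = b * cos (k * of_real x) - a * k * sin (k * of_real x) - cos_conv k f x"

lemma edge_sol_derivative:
  assumes f: "f absolutely_integrable_on {0..l}" and x: "x \<in> {0..l}" and k: "k \<noteq> 0"
  shows "(edge_sol k a b f has_vector_derivative edge_sol' k a b f x) (at x within {0..l})"
  unfolding edge_sol_def[abs_def] edge_sol'_def
  using k by (auto intro!: derivative_eq_intros sin_cos_has_vector_derivative
      sin_conv_derivative[OF f x] simp: field_simps)

lemma edge_sol_continuous: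
  assumes f: "f absolutely_integrable_on {0..l}" and k: "k \<noteq> 0"
  shows "continuous_on {0..l} (edge_sol k a b f)"
  using edge_sol_derivative[OF f _ k] by (rule continuous_on_vector_derivative)

text \<open>
  The differential equation in integrated form, which is how second derivatives of \<open>H\<^sup>2\<close> functions are
  defined.
\<close>
lemma edge_sol'_integral:
  assumes f: "f absolutely_integrable_on {0..l}" and x: "x \<in> {0..l}" and k: "k \<noteq> 0"
  shows "edge_sol' k a b f x = b + integral {0..x} (\<lambda>t. - k\<^sup>2 * edge_sol k a b f t - f t)"
proof -
  let ?h = "\<lambda>t. - k * (a * k * cos (k * of_real t)) - k * (b * sin (k * of_real t))"
  have h: "(?h has_integral
     ((b * cos (k * of_real x) - a * k * sin (k * of_real x)) -
      (b * cos (k * of_real 0) - a * k * sin (k * of_real 0)))) {0..x}"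
  proof (rule fundamental_theorem_of_calculus)
    fix y assume "y \<in> {0..x}"
    show "((\<lambda>x. b * cos (k * of_real x) - a * k * sin (k * of_real x)) has_vector_derivative ?h y) (at y within {0..x})"
      by (auto intro!: derivative_eq_intros sin_cos_has_vector_derivative simp: algebra_simps)
  qed (use x in auto)
  have f1: "(f has_integral integral {0..x} f) {0..x}"
    using absolutely_integrable_sub[OF f, of 0 x] x
    by (intro integrable_integral set_lebesgue_integral_eq_integral(1)) auto
  have hi: "((\<lambda>t. ?h t + k * sin_conv k f t - f t) has_integral
      (((b * cos (k * of_real x) - a * k * sin (k * of_real x)) - b)
       + (integral {0..x} f - cos_conv k f x) - integral {0..x} f)) {0..x}"
    by (rule has_integral_diff[OF has_integral_add[OF _ sin_conv_integral[OF f x]] f1]) (use h in simp)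
  have eq: "(\<lambda>t. ?h t + k * sin_conv k f t - f t) = (\<lambda>t. - k\<^sup>2 * edge_sol k a b f t - f t)"
    using k by (auto simp: edge_sol_def fun_eq_iff power2_eq_square field_simps)
  from hi have "integral {0..x} (\<lambda>t. - k\<^sup>2 * edge_sol k a b f t - f t) =
      (((b * cos (k * of_real x) - a * k * sin (k * of_real x)) - b)
       + (integral {0..x} f - cos_conv k f x) - integral {0..x} f)"
    unfolding eq by (rule integral_unique)
  then show ?thesis by (simp add: edge_sol'_def)
qed

lemma deriv1_eqI:
  assumes "(u has_vector_derivative v) (at x within {0..l})" "x \<in> {0..l}" "0 < l"
  shows "deriv1 l u x = v"
  unfolding deriv1_def using assms by (intro vector_derivative_within_closed_interval) auto

lemma edge_sol_deriv1:
  assumes "f \<in> L2 l" "0 < l" "k \<noteq> 0" "x \<in> {0..l}"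
  shows "deriv1 l (edge_sol k a b f) x = edge_sol' k a b f x"
  using assms by (intro deriv1_eqI edge_sol_derivative L2_absolutely_integrable)

lemma edge_sol_has_deriv2:
  assumes f: "f \<in> L2 l" and l: "0 < l" and k: "k \<noteq> 0"
  shows "has_deriv2 l (edge_sol k a b f) (\<lambda>x. - k\<^sup>2 * edge_sol k a b f x - f x)"
proof -
  note ai = L2_absolutely_integrable[OF f]
  have "(\<lambda>x. - 1 * f x + - k\<^sup>2 * edge_sol k a b f x) \<in> L2 l"
    by (intro L2_lincomb f L2_continuous continuous_intros edge_sol_continuous[OF ai k])
  also have "(\<lambda>x. - 1 * f x + - k\<^sup>2 * edge_sol k a b f x) = (\<lambda>x. - k\<^sup>2 * edge_sol k a b f x - f x)"
    by auto
  finally have "(\<lambda>x. - k\<^sup>2 * edge_sol k a b f x - f x) \<in> L2 l" .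
  moreover have "edge_sol k a b f differentiable_on {0..l}"
    unfolding differentiable_on_def
    using edge_sol_derivative[OF ai _ k] differentiableI_vector by blast
  moreover have "deriv1 l (edge_sol k a b f) 0 = b"
    using edge_sol_deriv1[OF f l k, of 0] l by (simp add: edge_sol'_def)
  ultimately show ?thesis
    unfolding has_deriv2_def using edge_sol_deriv1[OF f l k] edge_sol'_integral[OF ai _ k] by simp
qed

text \<open>
  Allows an arbitrary choice of second derivative to be replaced by the one given by a formula.
\<close>
lemma has_deriv2_unique:
  assumes "has_deriv2 l u w1" "has_deriv2 l u w2"
  shows "aeq l w1 w2"
proof (rule indefinite_integral_unique)
  show "w1 integrable_on {0..l}" "w2 integrable_on {0..l}"
    using assms L2_absolutely_integrable set_lebesgue_integral_eq_integral(1)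
    unfolding has_deriv2_def by blast+
  show "integral {0..x} w1 = integral {0..x} w2" if "x \<in> {0..l}" for x
    using assms that unfolding has_deriv2_def by (metis add_left_imp_eq)
qed

definition edge_equation :: "real \<Rightarrow> complex \<Rightarrow> (real \<Rightarrow> complex) \<Rightarrow> (real \<Rightarrow> complex) \<Rightarrow> bool" where
  "edge_equation l lam f u \<longleftrightarrow> u \<in> H2 l \<and> aeq l (\<lambda>x. - deriv2 l u x - lam * u x) f"

lemma edge_sol_edge_equation:
  assumes f: "f \<in> L2 l" and l: "0 < l" and k: "k \<noteq> 0"
  shows "edge_equation l (k\<^sup>2) f (edge_sol k a b f)"
proof -
  let ?y = "edge_sol k a b f"
  note h = edge_sol_has_deriv2[OF f l k, of a b]
  then have "\<exists>w. has_deriv2 l ?y w" by blast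
  then have "has_deriv2 l ?y (deriv2 l ?y)"
    unfolding deriv2_def by (rule someI_ex)
  from has_deriv2_unique[OF this h] have "aeq l (deriv2 l ?y) (\<lambda>x. - k\<^sup>2 * ?y x - f x)" .
  then have "aeq l (\<lambda>x. - deriv2 l ?y x - k\<^sup>2 * ?y x) f"
    unfolding aeq_def by eventually_elim simp
  with h show ?thesis by (auto simp: edge_equation_def H2_def)
qed

text \<open>
  The difference \<open>d\<close> of two solutions with the same initial data is a classical solution of \<open>d'' = - k\<^sup>2 d\<close>. For
  such a \<open>d\<close> the two combinations \<open>d' cos + k d sin\<close> and \<open>d' sin - k d cos\<close> are constant, hence zero, and
  \<open>sin\<^sup>2 + cos\<^sup>2 = 1\<close> recovers \<open>d\<close> and \<open>d'\<close> from them.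
\<close>
lemma edge_equation_unique:
  assumes u: "edge_equation l (k\<^sup>2) f u" and f: "f \<in> L2 l" and l: "0 < l" and k: "k \<noteq> 0" and x: "x \<in> {0..l}"
  shows "u x = edge_sol k (u 0) (deriv1 l u 0) f x"
    and "deriv1 l u x = edge_sol' k (u 0) (deriv1 l u 0) f x"
proof -
  note ai = L2_absolutely_integrable[OF f]
  let ?y = "edge_sol k (u 0) (deriv1 l u 0) f"
  let ?y' = "edge_sol' k (u 0) (deriv1 l u 0) f"
  define w where "w = deriv2 l u"
  have "\<exists>w. has_deriv2 l u w" using u by (auto simp: edge_equation_def H2_def)
  then have w: "has_deriv2 l u w"
    unfolding w_def deriv2_def by (rule someI_ex)
  have ae: "aeq l (\<lambda>x. - w x - k\<^sup>2 * u x) f"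
    using u by (simp add: edge_equation_def w_def)
  have ae: "aeq l w (\<lambda>x. - k\<^sup>2 * u x - f x)"
    using ae unfolding aeq_def
  proof eventually_elim
    case (elim x)
    show ?case by (simp flip: elim)
  qed
  have du: "(u has_vector_derivative deriv1 l u x) (at x within {0..l})" if "x \<in> {0..l}" for x
    using w that unfolding has_deriv2_def deriv1_def differentiable_on_def
    by (metis vector_derivative_works)
  have cu: "continuous_on {0..l} u"
    using du by (rule continuous_on_vector_derivative)
  have d1: "deriv1 l u x = deriv1 l u 0 + integral {0..x} (\<lambda>x. - k\<^sup>2 * u x - f x)" if "x \<in> {0..l}" for x
  proof -
    have "deriv1 l u x = deriv1 l u 0 + integral {0..x} w"
      using w that unfolding has_deriv2_def by blast
    then show ?thesis unfolding integral_cong_aeq[OF ae that] .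
  qed
  define d where "d = (\<lambda>x. u x - ?y x)"
  define d' where "d' = (\<lambda>x. deriv1 l u x - ?y' x)"
  have cd: "continuous_on {0..l} d"
    unfolding d_def by (intro continuous_intros cu edge_sol_continuous[OF ai k])
  have dd: "(d has_vector_derivative d' x) (at x within {0..l})" if "x \<in> {0..l}" for x
    unfolding d_def d'_def using that by (intro derivative_intros du edge_sol_derivative[OF ai _ k])
  have d'_int: "d' x = integral {0..x} (\<lambda>t. - k\<^sup>2 * d t)" if x: "x \<in> {0..l}" for x
  proof -
    have fx: "f integrable_on {0..x}"
      using absolutely_integrable_sub[OF ai, of 0 x] x
      by (intro set_lebesgue_integral_eq_integral(1)) auto
    have i: "(\<lambda>t. - k\<^sup>2 * v t - f t) integrable_on {0..x}" if "continuous_on {0..l} v" for v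
      using that x
      by (intro integrable_diff fx integrable_continuous_interval continuous_intros)
         (auto elim: continuous_on_subset)
    have "d' x = integral {0..x} (\<lambda>x. - k\<^sup>2 * u x - f x) - integral {0..x} (\<lambda>x. - k\<^sup>2 * ?y x - f x)"
      using d1[OF x] edge_sol'_integral[OF ai x k, of "u 0" "deriv1 l u 0"] by (simp add: d'_def)
    also have "\<dots> = integral {0..x} (\<lambda>x. (- k\<^sup>2 * u x - f x) - (- k\<^sup>2 * ?y x - f x))"
      by (intro integral_diff[symmetric] i cu edge_sol_continuous[OF ai k])
    also have "\<dots> = integral {0..x} (\<lambda>t. - k\<^sup>2 * d t)"
      by (rule integral_cong) (simp add: d_def algebra_simps)
    finally show ?thesis .
  qed
  have dd': "(d' has_vector_derivative - k\<^sup>2 * d x) (at x within {0..l})" if x: "x \<in> {0..l}" for x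
  proof (rule has_vector_derivative_transform[OF x d'_int])
    show "((\<lambda>x. integral {0..x} (\<lambda>t. - k\<^sup>2 * d t)) has_vector_derivative - k\<^sup>2 * d x) (at x within {0..l})"
      using x by (intro integral_has_vector_derivative continuous_intros cd)
  qed
  have d0: "d 0 = 0" "d' 0 = 0"
    using l by (simp_all add: d_def d'_def edge_sol_def edge_sol'_def)
  let ?s = "\<lambda>x::real. sin (k * of_real x)" and ?c = "\<lambda>x::real. cos (k * of_real x)"
  have e: "d' x * ?c x + k * d x * ?s x = 0" if "x \<in> {0..l}" for x
  proof -
    have "((\<lambda>x. d' x * ?c x + k * d x * ?s x) has_vector_derivative 0) (at x within {0..l})" if "x \<in> {0..l}" for x
      by (rule has_vector_derivative_eq_rhs, (rule derivative_intros dd[OF that] dd'[OF that] sin_cos_has_vector_derivative)+)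
         (simp add: algebra_simps power2_eq_square)
    then obtain c where c: "\<And>x. x \<in> {0..l} \<Longrightarrow> d' x * ?c x + k * d x * ?s x = c"
      using has_vector_derivative_zero_constant[OF convex_real_interval(5)] by blast
    from c[of 0] have "c = 0" using l d0 by simp
    with c that show ?thesis by simp
  qed
  have g: "d' x * ?s x - k * d x * ?c x = 0" if "x \<in> {0..l}" for x
  proof -
    have "((\<lambda>x. d' x * ?s x - k * d x * ?c x) has_vector_derivative 0) (at x within {0..l})" if "x \<in> {0..l}" for x
      by (rule has_vector_derivative_eq_rhs, (rule derivative_intros dd[OF that] dd'[OF that] sin_cos_has_vector_derivative)+)
         (simp add: algebra_simps power2_eq_square)
    then obtain c where c: "\<And>x. x \<in> {0..l} \<Longrightarrow> d' x * ?s x - k * d x * ?c x = c"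
      using has_vector_derivative_zero_constant[OF convex_real_interval(5)] by blast
    from c[of 0] have "c = 0" using l d0 by simp
    with c that show ?thesis by simp
  qed
  have sc: "?s x * ?s x + ?c x * ?c x = 1"
    using sin_cos_squared_add[of "k * of_real x"] by (simp add: power2_eq_square)
  have "d' x * (?s x * ?s x + ?c x * ?c x)
      = (d' x * ?c x + k * d x * ?s x) * ?c x + (d' x * ?s x - k * d x * ?c x) * ?s x"
    by algebra
  then have "d' x = 0" unfolding e[OF x] g[OF x] sc by simp
  moreover have "k * d x * (?s x * ?s x + ?c x * ?c x)
      = (d' x * ?c x + k * d x * ?s x) * ?s x - (d' x * ?s x - k * d x * ?c x) * ?c x"
    by algebra
  then have "d x = 0" unfolding e[OF x] g[OF x] sc using k by simp
  ultimately show "u x = ?y x" "deriv1 l u x = ?y' x"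
    by (simp_all add: d_def d'_def)
qed

lemma L_op_eq_edge_sol: "L_op k f = edge_sol k 0 0 f"
  by (simp add: fun_eq_iff L_op_def edge_sol_def sin_conv_def)

lemma L_op_in_H2:
  assumes "k \<noteq> 0" "g \<in> L2 1"
  shows "L_op k g \<in> H2 1"
  using edge_sol_edge_equation[OF assms(2) _ assms(1), of 0 0] by (simp add: L_op_eq_edge_sol edge_equation_def)

section \<open>Holomorphic dependence of convolutions on the frequency\<close>

text \<open>
  The constants come from Cauchy's inequality on discs of radius \<open>R/4\<close>, which stay inside \<open>ball 0 R\<close> when centred
  in the half-size ball. They are linear in \<open>M\<close>, and this is the point: with \<open>M\<close> proportional to the norm of \<open>f\<close>,
  pointwise bounds become operator norm bounds.
\<close>
lemma Cauchy_Taylor_bounds: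
  assumes hol: "g holomorphic_on ball 0 R" and R: "0 < R"
    and M: "\<And>z. z \<in> ball 0 R \<Longrightarrow> cmod (g z) \<le> M"
    and z: "z \<in> ball 0 (R/2)" and w: "w \<in> ball 0 (R/2)"
  shows "cmod (deriv g z) \<le> 4 * M / R"
    and "cmod (g w - g z) \<le> 4 * M / R * cmod (w - z)"
    and "cmod (g w - g z - (w - z) * deriv g z) \<le> 32 * M / R\<^sup>2 * (cmod (w - z))\<^sup>2"
proof -
  have bd: "cmod ((deriv ^^ n) g z) \<le> fact n * M / (R/4) ^ n" if z: "z \<in> ball 0 (R/2)" for n z
  proof -
    have sub: "cball z (R/4) \<subseteq> ball 0 R"
    proof
      fix y assume "y \<in> cball z (R/4)"
      then have "cmod y \<le> cmod z + R/4"
        using norm_triangle_ineq[of z "y - z"] by (simp add: dist_norm norm_minus_commute)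
      then show "y \<in> ball 0 R" using z R by simp
    qed
    show ?thesis
    proof (rule Cauchy_inequality)
      show "g holomorphic_on ball z (R/4)"
        using holomorphic_on_subset[OF hol] sub ball_subset_cball by blast
      show "continuous_on (cball z (R/4)) g"
        using holomorphic_on_imp_continuous_on[OF hol] sub continuous_on_subset by blast
      show "0 < R/4" using R by simp
      show "\<And>x. cmod (z - x) = R/4 \<Longrightarrow> cmod (g x) \<le> M"
        using sub by (intro M) (auto simp: dist_norm subset_iff)
    qed
  qed
  have der: "((deriv ^^ i) g has_field_derivative (deriv ^^ Suc i) g x) (at x within ball 0 (R/2))"
    if "x \<in> ball 0 (R/2)" for i x
  proof -
    have "(deriv ^^ i) g holomorphic_on ball 0 R"
      using hol by (rule holomorphic_higher_deriv) auto
    then have "((deriv ^^ i) g has_field_derivative deriv ((deriv ^^ i) g) x) (at x)"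
      by (rule holomorphic_derivI) (use that R in auto)
    then show ?thesis by (simp add: has_field_derivative_at_within)
  qed
  show "cmod (deriv g z) \<le> 4 * M / R"
    using bd[OF z, of 1] by (simp add: mult.commute)
  have "cmod ((deriv ^^ 0) g w - (\<Sum>i\<le>0. (deriv ^^ i) g z * (w - z) ^ i / fact i))
      \<le> (fact 1 * M / (R/4) ^ 1) * cmod (w - z) ^ Suc 0 / fact 0"
    by (rule complex_Taylor[OF convex_ball _ _ z w]) (use der[of _ 0] bd[of _ 1] in auto)
  then show "cmod (g w - g z) \<le> 4 * M / R * cmod (w - z)"
    by (simp add: mult.commute)
  have "cmod ((deriv ^^ 0) g w - (\<Sum>i\<le>1. (deriv ^^ i) g z * (w - z) ^ i / fact i))
      \<le> (fact 2 * M / (R/4) ^ 2) * cmod (w - z) ^ Suc 1 / fact 1"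
  proof (rule complex_Taylor[OF convex_ball _ _ z w])
    show "\<And>x. x \<in> ball 0 (R / 2) \<Longrightarrow> cmod ((deriv ^^ Suc 1) g x) \<le> fact 2 * M / (R / 4)\<^sup>2"
      using bd[of _ 2] by (simp add: numeral_2_eq_2)
  qed (use der in auto)
  then show "cmod (g w - g z - (w - z) * deriv g z) \<le> 32 * M / R\<^sup>2 * (cmod (w - z))\<^sup>2"
    by (simp add: power2_eq_square field_simps)
qed

lemma has_field_derivative_quadratic:
  fixes g :: "complex \<Rightarrow> complex"
  assumes S: "open S" "z \<in> S"
    and C: "\<And>w. w \<in> S \<Longrightarrow> cmod (g w - g z - (w - z) * D) \<le> C * (cmod (w - z))\<^sup>2"
  shows "(g has_field_derivative D) (at z)"
  unfolding has_field_derivative_iff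
proof (rule LIM_zero_cancel, rule Lim_null_comparison)
  have "((\<lambda>w. C * cmod (w - z)) \<longlongrightarrow> C * cmod (z - z)) (at z)"
    by (intro tendsto_intros)
  then show "((\<lambda>w. C * cmod (w - z)) \<longlongrightarrow> 0) (at z)" by simp
  have "\<forall>\<^sub>F w in at z. w \<in> S" using S by (simp add: eventually_at_in_open')
  moreover have "\<forall>\<^sub>F w in at z. w \<noteq> z" by (simp add: eventually_at_filter)
  ultimately show "\<forall>\<^sub>F w in at z. norm ((g w - g z) / (w - z) - D) \<le> C * cmod (w - z)"
  proof eventually_elim
    case (elim w)
    then have "(g w - g z) / (w - z) - D = (g w - g z - (w - z) * D) / (w - z)"
      by (simp add: diff_divide_distrib)
    also have "cmod \<dots> \<le> C * (cmod (w - z))\<^sup>2 / cmod (w - z)"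
      unfolding norm_divide using C elim by (intro divide_right_mono) auto
    finally show ?case using elim by (simp add: power2_eq_square)
  qed
qed

text \<open>
  Differentiation under the integral sign for an \<open>f\<close> that is merely integrable. The Taylor remainder of the entire kernel is
  quadratic in \<open>w - z\<close>, uniformly in \<open>t\<close>, and therefore remains so after integration against \<open>f\<close>.
\<close>
lemma kernel_integral_holomorphic:
  assumes \<phi>: "\<phi> holomorphic_on UNIV" and f: "f \<in> L2 1" and x: "x \<in> {0..1}"
  shows "(\<lambda>\<kappa>. integral {0..x} (\<lambda>t. \<phi> (\<kappa> * of_real (x - t)) * f t)) holomorphic_on UNIV"
proof -
  let ?G = "\<lambda>\<kappa>. integral {0..x} (\<lambda>t. \<phi> (\<kappa> * of_real (x - t)) * f t)"
  have ai: "f absolutely_integrable_on {0..x}"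
    using absolutely_integrable_sub[OF L2_absolutely_integrable[OF f], of 0 x] x by auto
  have d\<phi>: "deriv \<phi> holomorphic_on UNIV" using \<phi> by (rule holomorphic_deriv) auto
  have c: "continuous_on A (\<lambda>t::real. h (\<kappa> * of_real (x - t)))" if "h holomorphic_on UNIV" for h \<kappa> A
    by (rule continuous_on_compose2[OF holomorphic_on_imp_continuous_on[OF that]])
       (auto intro!: continuous_intros)
  have "\<exists>D. (?G has_field_derivative D) (at z)" for z
  proof -
    \<comment> \<open>Any radius with \<open>z\<close> in the half-size ball works.\<close>
    define R where "R = 2 * (cmod z + 1)"
    have R: "0 < R" by (simp add: R_def add_nonneg_pos)
    have zR: "z \<in> ball 0 (R/2)" by (simp add: R_def)
    have "bounded (\<phi> ` cball 0 R)"
      using holomorphic_on_imp_continuous_on[OF \<phi>]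
      by (intro compact_imp_bounded compact_continuous_image) (auto elim: continuous_on_subset)
    then obtain M where M: "\<And>y. y \<in> cball 0 R \<Longrightarrow> cmod (\<phi> y) \<le> M"
      unfolding bounded_iff by blast
    let ?d = "\<lambda>t. of_real (x - t) * deriv \<phi> (z * of_real (x - t))"
    have quad: "cmod (\<phi> (w * of_real (x - t)) - \<phi> (z * of_real (x - t)) - (w - z) * ?d t)
        \<le> 32 * M / R\<^sup>2 * (cmod (w - z))\<^sup>2" if t: "t \<in> {0..x}" and w: "w \<in> ball 0 (R/2)" for t :: real and w :: complex
    proof -
      let ?g = "\<lambda>\<kappa>. \<phi> (\<kappa> * of_real (x - t))"
      have "?g holomorphic_on ball 0 R"
        by (rule holomorphic_on_compose_gen[OF _ \<phi>, unfolded o_def]) (auto intro!: holomorphic_intros)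
      moreover have "cmod (?g y) \<le> M" if "y \<in> ball 0 R" for y
      proof (rule M)
        have "cmod y * \<bar>x - t\<bar> \<le> R * 1"
          using that t x R by (intro mult_mono) auto
        then show "y * of_real (x - t) \<in> cball 0 R"
          by (simp add: norm_mult flip: of_real_diff)
      qed
      ultimately have "cmod (?g w - ?g z - (w - z) * deriv ?g z) \<le> 32 * M / R\<^sup>2 * (cmod (w - z))\<^sup>2"
        using zR w by (intro Cauchy_Taylor_bounds(3)[OF _ R])
      moreover have "deriv ?g z = ?d t"
      proof (rule DERIV_imp_deriv)
        have "(\<phi> has_field_derivative deriv \<phi> (z * of_real (x - t))) (at (z * of_real (x - t)))"
          using \<phi> by (intro holomorphic_derivI) auto
        moreover have "((\<lambda>\<kappa>. \<kappa> * of_real (x - t)) has_field_derivative of_real (x - t)) (at z)"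
          by (auto intro!: derivative_eq_intros)
        ultimately show "(?g has_field_derivative ?d t) (at z)"
          using DERIV_chain2 by (fastforce simp: mult.commute)
      qed
      ultimately show ?thesis by simp
    qed
    have cd: "continuous_on A ?d" for A
      by (intro continuous_intros c d\<phi>)
    have int: "(\<lambda>t. h t * f t) integrable_on {0..x}" if "continuous_on {0..x} h" for h
      using absolutely_integrable_continuous_mult[OF ai that]
      by (rule set_lebesgue_integral_eq_integral(1))
    have "(?G has_field_derivative integral {0..x} (\<lambda>t. ?d t * f t)) (at z)"
    proof (rule has_field_derivative_quadratic[OF open_ball zR])
      fix w :: complex assume w: "w \<in> ball 0 (R/2)"
      have "?G w - ?G z - (w - z) * integral {0..x} (\<lambda>t. ?d t * f t)
          = integral {0..x} (\<lambda>t. \<phi> (w * of_real (x - t)) * f t - \<phi> (z * of_real (x - t)) * f t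
              - (w - z) * (?d t * f t))"
        by (simp only: integral_mult_right integral_diff int c \<phi> cd integrable_diff integrable_on_mult_right)
      also have "\<dots> = integral {0..x}
          (\<lambda>t. (\<phi> (w * of_real (x - t)) - \<phi> (z * of_real (x - t)) - (w - z) * ?d t) * f t)"
        by (rule integral_cong) (simp add: algebra_simps)
      also have "cmod \<dots> \<le> 32 * M / R\<^sup>2 * (cmod (w - z))\<^sup>2 * norm_L2 1 f"
      proof (rule norm_integral_kernel_le[OF f])
        show "continuous_on {0..x}
            (\<lambda>t. \<phi> (w * of_real (x - t)) - \<phi> (z * of_real (x - t)) - (w - z) * ?d t)"
          by (rule continuous_on_diff[OF continuous_on_diff[OF c[OF \<phi>] c[OF \<phi>]]
                continuous_on_mult[OF continuous_on_const cd]])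
      qed (use x quad[OF _ w] in auto)
      finally show "cmod (?G w - ?G z - (w - z) * integral {0..x} (\<lambda>t. ?d t * f t))
          \<le> (32 * M / R\<^sup>2 * norm_L2 1 f) * (cmod (w - z))\<^sup>2"
        by (simp add: mult_ac)
    qed
    then show ?thesis by blast
  qed
  then show ?thesis
    by (auto simp: holomorphic_on_def field_differentiable_def)
qed

lemma conv_holomorphic:
  assumes "f \<in> L2 1" "x \<in> {0..1}"
  shows "(\<lambda>\<kappa>. sin_conv \<kappa> f x) holomorphic_on A" "(\<lambda>\<kappa>. cos_conv \<kappa> f x) holomorphic_on A"
  unfolding sin_conv_def cos_conv_def
  by (rule holomorphic_on_subset[OF kernel_integral_holomorphic[of sin, OF holomorphic_on_sin assms] subset_UNIV]
        holomorphic_on_subset[OF kernel_integral_holomorphic[of cos, OF holomorphic_on_cos assms] subset_UNIV])+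

text \<open>
  Continuity in \<open>x\<close> makes the images of the operators measurable.
\<close>
lemma conv_continuous:
  assumes f: "f \<in> L2 1"
  shows "continuous_on {0..1} (sin_conv \<kappa> f)" "continuous_on {0..1} (cos_conv \<kappa> f)"
proof -
  note ai = L2_absolutely_integrable[OF f]
  show "continuous_on {0..1} (sin_conv \<kappa> f)"
    using sin_conv_derivative(1)[OF ai] by (rule continuous_on_vector_derivative)
  have "continuous_on {0..1} (\<lambda>y. integral {0..y} f - cos_conv \<kappa> f y)"
    using sin_conv_derivative(2)[OF ai] by (rule continuous_on_vector_derivative)
  then have "continuous_on {0..1} (\<lambda>y. integral {0..y} f - (integral {0..y} f - cos_conv \<kappa> f y))"
    by (rule continuous_on_diff[OF indefinite_integral_continuous_1[OF set_lebesgue_integral_eq_integral(1)[OF ai]]])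
  then show "continuous_on {0..1} (cos_conv \<kappa> f)" by simp
qed

lemma conv_bound:
  "\<exists>B. \<forall>\<kappa> f x. cmod \<kappa> \<le> M \<longrightarrow> f \<in> L2 1 \<longrightarrow> x \<in> {0..1} \<longrightarrow>
      cmod (sin_conv \<kappa> f x) \<le> B * norm_L2 1 f \<and> cmod (cos_conv \<kappa> f x) \<le> B * norm_L2 1 f"
proof -
  have "bounded ((sin :: complex \<Rightarrow> complex) ` cball 0 M)" "bounded ((cos :: complex \<Rightarrow> complex) ` cball 0 M)"
    by (intro compact_imp_bounded compact_continuous_image continuous_intros; simp)+
  then obtain B C where B: "\<And>z. z \<in> cball 0 M \<Longrightarrow> cmod (sin z) \<le> B" 
      and C: "\<And>z. z \<in> cball 0 M \<Longrightarrow> cmod (cos z) \<le> C"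
    unfolding bounded_iff by blast
  have "cmod (sin_conv \<kappa> f x) \<le> max B C * norm_L2 1 f \<and> cmod (cos_conv \<kappa> f x) \<le> max B C * norm_L2 1 f"
    if \<kappa>: "cmod \<kappa> \<le> M" and f: "f \<in> L2 1" and x: "x \<in> {0..1}" for \<kappa> f x
  proof -
    have k: "\<kappa> * of_real (x - t) \<in> cball 0 M" if "t \<in> {0..x}" for t
    proof -
      have "cmod \<kappa> * \<bar>x - t\<bar> \<le> M * 1"
        using that \<kappa> x by (intro mult_mono) (auto intro: order_trans[OF norm_ge_zero])
      then show ?thesis by (simp add: norm_mult flip: of_real_diff)
    qed
    show ?thesis
      unfolding sin_conv_def cos_conv_def
    proof (intro conjI norm_integral_kernel_le[OF f] continuous_on_trig)
      fix t assume "t \<in> {0..x}"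
      from B[OF k[OF this]] C[OF k[OF this]]
      show "cmod (sin (\<kappa> * of_real (x - t))) \<le> max B C" "cmod (cos (\<kappa> * of_real (x - t))) \<le> max B C"
        by (simp_all add: le_max_iff_disj)
    qed (use x in auto)
  qed
  then show ?thesis by blast
qed

lemma conv_linear:
  assumes f: "f \<in> L2 1" and g: "g \<in> L2 1" and x: "x \<in> {0..1}"
  shows "sin_conv \<kappa> (\<lambda>t. c * f t + g t) x = c * sin_conv \<kappa> f x + sin_conv \<kappa> g x"
    and "cos_conv \<kappa> (\<lambda>t. c * f t + g t) x = c * cos_conv \<kappa> f x + cos_conv \<kappa> g x"
proof -
  have int: "(\<lambda>t. h t * u t) integrable_on {0..x}" if "u \<in> L2 1" "continuous_on {0..x} h" for h u
    using absolutely_integrable_continuous_mult[OF _ that(2), of u]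
      absolutely_integrable_sub[OF L2_absolutely_integrable[OF that(1)], of 0 x] x
    by (intro set_lebesgue_integral_eq_integral(1)) auto
  have lin: "integral {0..x} (\<lambda>t. h t * (c * f t + g t))
      = c * integral {0..x} (\<lambda>t. h t * f t) + integral {0..x} (\<lambda>t. h t * g t)"
    if "continuous_on {0..x} h" for h
  proof -
    have "integral {0..x} (\<lambda>t. h t * (c * f t + g t)) = integral {0..x} (\<lambda>t. c * (h t * f t) + h t * g t)"
      by (rule integral_cong) (simp add: algebra_simps)
    also have "\<dots> = c * integral {0..x} (\<lambda>t. h t * f t) + integral {0..x} (\<lambda>t. h t * g t)"
      using int[OF f that] int[OF g that] by (simp add: integral_add integrable_on_mult_right)
    finally show ?thesis .
  qed
  show "sin_conv \<kappa> (\<lambda>t. c * f t + g t) x = c * sin_conv \<kappa> f x + sin_conv \<kappa> g x"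
    "cos_conv \<kappa> (\<lambda>t. c * f t + g t) x = c * cos_conv \<kappa> f x + cos_conv \<kappa> g x"
    unfolding sin_conv_def cos_conv_def by (rule lin, rule continuous_on_trig)+
qed

section \<open>Holomorphic families of operators\<close>

text \<open>
  Linearity and boundedness at every single point of \<open>(0, 1)\<close>. This is stronger than boundedness between \<open>L\<^sub>2\<close> spaces, holds for
  all operators below, and avoids almost-everywhere arguments.
\<close>
definition sup_bounded_op :: "gop \<Rightarrow> real \<Rightarrow> bool" where
  "sup_bounded_op A K \<longleftrightarrow> 0 \<le> K \<and>
     (\<forall>f\<in>L2G 1. A f \<in> borel_measurable (lebesgue_on {0<..<1})) \<and>
     (\<forall>f\<in>L2G 1. \<forall>g\<in>L2G 1. \<forall>c. \<forall>x\<in>{0<..<1}.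
        A ((\<lambda>x. c * fst f x + fst g x), (\<lambda>x. c * snd f x + snd g x)) x = c * A f x + A g x) \<and>
     (\<forall>f\<in>L2G 1. \<forall>x\<in>{0<..<1}. cmod (A f x) \<le> K * norm_L2G 1 f)"

lemma sup_bounded_opD:
  assumes "sup_bounded_op A K"
  shows "0 \<le> K" "\<And>f. f \<in> L2G 1 \<Longrightarrow> A f \<in> borel_measurable (lebesgue_on {0<..<1})"
    "\<And>f g c x. f \<in> L2G 1 \<Longrightarrow> g \<in> L2G 1 \<Longrightarrow> x \<in> {0<..<1} \<Longrightarrow>
        A ((\<lambda>x. c * fst f x + fst g x), (\<lambda>x. c * snd f x + snd g x)) x = c * A f x + A g x"
    "\<And>f x. f \<in> L2G 1 \<Longrightarrow> x \<in> {0<..<1} \<Longrightarrow> cmod (A f x) \<le> K * norm_L2G 1 f"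
  using assms unfolding sup_bounded_op_def by blast+

lemma norm_L2G_nonneg [simp]: "0 \<le> norm_L2G l f"
  by (simp add: norm_L2G_def)

lemma norm_L2_le_norm_L2G:
  "norm_L2 1 (fst f) \<le> norm_L2G 1 f" "norm_L2 1 (snd f) \<le> norm_L2G 1 f"
  unfolding norm_L2G_def by (auto intro!: real_le_rsqrt)

lemma L2G_comb:
  assumes "f \<in> L2G 1" "g \<in> L2G 1"
  shows "((\<lambda>x. c * fst f x + fst g x), (\<lambda>x. c * snd f x + snd g x)) \<in> L2G 1"
  using assms by (auto simp: L2G_def intro!: L2_lincomb)

lemma norm_L2_le_sup:
  assumes h: "h \<in> borel_measurable (lebesgue_on {0<..<1})"
    and M: "\<And>x. x \<in> {0<..<1} \<Longrightarrow> cmod (h x) \<le> M" "0 \<le> M"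
  shows "norm_L2 1 h \<le> M"
proof -
  interpret finite_measure "lebesgue_on {0<..<1::real}"
    by (simp add: finite_measure_lebesgue_on)
  have i: "integrable (lebesgue_on {0<..<1}) (\<lambda>x. (cmod (h x))\<^sup>2)"
    using L2_bounded[OF h M(1)] by (simp add: L2_def)
  have "(LINT x|lebesgue_on {0<..<1}. (cmod (h x))\<^sup>2) \<le> (LINT x|lebesgue_on {0<..<1::real}. M\<^sup>2)"
    using M by (intro integral_mono i) (auto intro!: power_mono)
  also have "\<dots> = M\<^sup>2" by (simp add: measure_restrict_space)
  finally have "norm_L2 1 h \<le> sqrt (M\<^sup>2)"
    unfolding norm_L2_def by (rule real_sqrt_le_mono)
  then show ?thesis using M(2) by simp
qed

lemma sup_bounded_op_bounded_op:
  assumes A: "sup_bounded_op A K"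
  shows "bounded_op A"
proof -
  note D = sup_bounded_opD[OF A]
  have "norm_L2 1 (A f) \<le> K * norm_L2G 1 f" if "f \<in> L2G 1" for f
    using D that by (intro norm_L2_le_sup) auto
  moreover have "A f \<in> L2 1" if "f \<in> L2G 1" for f
    by (rule L2_bounded[OF D(2)[OF that] D(4)[OF that]])
  moreover have "aeq 1 (A ((\<lambda>x. c * fst f x + fst g x), (\<lambda>x. c * snd f x + snd g x)))
              (\<lambda>x. c * A f x + A g x)" if "f \<in> L2G 1" "g \<in> L2G 1" for f g c
    unfolding aeq_def using D(3)[OF that] by (intro AE_I2) simp
  ultimately show ?thesis unfolding bounded_op_def by blast
qed

text \<open>
  The unit ball over which the operator norm is taken is not empty, so its supremum is a genuine one.
\<close>
lemma zero_in_L2G: "((\<lambda>x. 0), (\<lambda>x. 0)) \<in> L2G 1"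
  by (simp add: L2G_def L2_def)

lemma norm_L2G_zero: "norm_L2G 1 ((\<lambda>x. 0), (\<lambda>x. 0)) = 0"
  by (simp add: norm_L2G_def norm_L2_def)

lemma sup_bounded_op_op_norm:
  assumes A: "sup_bounded_op A K"
  shows "op_norm A \<le> K" "0 \<le> op_norm A"
proof -
  note D = sup_bounded_opD[OF A]
  let ?S = "{f \<in> L2G 1. norm_L2G 1 f \<le> 1}"
  have z: "((\<lambda>x. 0), (\<lambda>x. 0)) \<in> ?S"
    using zero_in_L2G norm_L2G_zero by simp
  have le: "norm_L2 1 (A f) \<le> K" if "f \<in> ?S" for f
  proof (rule norm_L2_le_sup)
    fix x :: real assume "x \<in> {0<..<1}"
    then have "cmod (A f x) \<le> K * norm_L2G 1 f" using D that by auto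
    also have "\<dots> \<le> K * 1" using that D(1) by (intro mult_left_mono) auto
    finally show "cmod (A f x) \<le> K" by simp
  qed (use D that in auto)
  show "op_norm A \<le> K"
    unfolding op_norm_def using z le by (intro cSUP_least) auto
  have "0 \<le> norm_L2 1 (A ((\<lambda>x. 0), (\<lambda>x. 0)))" by simp
  also have "\<dots> \<le> op_norm A"
    unfolding op_norm_def using z le by (intro cSUP_upper bdd_aboveI2[of _ _ K]) auto
  finally show "0 \<le> op_norm A" .
qed

lemma sup_bounded_op_cong:
  assumes A: "sup_bounded_op A K"
    and eq: "\<And>f x. f \<in> L2G 1 \<Longrightarrow> x \<in> {0<..<1} \<Longrightarrow> B f x = A f x"
  shows "sup_bounded_op B K"
  unfolding sup_bounded_op_def
proof (intro conjI ballI allI)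
  note D = sup_bounded_opD[OF A]
  show "0 \<le> K" by fact
  fix f assume f: "f \<in> L2G 1"
  show "B f \<in> borel_measurable (lebesgue_on {0<..<1})"
    by (subst measurable_cong[of _ _ "A f"]) (use D(2)[OF f] eq[OF f] in auto)
  show "\<And>x. x \<in> {0<..<1} \<Longrightarrow> cmod (B f x) \<le> K * norm_L2G 1 f" using D(4)[OF f] eq[OF f] by auto
  fix g c x assume "g \<in> L2G 1" "x \<in> {0<..<1::real}"
  then show "B ((\<lambda>x. c * fst f x + fst g x), (\<lambda>x. c * snd f x + snd g x)) x = c * B f x + B g x"
    using D(3)[OF f] eq f L2G_comb by simp
qed

lemma sup_bounded_op_comb:
  assumes A: "sup_bounded_op A K" and B: "sup_bounded_op B L"
    and M: "0 \<le> M" "\<And>f x. f \<in> L2G 1 \<Longrightarrow> x \<in> {0<..<1} \<Longrightarrow> cmod (a * A f x + b * B f x) \<le> M * norm_L2G 1 f"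
  shows "sup_bounded_op (\<lambda>f x. a * A f x + b * B f x) M"
  unfolding sup_bounded_op_def
  using sup_bounded_opD[OF A] sup_bounded_opD[OF B] M
  by (auto simp: algebra_simps intro!: borel_measurable_add borel_measurable_times)

text \<open>
  Holomorphy is required only for each fixed \<open>f\<close> and \<open>x\<close>; the uniform bound \<open>K\<close> upgrades it to holomorphy in
  operator norm.
\<close>
definition hol_family :: "(complex \<Rightarrow> gop) \<Rightarrow> real \<Rightarrow> bool" where
  "hol_family F R \<longleftrightarrow> (\<exists>K. \<forall>z\<in>ball 0 R. sup_bounded_op (F z) K) \<and>
     (\<forall>f\<in>L2G 1. \<forall>x\<in>{0<..<1}. (\<lambda>z. F z f x) holomorphic_on ball 0 R)"

text \<open>
  The pointwise derivative inherits linearity from the family, measurability as a limit of difference quotients, and its bound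
  from Cauchy's inequality.
\<close>
lemma hol_family_deriv:
  assumes F: "hol_family F R" and z: "z \<in> ball 0 (R/2)"
  shows "\<exists>K. sup_bounded_op (\<lambda>f x. deriv (\<lambda>w. F w f x) z) K"
proof -
  have "cmod z < R/2" using z by simp
  then have R: "0 < R" using norm_ge_zero[of z] by linarith
  obtain K where K: "\<And>z. z \<in> ball 0 R \<Longrightarrow> sup_bounded_op (F z) K"
    and hol: "\<And>f x. f \<in> L2G 1 \<Longrightarrow> x \<in> {0<..<1} \<Longrightarrow> (\<lambda>z. F z f x) holomorphic_on ball 0 R"
    using F unfolding hol_family_def by blast
  have zR: "z \<in> ball 0 R" using z R by auto
  have D: "((\<lambda>w. F w f x) has_field_derivative deriv (\<lambda>w. F w f x) z) (at z)"
    if "f \<in> L2G 1" "x \<in> {0<..<1}" for f x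
    by (rule holomorphic_derivI[OF hol[OF that] open_ball zR])
  have "sup_bounded_op (\<lambda>f x. deriv (\<lambda>w. F w f x) z) (4 * K / R)"
    unfolding sup_bounded_op_def
  proof (intro conjI ballI allI)
    show "0 \<le> 4 * K / R" using sup_bounded_opD(1)[OF K[OF zR]] R by simp
    fix f assume f: "f \<in> L2G 1"
    show "\<And>x. x \<in> {0<..<1} \<Longrightarrow> cmod (deriv (\<lambda>w. F w f x) z) \<le> 4 * K / R * norm_L2G 1 f"
      using Cauchy_Taylor_bounds(1)[OF hol[OF f] R sup_bounded_opD(4)[OF K f] z z] by (simp add: mult.assoc)
    \<comment> \<open>Steps of length at most half the radius keep the quotients inside the disc of holomorphy.\<close>
    define h :: "nat \<Rightarrow> complex" where "h = (\<lambda>n. of_real (R/2 / real (Suc n)))"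
    have h: "h n \<noteq> 0" "z + h n \<in> ball 0 R" for n
    proof -
      have "R/2 / real (Suc n) \<noteq> 0" using R by simp
      then show "h n \<noteq> 0" unfolding h_def of_real_eq_0_iff .
      have "cmod (h n) \<le> R/2" using R unfolding h_def norm_of_real by (simp add: divide_simps)
      then show "z + h n \<in> ball 0 R"
        using z norm_triangle_ineq[of z "h n"] by simp
    qed
    have "(\<lambda>n. R/2 / real (Suc n)) \<longlonglongrightarrow> 0" by real_asymp
    then have hlim: "h \<longlonglongrightarrow> 0"
      using tendsto_of_real[of _ 0] unfolding h_def of_real_0 by blast
    show "(\<lambda>x. deriv (\<lambda>w. F w f x) z) \<in> borel_measurable (lebesgue_on {0<..<1})"
    proof (rule borel_measurable_LIMSEQ_metric)
      show "(\<lambda>x. (F (z + h n) f x - F z f x) / h n) \<in> borel_measurable (lebesgue_on {0<..<1})" for n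
        using sup_bounded_opD(2)[OF K f] zR h by (intro borel_measurable_divide borel_measurable_diff) auto
      fix x assume "x \<in> space (lebesgue_on {0<..<1::real})"
      then have x: "x \<in> {0<..<1}" by simp
      have "((\<lambda>t. (F (z + t) f x - F z f x) / t) \<longlongrightarrow> deriv (\<lambda>w. F w f x) z) (at 0)"
        using D[OF f x] unfolding DERIV_def .
      then show "(\<lambda>n. (F (z + h n) f x - F z f x) / h n) \<longlonglongrightarrow> deriv (\<lambda>w. F w f x) z"
        using filterlim_compose[of _ _ "at 0" h sequentially] h hlim by (auto simp: filterlim_at)
    qed
    fix g c x assume g: "g \<in> L2G 1" and x: "x \<in> {0<..<1::real}"
    let ?fg = "((\<lambda>x. c * fst f x + fst g x), (\<lambda>x. c * snd f x + snd g x))"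
    have "((\<lambda>w. c * F w f x + F w g x) has_field_derivative
        c * deriv (\<lambda>w. F w f x) z + deriv (\<lambda>w. F w g x) z) (at z)"
      using D[OF f x] D[OF g x] by (auto intro!: derivative_eq_intros)
    then have "((\<lambda>w. F w ?fg x) has_field_derivative
        c * deriv (\<lambda>w. F w f x) z + deriv (\<lambda>w. F w g x) z) (at z)"
      by (rule has_field_derivative_transform_within_open[OF _ open_ball zR])
         (use sup_bounded_opD(3)[OF K f g x] in auto)
    then show "deriv (\<lambda>w. F w ?fg x) z = c * deriv (\<lambda>w. F w f x) z + deriv (\<lambda>w. F w g x) z"
      by (rule DERIV_imp_deriv)
  qed
  then show ?thesis by blast
qed

text \<open>
  The difference quotient differs from the derivative by at most \<open>32 K / R\<^sup>2 |w - z|\<close> times the norm of \<open>f\<close>,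
  uniformly in \<open>x\<close>, by the second-order Taylor estimate.
\<close>
proposition hol_family_op_holomorphic:
  assumes F: "hol_family F R" and R: "0 < R"
  shows "op_holomorphic_on F (ball 0 (R/2))"
  unfolding op_holomorphic_on_def
proof (intro conjI ballI)
  obtain K where K: "\<And>z. z \<in> ball 0 R \<Longrightarrow> sup_bounded_op (F z) K"
    and hol: "\<And>f x. f \<in> L2G 1 \<Longrightarrow> x \<in> {0<..<1} \<Longrightarrow> (\<lambda>z. F z f x) holomorphic_on ball 0 R"
    using F unfolding hol_family_def by blast
  fix z :: complex assume z: "z \<in> ball 0 (R/2)"
  have zR: "z \<in> ball 0 R" using z R by auto
  show "bounded_op (F z)" using K[OF zR] by (rule sup_bounded_op_bounded_op)
  have K0: "0 \<le> K" using sup_bounded_opD(1)[OF K[OF zR]] .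
  let ?D = "\<lambda>f x. deriv (\<lambda>w. F w f x) z"
  obtain L where D: "sup_bounded_op ?D L" using hol_family_deriv[OF F z] by blast
  let ?C = "32 * K / R\<^sup>2"
  have est: "op_norm (\<lambda>f x. (F w f x - F z f x) / (w - z) - ?D f x) \<le> ?C * cmod (w - z) \<and>
      0 \<le> op_norm (\<lambda>f x. (F w f x - F z f x) / (w - z) - ?D f x)"
    if w: "w \<in> ball 0 (R/2)" "w \<noteq> z" for w
  proof -
    have wR: "w \<in> ball 0 R" using w R by auto
    have bd: "cmod ((F w f x - F z f x) / (w - z) - ?D f x) \<le> ?C * cmod (w - z) * norm_L2G 1 f"
      if f: "f \<in> L2G 1" and x: "x \<in> {0<..<1}" for f x
    proof -
      have "(F w f x - F z f x) / (w - z) - ?D f x = (F w f x - F z f x - (w - z) * ?D f x) / (w - z)"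
        using w by (simp add: diff_divide_distrib)
      also have "cmod \<dots> \<le> 32 * (K * norm_L2G 1 f) / R\<^sup>2 * (cmod (w - z))\<^sup>2 / cmod (w - z)"
        unfolding norm_divide
        by (intro divide_right_mono Cauchy_Taylor_bounds(3)[OF hol[OF f x] R _ z w(1)] sup_bounded_opD(4)[OF K f x]) auto
      also have "\<dots> = ?C * cmod (w - z) * norm_L2G 1 f"
        using w by (simp add: power2_eq_square)
      finally show ?thesis .
    qed
    have s1: "sup_bounded_op (\<lambda>f x. 1 * F w f x + (-1) * F z f x) (K + K)"
    proof (rule sup_bounded_op_comb[OF K[OF wR] K[OF zR]])
      fix f x assume f: "f \<in> L2G 1" and x: "x \<in> {0<..<1::real}"
      have "cmod (1 * F w f x + -1 * F z f x) \<le> cmod (F w f x) + cmod (F z f x)"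
        using norm_triangle_ineq4[of "F w f x" "F z f x"] by simp
      then show "cmod (1 * F w f x + -1 * F z f x) \<le> (K + K) * norm_L2G 1 f"
        using sup_bounded_opD(4)[OF K f x, OF wR] sup_bounded_opD(4)[OF K f x, OF zR]
        by (simp add: algebra_simps)
    qed (use K0 in simp)
    have "sup_bounded_op (\<lambda>f x. (1 / (w - z)) * (1 * F w f x + (-1) * F z f x) + (-1) * ?D f x)
        (?C * cmod (w - z))"
      using bd K0 by (intro sup_bounded_op_comb[OF s1 D]) auto
    then have "sup_bounded_op (\<lambda>f x. (F w f x - F z f x) / (w - z) - ?D f x) (?C * cmod (w - z))"
      by (rule sup_bounded_op_cong) simp
    from sup_bounded_op_op_norm[OF this] show ?thesis by blast
  qed
  have "((\<lambda>w. op_norm (\<lambda>f x. (F w f x - F z f x) / (w - z) - ?D f x)) \<longlongrightarrow> 0) (at z)"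
  proof (rule Lim_null_comparison)
    have "((\<lambda>w. ?C * cmod (w - z)) \<longlongrightarrow> ?C * cmod (z - z)) (at z)"
      by (intro tendsto_intros)
    then show "((\<lambda>w. ?C * cmod (w - z)) \<longlongrightarrow> 0) (at z)" by simp
    have "\<forall>\<^sub>F w in at z. w \<in> ball 0 (R/2)" using z by (intro eventually_at_in_open') auto
    moreover have "\<forall>\<^sub>F w in at z. w \<noteq> z" by (simp add: eventually_at_filter)
    ultimately show "\<forall>\<^sub>F w in at z. norm (op_norm (\<lambda>f x. (F w f x - F z f x) / (w - z) - ?D f x))
        \<le> ?C * cmod (w - z)"
      by eventually_elim (use est in auto)
  qed
  then show "\<exists>D. bounded_op D \<and>
        ((\<lambda>w. op_norm (\<lambda>f x. (F w f x - F z f x) / (w - z) - D f x)) \<longlongrightarrow> 0) (at z)"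
    using sup_bounded_op_bounded_op[OF D] by blast
qed

lemma op_holomorphic_at_0I:
  assumes F: "hol_family F R" and R: "0 < R"
    and eq: "\<And>\<epsilon> f x. 0 < \<epsilon> \<Longrightarrow> \<epsilon> < R \<Longrightarrow> f \<in> L2G 1 \<Longrightarrow> x \<in> {0<..<1} \<Longrightarrow> A \<epsilon> f x = F (of_real \<epsilon>) f x"
  shows "op_holomorphic_at_0 A"
  unfolding op_holomorphic_at_0_def
proof (intro exI conjI ballI)
  show "0 < R/2" using R by simp
  show "op_holomorphic_on F (ball 0 (R/2))" by (rule hol_family_op_holomorphic[OF F R])
  fix \<epsilon> f assume "\<epsilon> \<in> {0<..<R/2}" "f \<in> L2G 1"
  then show "aeq 1 (A \<epsilon> f) (F (of_real \<epsilon>) f)"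
    unfolding aeq_def using eq[of \<epsilon> f] by (intro AE_I2) auto
qed

lemma op_bigO_I:
  assumes r: "0 < r" and A: "\<And>\<epsilon>. 0 < \<epsilon> \<Longrightarrow> \<epsilon> < r \<Longrightarrow> sup_bounded_op (A \<epsilon>) (C * \<epsilon> ^ n)"
  shows "op_bigO n A"
  unfolding op_bigO_def
proof (intro conjI)
  have ev: "\<forall>\<^sub>F \<epsilon> in at_right 0. 0 < \<epsilon> \<and> \<epsilon> < r"
    using r by (auto simp: eventually_at_right)
  then show "\<forall>\<^sub>F \<epsilon> in at_right 0. bounded_op (A \<epsilon>)"
    by eventually_elim (use A sup_bounded_op_bounded_op in blast)
  show "(\<lambda>\<epsilon>. op_norm (A \<epsilon>)) \<in> O[at_right 0](\<lambda>\<epsilon>. \<epsilon> ^ n)"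
  proof (rule bigoI[of _ C])
    show "\<forall>\<^sub>F \<epsilon> in at_right 0. norm (op_norm (A \<epsilon>)) \<le> C * norm (\<epsilon> ^ n)"
      using ev
    proof eventually_elim
      case (elim \<epsilon>)
      then show ?case using sup_bounded_op_op_norm[OF A[of \<epsilon>]] by (simp add: abs_of_nonneg)
    qed
  qed
qed

text \<open>
  Lengths are real, but the constant in the bound is Cauchy's constant for the complex disc.
\<close>
lemma hol_family_op_bigO_1:
  assumes F: "hol_family F R" and R: "0 < R"
    and eq: "\<And>\<epsilon> f x. 0 < \<epsilon> \<Longrightarrow> \<epsilon> < R \<Longrightarrow> f \<in> L2G 1 \<Longrightarrow> x \<in> {0<..<1} \<Longrightarrow>
      A \<epsilon> f x = F (of_real \<epsilon>) f x - F 0 f x"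
  shows "op_bigO 1 A"
proof -
  obtain K where K: "\<And>z. z \<in> ball 0 R \<Longrightarrow> sup_bounded_op (F z) K"
    and hol: "\<And>f x. f \<in> L2G 1 \<Longrightarrow> x \<in> {0<..<1} \<Longrightarrow> (\<lambda>z. F z f x) holomorphic_on ball 0 R"
    using F unfolding hol_family_def by blast
  have 0: "0 \<in> ball (0::complex) R" "0 \<in> ball (0::complex) (R/2)" using R by auto
  have K0: "0 \<le> K" using sup_bounded_opD(1)[OF K[OF 0(1)]] .
  show ?thesis
  proof (rule op_bigO_I[where r = "R/2"])
    show "0 < R/2" using R by simp
    fix \<epsilon> assume e: "0 < \<epsilon>" "\<epsilon> < R/2"
    have eR: "of_real \<epsilon> \<in> ball (0::complex) R" "of_real \<epsilon> \<in> ball (0::complex) (R/2)" using e by auto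
    have "sup_bounded_op (\<lambda>f x. 1 * F (of_real \<epsilon>) f x + (-1) * F 0 f x) (4 * K / R * \<epsilon> ^ 1)"
    proof (rule sup_bounded_op_comb[OF K[OF eR(1)] K[OF 0(1)]])
      show "0 \<le> 4 * K / R * \<epsilon> ^ 1" using K0 R e by simp
      fix f x assume f: "f \<in> L2G 1" and x: "x \<in> {0<..<1::real}"
      show "cmod (1 * F (of_real \<epsilon>) f x + (-1) * F 0 f x) \<le> 4 * K / R * \<epsilon> ^ 1 * norm_L2G 1 f"
        using Cauchy_Taylor_bounds(2)[OF hol[OF f x] R sup_bounded_opD(4)[OF K f x] 0(2) eR(2)] e
        by (simp add: mult_ac)
    qed
    then show "sup_bounded_op (A \<epsilon>) (4 * K / R * \<epsilon> ^ 1)"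
      by (rule sup_bounded_op_cong) (use eq e in auto)
  qed
qed

lemma hol_family_op_bigO_2:
  assumes F: "hol_family F R" and R: "0 < R"
    and F0: "\<And>f x. f \<in> L2G 1 \<Longrightarrow> x \<in> {0<..<1} \<Longrightarrow> F 0 f x = 0"
    and G: "\<And>f x. f \<in> L2G 1 \<Longrightarrow> x \<in> {0<..<1} \<Longrightarrow> ((\<lambda>z. F z f x) has_field_derivative G f x) (at 0)"
    and eq: "\<And>\<epsilon> f x. 0 < \<epsilon> \<Longrightarrow> \<epsilon> < R \<Longrightarrow> f \<in> L2G 1 \<Longrightarrow> x \<in> {0<..<1} \<Longrightarrow>
      A \<epsilon> f x = F (of_real \<epsilon>) f x - of_real \<epsilon> * G f x"
  shows "op_bigO 2 A"
proof -
  obtain K where K: "\<And>z. z \<in> ball 0 R \<Longrightarrow> sup_bounded_op (F z) K"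
    and hol: "\<And>f x. f \<in> L2G 1 \<Longrightarrow> x \<in> {0<..<1} \<Longrightarrow> (\<lambda>z. F z f x) holomorphic_on ball 0 R"
    using F unfolding hol_family_def by blast
  have 0: "0 \<in> ball (0::complex) R" "0 \<in> ball (0::complex) (R/2)" using R by auto
  have K0: "0 \<le> K" using sup_bounded_opD(1)[OF K[OF 0(1)]] .
  have dG: "deriv (\<lambda>z. F z f x) 0 = G f x" if "f \<in> L2G 1" "x \<in> {0<..<1}" for f x
    using G[OF that] by (rule DERIV_imp_deriv)
  obtain L where D: "sup_bounded_op (\<lambda>f x. deriv (\<lambda>w. F w f x) 0) L"
    using hol_family_deriv[OF F 0(2)] by blast
  have D: "sup_bounded_op G L"
    by (rule sup_bounded_op_cong[OF D]) (simp add: dG)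
  show ?thesis
  proof (rule op_bigO_I[where r = "R/2"])
    show "0 < R/2" using R by simp
    fix \<epsilon> assume e: "0 < \<epsilon>" "\<epsilon> < R/2"
    have eR: "of_real \<epsilon> \<in> ball (0::complex) R" "of_real \<epsilon> \<in> ball (0::complex) (R/2)" using e by auto
    have "sup_bounded_op (\<lambda>f x. 1 * F (of_real \<epsilon>) f x + (- of_real \<epsilon>) * G f x) (32 * K / R\<^sup>2 * \<epsilon> ^ 2)"
    proof (rule sup_bounded_op_comb[OF K[OF eR(1)] D])
      show "0 \<le> 32 * K / R\<^sup>2 * \<epsilon> ^ 2" using K0 R e by simp
      fix f x assume f: "f \<in> L2G 1" and x: "x \<in> {0<..<1::real}"
      show "cmod (1 * F (of_real \<epsilon>) f x + (- of_real \<epsilon>) * G f x) \<le> 32 * K / R\<^sup>2 * \<epsilon> ^ 2 * norm_L2G 1 f"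
        using Cauchy_Taylor_bounds(3)[OF hol[OF f x] R sup_bounded_opD(4)[OF K f x] 0(2) eR(2)] e
        by (simp add: mult_ac dG[OF f x] F0[OF f x])
    qed
    then show "sup_bounded_op (A \<epsilon>) (32 * K / R\<^sup>2 * \<epsilon> ^ 2)"
      by (rule sup_bounded_op_cong) (use eq e in auto)
  qed
qed

lemma hol_family_add:
  assumes F: "hol_family F R" and G: "hol_family G R"
  shows "hol_family (\<lambda>z f x. F z f x + G z f x) R"
proof -
  obtain K where K: "\<And>z. z \<in> ball 0 R \<Longrightarrow> sup_bounded_op (F z) K"
    and hF: "\<And>f x. f \<in> L2G 1 \<Longrightarrow> x \<in> {0<..<1} \<Longrightarrow> (\<lambda>z. F z f x) holomorphic_on ball 0 R"
    using F unfolding hol_family_def by blast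
  obtain L where L: "\<And>z. z \<in> ball 0 R \<Longrightarrow> sup_bounded_op (G z) L"
    and hG: "\<And>f x. f \<in> L2G 1 \<Longrightarrow> x \<in> {0<..<1} \<Longrightarrow> (\<lambda>z. G z f x) holomorphic_on ball 0 R"
    using G unfolding hol_family_def by blast
  have "sup_bounded_op (\<lambda>f x. F z f x + G z f x) (K + L)" if z: "z \<in> ball 0 R" for z
  proof -
    have "sup_bounded_op (\<lambda>f x. 1 * F z f x + 1 * G z f x) (K + L)"
    proof (rule sup_bounded_op_comb[OF K[OF z] L[OF z]])
      fix f x assume f: "f \<in> L2G 1" and x: "x \<in> {0<..<1::real}"
      show "cmod (1 * F z f x + 1 * G z f x) \<le> (K + L) * norm_L2G 1 f"
        using sup_bounded_opD(4)[OF K[OF z] f x] sup_bounded_opD(4)[OF L[OF z] f x]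
          norm_triangle_ineq[of "F z f x" "G z f x"] by (simp add: algebra_simps)
    qed (use sup_bounded_opD(1)[OF K[OF z]] sup_bounded_opD(1)[OF L[OF z]] in simp)
    then show ?thesis by simp
  qed
  then show ?thesis
    unfolding hol_family_def
    by (intro conjI exI[of _ "K + L"] ballI holomorphic_on_add hF hG)
qed

lemma hol_family_mult:
  assumes F: "hol_family F R"
    and hol: "\<And>x. x \<in> {0<..<1} \<Longrightarrow> (\<lambda>z. \<phi> z x) holomorphic_on ball 0 R"
    and M: "\<And>z x. z \<in> ball 0 R \<Longrightarrow> x \<in> {0<..<1} \<Longrightarrow> cmod (\<phi> z x) \<le> M"
    and m: "\<And>z. z \<in> ball 0 R \<Longrightarrow> \<phi> z \<in> borel_measurable (lebesgue_on {0<..<1})"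
  shows "hol_family (\<lambda>z f x. \<phi> z x * F z f x) R"
proof -
  obtain K where K: "\<And>z. z \<in> ball 0 R \<Longrightarrow> sup_bounded_op (F z) K"
    and hF: "\<And>f x. f \<in> L2G 1 \<Longrightarrow> x \<in> {0<..<1} \<Longrightarrow> (\<lambda>z. F z f x) holomorphic_on ball 0 R"
    using F unfolding hol_family_def by blast
  have "sup_bounded_op (\<lambda>f x. \<phi> z x * F z f x) (\<bar>M\<bar> * K)" if z: "z \<in> ball 0 R" for z
    unfolding sup_bounded_op_def
  proof (intro conjI ballI allI)
    note D = sup_bounded_opD[OF K[OF z]]
    show "0 \<le> \<bar>M\<bar> * K" using D(1) by simp
    fix f assume f: "f \<in> L2G 1"
    show "(\<lambda>x. \<phi> z x * F z f x) \<in> borel_measurable (lebesgue_on {0<..<1})"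
      by (intro borel_measurable_times m z D(2) f)
    show "cmod (\<phi> z x * F z f x) \<le> \<bar>M\<bar> * K * norm_L2G 1 f" if x: "x \<in> {0<..<1}" for x
    proof -
      have "cmod (\<phi> z x) * cmod (F z f x) \<le> \<bar>M\<bar> * (K * norm_L2G 1 f)"
        using M[OF z x] D(4)[OF f x] by (intro mult_mono) auto
      then show ?thesis by (simp add: norm_mult mult_ac)
    qed
    fix g c x assume g: "g \<in> L2G 1" and x: "x \<in> {0<..<1::real}"
    show "\<phi> z x * F z ((\<lambda>x. c * fst f x + fst g x), (\<lambda>x. c * snd f x + snd g x)) x
        = c * (\<phi> z x * F z f x) + \<phi> z x * F z g x"
      using D(3)[OF f g x] by (simp add: algebra_simps)
  qed
  then show ?thesis
    unfolding hol_family_def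
    by (intro conjI exI[of _ "\<bar>M\<bar> * K"] ballI holomorphic_on_mult hF hol)
qed

text \<open>
  All families of the theorem are built from these with sums and multipliers. The choices for \<open>\<pi>\<close> and \<open>b\<close> cover data on
  either edge, and both running convolutions and their values at the end of the edge.
\<close>
lemma hol_family_conv:
  assumes \<pi>: "\<pi> = fst \<or> \<pi> = snd" and b: "b = (\<lambda>x. x) \<or> b = (\<lambda>x. 1)"
    and \<kappa>: "\<kappa> holomorphic_on ball 0 R" "\<And>z. z \<in> ball 0 R \<Longrightarrow> cmod (\<kappa> z) \<le> M"
  shows "hol_family (\<lambda>z f x. sin_conv (\<kappa> z) (\<pi> f) (b x)) R"
    and "hol_family (\<lambda>z f x. cos_conv (\<kappa> z) (\<pi> f) (b x)) R"
proof -
  have \<pi>L: "\<pi> f \<in> L2 1" if "f \<in> L2G 1" for f using that \<pi> by (auto simp: L2G_def)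
  have \<pi>n: "norm_L2 1 (\<pi> f) \<le> norm_L2G 1 f" for f using \<pi> norm_L2_le_norm_L2G[of f] by metis
  have bx: "b x \<in> {0..1}" if "x \<in> {0<..<1}" for x using that b by auto
  obtain B where B: "\<And>\<kappa> f x. cmod \<kappa> \<le> M \<Longrightarrow> f \<in> L2 1 \<Longrightarrow> x \<in> {0..1} \<Longrightarrow>
      cmod (sin_conv \<kappa> f x) \<le> B * norm_L2 1 f \<and> cmod (cos_conv \<kappa> f x) \<le> B * norm_L2 1 f"
    using conv_bound by blast
  have meas: "(\<lambda>x. h (b x)) \<in> borel_measurable (lebesgue_on {0<..<1})" if "continuous_on {0..1} h" for h :: "real \<Rightarrow> complex"
  proof -
    have "continuous_on {0<..<1} (\<lambda>x. h (b x))"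
      using b continuous_on_subset[OF that, of "{0<..<1}"] by (auto simp: subset_iff)
    then show ?thesis by (intro continuous_imp_measurable_on_sets_lebesgue) auto
  qed
  have bound: "cmod y \<le> \<bar>B\<bar> * norm_L2G 1 f" if "cmod y \<le> B * norm_L2 1 (\<pi> f)" for y f
  proof -
    have "B * norm_L2 1 (\<pi> f) \<le> \<bar>B\<bar> * norm_L2G 1 f" using \<pi>n by (intro mult_mono) auto
    with that show ?thesis by linarith
  qed
  have lin: "\<pi> ((\<lambda>x. c * fst f x + fst g x), (\<lambda>x. c * snd f x + snd g x)) = (\<lambda>x. c * \<pi> f x + \<pi> g x)" for c f g
    using \<pi> by auto
  have sc: "sup_bounded_op (\<lambda>f x. sin_conv (\<kappa> z) (\<pi> f) (b x)) \<bar>B\<bar>"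
    "sup_bounded_op (\<lambda>f x. cos_conv (\<kappa> z) (\<pi> f) (b x)) \<bar>B\<bar>" if z: "z \<in> ball 0 R" for z
    unfolding sup_bounded_op_def
    using B[OF \<kappa>(2)[OF z] \<pi>L bx] bound conv_linear[OF \<pi>L \<pi>L bx] meas[OF conv_continuous(1)[OF \<pi>L]]
      meas[OF conv_continuous(2)[OF \<pi>L]] lin by (auto simp del: greaterThanLessThan_iff)
  have "(\<lambda>z. sin_conv (\<kappa> z) (\<pi> f) (b x)) holomorphic_on ball 0 R"
    "(\<lambda>z. cos_conv (\<kappa> z) (\<pi> f) (b x)) holomorphic_on ball 0 R" if "f \<in> L2G 1" "x \<in> {0<..<1}" for f x
    using holomorphic_on_compose_gen[OF \<kappa>(1) conv_holomorphic(1)[OF \<pi>L[OF that(1)] bx[OF that(2)], of UNIV]]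
      holomorphic_on_compose_gen[OF \<kappa>(1) conv_holomorphic(2)[OF \<pi>L[OF that(1)] bx[OF that(2)], of UNIV]]
    by (auto simp: o_def)
  with sc show "hol_family (\<lambda>z f x. sin_conv (\<kappa> z) (\<pi> f) (b x)) R"
    "hol_family (\<lambda>z f x. cos_conv (\<kappa> z) (\<pi> f) (b x)) R"
    unfolding hol_family_def by blast+
qed

section \<open>The linear system for the amplitudes\<close>

lemma abs_less_abs_sinh:
  fixes y :: real
  assumes "y \<noteq> 0"
  shows "\<bar>2 * y\<bar> < \<bar>sinh (2 * y)\<bar>"
proof -
  have s: "\<bar>y\<bar> \<le> \<bar>sinh y\<bar>"
    using real_le_abs_sinh[of y] by (simp add: sinh_field_def exp_minus)
  have "1 < (cosh y)\<^sup>2"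
    using assms by (simp add: cosh_square_eq)
  then have "1 < cosh y"
    using cosh_real_ge_1[of y] by (metis less_eq_real_def one_power2 order_less_irrefl)
  then have "\<bar>y\<bar> * 1 < \<bar>sinh y\<bar> * cosh y"
    using s assms by (intro mult_le_less_imp_less) auto
  then show ?thesis using \<open>1 < cosh y\<close> by (simp add: sinh_double abs_mult)
qed

context
  fixes k :: complex
  assumes nonreal: "k\<^sup>2 \<notin> \<real>"
begin

lemma Re_Im_nonzero: "Re k \<noteq> 0" "Im k \<noteq> 0"
proof -
  have "Im (k\<^sup>2) \<noteq> 0" using nonreal by (simp add: complex_is_Real_iff)
  then show "Re k \<noteq> 0" "Im k \<noteq> 0" by (auto simp: power2_eq_square)
qed

lemma k_nonzero: "k \<noteq> 0"
  using Re_Im_nonzero by auto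

lemma sin_nonzero: "sin k \<noteq> 0"
  using Re_Im_nonzero by (auto simp: sin_eq_0)

text \<open>
  Multiplying by the conjugate of \<open>sin k\<close> turns the vanishing into the statement that \<open>k cos k \<cdot> cnj (sin k)\<close> is real.
  With \<open>k = p + i q\<close> its imaginary part is \<open>(q sin (2 p) - p sinh (2 q)) / 2\<close>, which cannot be zero for nonzero
  \<open>p, q\<close> because \<open>|sin (2 p)| \<le> |2 p|\<close> while \<open>|sinh (2 q)| > |2 q|\<close>.
\<close>
lemma robin_nonzero: "k * cos k + of_real \<mu> * sin k \<noteq> 0"
proof
  assume eq: "k * cos k + of_real \<mu> * sin k = 0"
  define X where "X = cos k * cnj (sin k)"
  have "k * X + of_real \<mu> * (sin k * cnj (sin k)) = (k * cos k + of_real \<mu> * sin k) * cnj (sin k)"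
    by (simp add: X_def algebra_simps)
  also have "\<dots> = 0" by (simp add: eq)
  finally have "Im (k * X + of_real \<mu> * (sin k * cnj (sin k))) = 0" by simp
  moreover have "Im (of_real \<mu> * (sin k * cnj (sin k))) = 0" by (simp add: complex_mult_cnj)
  ultimately have 0: "Im (k * X) = 0" by simp
  have c: "X = (sin (cnj k + k) + sin (cnj k - k)) / 2"
    by (simp add: X_def cnj_sin mult.commute flip: sin_times_cos)
  have "Re X = sin (2 * Re k) / 2" "Im X = - sinh (2 * Im k) / 2"
    unfolding c by (simp_all add: Re_sin Im_sin sinh_field_def field_simps)
  with 0 have "Re k * sinh (2 * Im k) = Im k * sin (2 * Re k)" by simp
  then have "\<bar>Re k\<bar> * \<bar>sinh (2 * Im k)\<bar> = \<bar>Im k\<bar> * \<bar>sin (2 * Re k)\<bar>" by (metis abs_mult)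
  moreover have "\<bar>Im k\<bar> * \<bar>sin (2 * Re k)\<bar> \<le> \<bar>Im k\<bar> * \<bar>2 * Re k\<bar>"
    by (intro mult_left_mono abs_sin_x_le_abs_x) auto
  moreover have "\<bar>Re k\<bar> * \<bar>2 * Im k\<bar> < \<bar>Re k\<bar> * \<bar>sinh (2 * Im k)\<bar>"
    using Re_Im_nonzero by (intro mult_strict_left_mono abs_less_abs_sinh) auto
  ultimately show False by (simp add: abs_mult algebra_simps)
qed

end

definition vertex_cond :: "complex^2^2 \<Rightarrow> complex^2^2 \<Rightarrow> complex^2 \<Rightarrow> complex^2 \<Rightarrow> bool" where
  "vertex_cond P T U V \<longleftrightarrow> P *v U = 0 \<and> (mat 1 - P) *v V = T *v ((mat 1 - P) *v U)"

text \<open>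
  An amplitude as a combination of the four functionals of the data that occur: \<open>S, C\<close> are the sine and cosine
  convolutions of \<open>f\<^sub>s\<close> with frequency \<open>k z\<close> at the end of the short edge, and \<open>s, c\<close> those of \<open>f\<^sub>e\<close> with
  frequency \<open>k\<close> at the end of the long edge. The function \<open>p i\<close> is the coefficient of the \<open>i\<close>-th of them.
\<close>
definition lin4 :: "(nat \<Rightarrow> complex \<Rightarrow> complex) \<Rightarrow> complex \<Rightarrow> complex \<Rightarrow> complex \<Rightarrow> complex \<Rightarrow> complex \<Rightarrow> complex" where
  "lin4 p z S C s c = p 0 z * S + p 1 z * C + p 2 z * s + p 3 z * c"

text \<open>
  The vectors \<open>U\<close> and \<open>U'\<close> of the general solution with amplitude \<open>a\<close> of \<open>cos\<close> on the short edge and \<open>b\<close> of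
  \<open>sin\<close> on the long edge; \<open>z\<close> is the length of the short edge.
\<close>
definition ansatz_val :: "complex \<Rightarrow> complex \<Rightarrow> complex \<Rightarrow> complex \<Rightarrow> complex \<Rightarrow> complex \<Rightarrow> complex^2" where
  "ansatz_val k z a b S s = vector [a * cos (k * z) - z / k * S, b * sin k - s / k]"

definition ansatz_der :: "complex \<Rightarrow> complex \<Rightarrow> complex \<Rightarrow> complex \<Rightarrow> complex \<Rightarrow> complex \<Rightarrow> complex^2" where
  "ansatz_der k z a b C c = vector [a * k * sin (k * z) + z * C, - (b * k * cos k) + c]"

text \<open>
  For short edges the vertex conditions determine both amplitudes, with coefficients that extend holomorphically to
  \<open>0\<close>. The two values \<open>q 0 0\<close> and \<open>q 1 0\<close> are included because in every case the data on the short edge drop out of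
  the limit on the long edge.
\<close>
definition solution_coeffs ::
  "complex^2^2 \<Rightarrow> complex^2^2 \<Rightarrow> complex \<Rightarrow> real \<Rightarrow> (nat \<Rightarrow> complex \<Rightarrow> complex) \<Rightarrow> (nat \<Rightarrow> complex \<Rightarrow> complex) \<Rightarrow> bool" where
  "solution_coeffs P T k r p q \<longleftrightarrow> 0 < r \<and>
     (\<forall>i<4. p i holomorphic_on ball 0 r \<and> q i holomorphic_on ball 0 r) \<and> q 0 0 = 0 \<and> q 1 0 = 0 \<and>
     (\<forall>\<epsilon> a b S C s c. 0 < \<epsilon> \<longrightarrow> \<epsilon> < r \<longrightarrow>
        (vertex_cond P T (ansatz_val k (of_real \<epsilon>) a b S s) (ansatz_der k (of_real \<epsilon>) a b C c) \<longleftrightarrow>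
         a = lin4 p (of_real \<epsilon>) S C s c \<and> b = lin4 q (of_real \<epsilon>) S C s c))"

lemma all_less_4: "(\<forall>i<4::nat. Q i) \<longleftrightarrow> Q 0 \<and> Q 1 \<and> Q 2 \<and> Q 3"
  by (auto simp: eval_nat_numeral less_Suc_eq)

lemma nonzero_near_0:
  fixes f :: "complex \<Rightarrow> complex"
  assumes "continuous_on UNIV f" "f 0 \<noteq> 0"
  shows "\<exists>r>0. \<forall>z\<in>ball 0 r. f z \<noteq> 0"
proof -
  have "isCont f 0" using assms(1) by (simp add: continuous_on_eq_continuous_at)
  from continuous_at_avoid[OF this assms(2)] show ?thesis
    by (auto simp: dist_norm)
qed

text \<open>
  Cramer's rule. The hypothesis \<open>det0\<close> says that the determinant does not vanish at \<open>z = 0\<close>, so by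
  continuity it has no zero nearby. The functionals of \<open>f\<^sub>s\<close> enter the right-hand sides with a factor \<open>z\<close>, whence
  \<open>p 0 0 = p 1 0 = 0\<close>. If the first equation does not involve the long edge, neither does the amplitude on the short edge; if no
  derivative on the short edge occurs, neither does the cosine convolution of \<open>f\<^sub>s\<close>.
\<close>
lemma regular_solution_coeffs:
  assumes rows: "\<And>U1 U2 V1 V2. vertex_cond P T (vector [U1, U2]) (vector [V1, V2]) \<longleftrightarrow>
      \<alpha>1 * U1 + \<alpha>2 * U2 + \<beta>1 * V1 + \<beta>2 * V2 = 0 \<and>
      \<gamma>1 * U1 + \<gamma>2 * U2 + \<delta>1 * V1 + \<delta>2 * V2 = 0"
    and k: "k \<noteq> 0"
    and det0: "\<alpha>1 * (\<gamma>2 * sin k - \<delta>2 * k * cos k) - \<gamma>1 * (\<alpha>2 * sin k - \<beta>2 * k * cos k) \<noteq> 0"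
  obtains r p q where "solution_coeffs P T k r p q" "p 0 0 = 0" "p 1 0 = 0"
    "\<alpha>2 = 0 \<Longrightarrow> \<beta>2 = 0 \<Longrightarrow> p 2 = (\<lambda>z. 0) \<and> p 3 = (\<lambda>z. 0)"
    "\<beta>1 = 0 \<Longrightarrow> \<delta>1 = 0 \<Longrightarrow> p 1 = (\<lambda>z. 0)"
proof -
  \<comment> \<open>Coefficients of \<open>a\<close> (first column) and \<open>b\<close> (second column); the latter belong to the long edge and do not depend on \<open>z\<close>.\<close>
  define m12 where "m12 = \<alpha>2 * sin k - \<beta>2 * k * cos k"
  define m22 where "m22 = \<gamma>2 * sin k - \<delta>2 * k * cos k"
  define m11 where "m11 = (\<lambda>z. \<alpha>1 * cos (k * z) + \<beta>1 * k * sin (k * z))"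
  define m21 where "m21 = (\<lambda>z. \<gamma>1 * cos (k * z) + \<delta>1 * k * sin (k * z))"
  define D where "D = (\<lambda>z. m11 z * m22 - m21 z * m12)"
  have "continuous_on UNIV D"
    unfolding D_def m11_def m21_def by (intro continuous_intros)
  moreover have "D 0 \<noteq> 0" using det0 by (simp add: D_def m11_def m21_def m12_def m22_def)
  ultimately obtain r where r: "0 < r" and Dnz: "\<And>z. z \<in> ball 0 r \<Longrightarrow> D z \<noteq> 0"
    using nonzero_near_0 by blast
  define p where "p = (\<lambda>i z. [z / k * (\<alpha>1 * m22 - \<gamma>1 * m12) / D z, - z * (\<beta>1 * m22 - \<delta>1 * m12) / D z,
      (\<alpha>2 * m22 - \<gamma>2 * m12) / (k * D z), - (\<beta>2 * m22 - \<delta>2 * m12) / D z] ! i)"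
  define q where "q = (\<lambda>i z. [z / k * (\<gamma>1 * m11 z - \<alpha>1 * m21 z) / D z, - z * (\<delta>1 * m11 z - \<beta>1 * m21 z) / D z,
      (\<gamma>2 * m11 z - \<alpha>2 * m21 z) / (k * D z), - (\<delta>2 * m11 z - \<beta>2 * m21 z) / D z] ! i)"
  have hol: "D holomorphic_on A" "m11 holomorphic_on A" "m21 holomorphic_on A" for A
    unfolding D_def m11_def m21_def by (intro holomorphic_intros)+
  have "p i holomorphic_on ball 0 r \<and> q i holomorphic_on ball 0 r" if "i < 4" for i
  proof -
    have "\<forall>i<4. p i holomorphic_on ball 0 r \<and> q i holomorphic_on ball 0 r"
      unfolding all_less_4 p_def q_def
      by (simp add: eval_nat_numeral) (intro conjI holomorphic_intros hol; use Dnz k in auto)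
    then show ?thesis using that by blast
  qed
  moreover have "vertex_cond P T (ansatz_val k z a b S s) (ansatz_der k z a b C c) \<longleftrightarrow>
      a = lin4 p z S C s c \<and> b = lin4 q z S C s c" if z: "z \<in> ball 0 r" for z a b S C s c
  proof -
    define r1 where "r1 = \<alpha>1 * (z / k) * S + \<alpha>2 * s / k - \<beta>1 * z * C - \<beta>2 * c"
    define r2 where "r2 = \<gamma>1 * (z / k) * S + \<gamma>2 * s / k - \<delta>1 * z * C - \<delta>2 * c"
    have D0: "D z \<noteq> 0" by (rule Dnz[OF z])
    have "\<alpha>1 * (a * cos (k * z) - z / k * S) + \<alpha>2 * (b * sin k - s / k) + \<beta>1 * (a * k * sin (k * z) + z * C)
        + \<beta>2 * (- (b * k * cos k) + c) = m11 z * a + m12 * b - r1"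
      by (simp add: m11_def m12_def r1_def algebra_simps)
    moreover have "\<gamma>1 * (a * cos (k * z) - z / k * S) + \<gamma>2 * (b * sin k - s / k) + \<delta>1 * (a * k * sin (k * z) + z * C)
        + \<delta>2 * (- (b * k * cos k) + c) = m21 z * a + m22 * b - r2"
      by (simp add: m21_def m22_def r2_def algebra_simps)
    ultimately have "vertex_cond P T (ansatz_val k z a b S s) (ansatz_der k z a b C c) \<longleftrightarrow>
        m11 z * a + m12 * b = r1 \<and> m21 z * a + m22 * b = r2"
      by (simp add: ansatz_val_def ansatz_der_def rows)
    also have "\<dots> \<longleftrightarrow> a = (r1 * m22 - r2 * m12) / D z \<and> b = (r2 * m11 z - r1 * m21 z) / D z"
    proof
      assume eq: "m11 z * a + m12 * b = r1 \<and> m21 z * a + m22 * b = r2"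
      then have "D z * a = r1 * m22 - r2 * m12" "D z * b = r2 * m11 z - r1 * m21 z"
        by (auto simp: D_def algebra_simps)
      then show "a = (r1 * m22 - r2 * m12) / D z \<and> b = (r2 * m11 z - r1 * m21 z) / D z"
        using D0 by (simp add: field_simps)
    next
      assume ab: "a = (r1 * m22 - r2 * m12) / D z \<and> b = (r2 * m11 z - r1 * m21 z) / D z"
      have "m11 z * a + m12 * b = (D z * r1) / D z"
        using ab by (simp add: D_def algebra_simps flip: add_divide_distrib diff_divide_distrib)
      moreover have "m21 z * a + m22 * b = (D z * r2) / D z"
        using ab by (simp add: D_def algebra_simps flip: add_divide_distrib diff_divide_distrib)
      ultimately show "m11 z * a + m12 * b = r1 \<and> m21 z * a + m22 * b = r2"
        using D0 by simp
    qed
    also have "(r1 * m22 - r2 * m12) / D z = lin4 p z S C s c"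
      using k D0 by (simp add: lin4_def p_def r1_def r2_def eval_nat_numeral field_simps)
    also have "(r2 * m11 z - r1 * m21 z) / D z = lin4 q z S C s c"
      using k D0 by (simp add: lin4_def q_def r1_def r2_def eval_nat_numeral field_simps)
    finally show ?thesis .
  qed
  moreover have "q 0 0 = 0" "q 1 0 = 0" by (simp_all add: q_def)
  ultimately have "solution_coeffs P T k r p q"
    using r unfolding solution_coeffs_def by simp
  moreover have "p 0 0 = 0" "p 1 0 = 0" by (simp_all add: p_def)
  moreover have "p 2 = (\<lambda>z. 0) \<and> p 3 = (\<lambda>z. 0)" if "\<alpha>2 = 0" "\<beta>2 = 0"
    using that by (simp add: p_def m12_def eval_nat_numeral)
  moreover have "p 1 = (\<lambda>z. 0)" if "\<beta>1 = 0" "\<delta>1 = 0"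
    using that by (simp add: p_def fun_eq_iff)
  ultimately show thesis by (rule that)
qed

text \<open>
  Here the determinant vanishes at \<open>z = 0\<close>. The condition \<open>V1 = 0\<close> reads \<open>a k sin (k z) + z C = 0\<close>, and
  \<open>sin (k z) = z \<phi> z\<close> with \<open>\<phi>\<close> entire and \<open>\<phi> 0 = k\<close>, so the factor \<open>z\<close> cancels and \<open>a = - C / (k \<phi> z)\<close>
  is holomorphic and of order one.
\<close>
lemma neumann_solution_coeffs:
  assumes rows: "\<And>U1 U2 V1 V2. vertex_cond P T (vector [U1, U2]) (vector [V1, V2]) \<longleftrightarrow>
      V1 = 0 \<and> \<alpha> * U2 + \<beta> * V2 = 0"
    and k: "k \<noteq> 0"
    and det0: "\<alpha> * sin k - \<beta> * k * cos k \<noteq> 0"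
  obtains r p q where "solution_coeffs P T k r p q" "p 2 = (\<lambda>z. 0)" "p 3 = (\<lambda>z. 0)"
proof -
  define m where "m = \<alpha> * sin k - \<beta> * k * cos k"
  define \<phi> where "\<phi> = (\<lambda>z. if z = 0 then deriv (\<lambda>z. sin (k * z)) 0 else (sin (k * z) - sin (k * 0)) / (z - 0))"
  have h\<phi>: "\<phi> holomorphic_on UNIV"
    unfolding \<phi>_def by (rule pole_lemma) (auto intro!: holomorphic_intros)
  have "deriv (\<lambda>z. sin (k * z)) 0 = k"
    by (rule DERIV_imp_deriv) (auto intro!: derivative_eq_intros)
  then have "\<phi> 0 \<noteq> 0" using k by (simp add: \<phi>_def)
  then obtain r where r: "0 < r" and nz: "\<And>z. z \<in> ball 0 r \<Longrightarrow> \<phi> z \<noteq> 0"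
    using nonzero_near_0[OF holomorphic_on_imp_continuous_on[OF h\<phi>]] by blast
  have h: "\<phi> holomorphic_on A" for A using holomorphic_on_subset[OF h\<phi>] by blast
  define p where "p = (\<lambda>i z. [0, - 1 / (k * \<phi> z), 0, 0] ! i)"
  define q where "q = (\<lambda>i z::complex. [0, 0, \<alpha> / (k * m), - \<beta> / m] ! i)"
  have m: "m \<noteq> 0" using det0 by (simp add: m_def)
  have "\<forall>i<4. p i holomorphic_on ball 0 r \<and> q i holomorphic_on ball 0 r"
    unfolding all_less_4 p_def q_def
    by (simp add: eval_nat_numeral) (intro conjI holomorphic_intros h; use nz k in auto)
  moreover have "vertex_cond P T (ansatz_val k z a b S s) (ansatz_der k z a b C c) \<longleftrightarrow>
      a = lin4 p z S C s c \<and> b = lin4 q z S C s c" if z: "z \<in> ball 0 r" "z \<noteq> 0" for z a b S C s c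
  proof -
    have \<phi>z: "z * \<phi> z = sin (k * z)" using z by (simp add: \<phi>_def)
    have "a * k * sin (k * z) + z * C = z * (k * \<phi> z * a + C)"
      unfolding \<phi>z[symmetric] by (simp add: algebra_simps)
    then have "a * k * sin (k * z) + z * C = 0 \<longleftrightarrow> k * \<phi> z * a + C = 0" using z by simp
    also have "\<dots> \<longleftrightarrow> a = lin4 p z S C s c"
      using nz[OF z(1)] k by (auto simp: lin4_def p_def eval_nat_numeral field_simps add_eq_0_iff)
    finally have 1: "a * k * sin (k * z) + z * C = 0 \<longleftrightarrow> a = lin4 p z S C s c" .
    have "\<alpha> * (b * sin k - s / k) + \<beta> * (- (b * k * cos k) + c) = m * b - (\<alpha> * s / k - \<beta> * c)"
      by (simp add: m_def algebra_simps)
    then have "\<alpha> * (b * sin k - s / k) + \<beta> * (- (b * k * cos k) + c) = 0 \<longleftrightarrow> b = (\<alpha> * s / k - \<beta> * c) / m"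
      using m by (simp add: field_simps)
    also have "(\<alpha> * s / k - \<beta> * c) / m = lin4 q z S C s c"
      by (simp add: lin4_def q_def eval_nat_numeral diff_divide_distrib)
    finally show ?thesis
      using 1 by (simp add: rows ansatz_val_def ansatz_der_def)
  qed
  moreover have "q 0 0 = 0" "q 1 0 = 0" by (simp_all add: q_def)
  ultimately have "solution_coeffs P T k r p q"
    using r unfolding solution_coeffs_def by simp
  moreover have "p 2 = (\<lambda>z. 0)" "p 3 = (\<lambda>z. 0)" by (simp_all add: p_def eval_nat_numeral)
  ultimately show thesis by (rule that)
qed

section \<open>Classification of the vertex conditions\<close>

text \<open>
  Matrices in coordinates, so that the matrix algebra below is done by rewriting.
\<close>
definition mat22 :: "complex \<Rightarrow> complex \<Rightarrow> complex \<Rightarrow> complex \<Rightarrow> complex^2^2" where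
  "mat22 a b c d = vector [vector [a, b], vector [c, d]]"

lemma mat22_cases:
  obtains a b c d where "A = mat22 a b c d"
proof
  show "A = mat22 (vec_nth (vec_nth A 1) 1) (vec_nth (vec_nth A 1) 2) (vec_nth (vec_nth A 2) 1) (vec_nth (vec_nth A 2) 2)"
    by (simp add: mat22_def vec_eq_iff forall_2)
qed

lemma vector2_eq_iff: "vector [a, b] = (vector [a', b'] :: complex^2) \<longleftrightarrow> a = a' \<and> b = b'"
  by (simp add: vec_eq_iff forall_2)

lemma vector2_zero: "(0 :: complex^2) = vector [0, 0]"
  by (simp add: vec_eq_iff forall_2)

lemma mat22_eq_iff: "mat22 a b c d = mat22 a' b' c' d' \<longleftrightarrow> a = a' \<and> b = b' \<and> c = c' \<and> d = d'"
  by (auto simp: mat22_def vector2_eq_iff vec_eq_iff forall_2)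

lemma mat22_simps:
  "mat22 a b c d ** mat22 a' b' c' d' = mat22 (a*a' + b*c') (a*b' + b*d') (c*a' + d*c') (c*b' + d*d')"
  "mat22 a b c d *v vector [u, v] = vector [a * u + b * v, c * u + d * v]"
  "mat 1 = mat22 1 0 0 1" "0 = mat22 0 0 0 0"
  "mat22 a b c d - mat22 a' b' c' d' = mat22 (a-a') (b-b') (c-c') (d-d')"
  "r *\<^sub>R mat22 a b c d = mat22 (r *\<^sub>R a) (r *\<^sub>R b) (r *\<^sub>R c) (r *\<^sub>R d)"
  "hermitian (mat22 a b c d) \<longleftrightarrow> a = cnj a \<and> b = cnj c \<and> c = cnj b \<and> d = cnj d"
  by (auto simp: mat22_def vec_eq_iff forall_2 matrix_matrix_mult_def matrix_vector_mult_def sum_2 mat_def hermitian_def)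

lemma rank1_proj_mat22:
  "rank1_proj None = mat22 0 0 0 1"
  "rank1_proj (Some z) = mat22 (1 / (1 + z * cnj z)) (z / (1 + z * cnj z)) (cnj z / (1 + z * cnj z)) (z * cnj z / (1 + z * cnj z))"
  unfolding rank1_proj.simps mat22_def[symmetric] mat22_simps(6)
  by (simp_all add: scaleR_conv_of_real mat22_eq_iff complex_norm_square del: of_real_power)

lemma rank_0_imp_zero:
  fixes A :: "complex^2^2"
  assumes "rank A = 0"
  shows "A = 0"
proof -
  have "rows A \<subseteq> {0}" using assms by (simp add: row_rank_def_gen)
  then have "row i A = 0" for i by (auto simp: rows_def)
  then show ?thesis by (simp add: row_def vec_eq_iff)
qed

lemma rank_2_idempotent:
  fixes P :: "complex^2^2"
  assumes "rank P = 2" "P ** P = P"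
  shows "P = mat 1"
proof -
  have "vec.dim (rows P) = CARD(2)" using assms(1) by (simp add: row_rank_def_gen)
  then have "vec.span (rows P) = UNIV"
    using vec.dim_eq_full[of "rows P"] by (simp add: vec.dimension_def card_cart_basis)
  then obtain B where B: "B ** P = mat 1"
    using matrix_left_invertible_span_rows_gen[of P] by blast
  have "P = (B ** P) ** P" by (simp add: B)
  also have "\<dots> = B ** (P ** P)" by (simp add: matrix_mul_assoc)
  also have "\<dots> = mat 1" by (simp add: assms B)
  finally show ?thesis .
qed

lemma one_plus_norm_nonzero: "1 + z * cnj z \<noteq> 0"
proof -
  have "1 + z * cnj z = of_real (1 + (cmod z)\<^sup>2)" by (simp add: complex_norm_square del: of_real_power)
  moreover have "1 + (cmod z)\<^sup>2 \<noteq> 0" by (metis add_pos_nonneg less_irrefl zero_le_power2 zero_less_one)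
  ultimately show ?thesis by (metis of_real_eq_0_iff)
qed

text \<open>
  A self-adjoint operator on a line is multiplication by a real number. With \<open>Q = q q\<^sup>* / N\<close> for \<open>q = (z, -1)\<close>, the
  compression of \<open>T\<close> to the range of \<open>Q\<close> is \<open>(q\<^sup>* T q / N) Q\<close>, and \<open>m\<close> below is \<open>q\<^sup>* T q\<close>.
\<close>
lemma compression_rank1:
  assumes T: "(mat 1 - rank1_proj oz) ** T ** (mat 1 - rank1_proj oz) = T" and h: "hermitian T"
  obtains \<mu> :: real where "T = \<mu> *\<^sub>R (mat 1 - rank1_proj oz)"
proof -
  obtain t1 t2 t3 t4 where t: "T = mat22 t1 t2 t3 t4" by (rule mat22_cases)
  from h have ht: "t1 = cnj t1" "t2 = cnj t3" "t4 = cnj t4" unfolding t mat22_simps by blast+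
  show thesis
  proof (cases oz)
    case None
    have "of_real (Re t1) = t1" by (metis Reals_cnj_iff of_real_Re ht(1))
    then have "T = (Re t1) *\<^sub>R (mat 1 - rank1_proj oz)"
      using T unfolding None rank1_proj_mat22 t mat22_simps mat22_eq_iff by (simp add: scaleR_conv_of_real)
    then show thesis by (rule that)
  next
    case (Some z)
    define N where "N = 1 + z * cnj z"
    have N: "N \<noteq> 0" unfolding N_def by (rule one_plus_norm_nonzero)
    have Q: "mat 1 - rank1_proj oz = mat22 (z * cnj z / N) (- z / N) (- cnj z / N) (1 / N)"
      unfolding Some rank1_proj_mat22 mat22_simps mat22_eq_iff N_def[symmetric]
      using N by (simp add: field_simps) (simp add: N_def)
    define m where "m = cnj z * t1 * z - cnj z * t2 - z * t3 + t4"
    have "cnj m = m" unfolding m_def using ht by (simp add: algebra_simps)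
    moreover have "cnj N = N" by (simp add: N_def mult.commute)
    ultimately have "m / N = cnj (m / N)" by simp
    then have mN: "m / N = of_real (Re (m / N))"
      by (metis Reals_cnj_iff of_real_Re)
    have T': "T = mat22 (z * cnj z / N * (m / N)) (- z / N * (m / N)) (- cnj z / N * (m / N)) (1 / N * (m / N))"
    proof -
      have "mat22 t1 t2 t3 t4 = mat22 (z * cnj z / N) (- z / N) (- cnj z / N) (1 / N) ** mat22 t1 t2 t3 t4
          ** mat22 (z * cnj z / N) (- z / N) (- cnj z / N) (1 / N)"
        using T[symmetric] unfolding Q t .
      also have "\<dots> = mat22 (z * cnj z / N * (m / N)) (- z / N * (m / N)) (- cnj z / N * (m / N)) (1 / N * (m / N))"
        unfolding mat22_simps mat22_eq_iff m_def using N by (simp add: field_simps)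
      finally show ?thesis unfolding t .
    qed
    have "T = Re (m / N) *\<^sub>R (mat 1 - rank1_proj oz)"
      unfolding Q unfolding mat22_simps(6) unfolding scaleR_conv_of_real mN[symmetric] unfolding T' mat22_eq_iff
      by simp
    then show thesis by (rule that)
  qed
qed

text \<open>
  For a projection with diagonal \<open>a, d\<close> and entry \<open>b\<close> off the diagonal, idempotency gives \<open>b (a + d - 1) = 0\<close>. If
  \<open>b = 0\<close>, the diagonal entries are \<open>0\<close> or \<open>1\<close>; otherwise the trace is one and \<open>z = b / a\<close>.
\<close>
lemma vertex_conditions_cases:
  assumes v: "vertex_conditions P T"
  obtains (dirichlet) "P = mat 1" "T = 0"
    | (rank1) oz and \<mu> :: real where "P = rank1_proj oz" "T = \<mu> *\<^sub>R (mat 1 - P)"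
    | (free) a b :: real and c where "P = 0" "T = vector [vector [of_real a, c], vector [cnj c, of_real b]]"
proof -
  have PP: "P ** P = P" and hP: "hermitian P" and hT: "hermitian T"
    and QTQ: "(mat 1 - P) ** T ** (mat 1 - P) = T"
    using v by (auto simp: vertex_conditions_def)
  obtain a b c d where P: "P = mat22 a b c d" by (rule mat22_cases)
  from hP have h: "a = cnj a" "b = cnj c" "d = cnj d" unfolding P mat22_simps by blast+
  from PP have e: "a * a + b * c = a" "a * b + b * d = b" "c * a + d * c = c" "c * b + d * d = d"
    unfolding P mat22_simps mat22_eq_iff by blast+
  show thesis
  proof (cases "b = 0")
    case True
    then have c: "c = 0" using h(2) by simp
    have "a = 0 \<or> a = 1" "d = 0 \<or> d = 1" using e(1,4) True c by auto
    then consider "a = 1" "d = 1" | "a = 0" "d = 1" | "a = 1" "d = 0" | "a = 0" "d = 0" by blast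
    then show thesis
    proof cases
      case 1
      then have "P = mat 1" unfolding P mat22_simps using True c by simp
      moreover from this QTQ have "T = 0" by (simp add: matrix_vector_mult_0 flip: matrix_mul_assoc)
      ultimately show thesis by (rule dirichlet)
    next
      case 2
      then have P: "P = rank1_proj None" unfolding P rank1_proj_mat22 using True c by simp
      show thesis
        by (rule compression_rank1[OF QTQ[unfolded P] hT]) (rule rank1[OF P], simp only: P)
    next
      case 3
      then have P: "P = rank1_proj (Some 0)" unfolding P rank1_proj_mat22 using True c by simp
      show thesis
        by (rule compression_rank1[OF QTQ[unfolded P] hT]) (rule rank1[OF P], simp only: P)
    next
      case 4
      then have P: "P = 0" unfolding P mat22_simps using True c by simp
      obtain t1 t2 t3 t4 where t: "T = mat22 t1 t2 t3 t4" by (rule mat22_cases)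
      from hT have ht: "t1 = cnj t1" "t2 = cnj t3" "t3 = cnj t2" "t4 = cnj t4" unfolding t mat22_simps by blast+
      have "t1 = of_real (Re t1)" "t4 = of_real (Re t4)" using ht by (auto simp: complex_eq_iff)
      then have "T = vector [vector [of_real (Re t1), t2], vector [cnj t2, of_real (Re t4)]]"
        using t ht(3) by (simp add: mat22_def)
      with P show thesis by (rule free)
    qed
  next
    case False
    then have c0: "c \<noteq> 0" using h(2) by auto
    have "b * (a + d - 1) = 0" using e(2) by (simp add: algebra_simps)
    then have "a + d - 1 = 0" using False mult_eq_0_iff by blast
    then have d: "d = 1 - a" by (simp add: eq_diff_eq add.commute)
    have a0: "a \<noteq> 0" using e(1) False c0 by auto
    define z where "z = b / a"
    have cz: "cnj z = c / a" using h by (simp add: z_def)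
    have N: "1 + z * cnj z = 1 / a"
    proof -
      have "a * a * (1 + z * cnj z) = a * a + b * c" unfolding cz unfolding z_def using a0 by (simp add: field_simps)
      also have "\<dots> = a" by (rule e(1))
      finally have "a * (a * (1 + z * cnj z) - 1) = 0" by (simp add: algebra_simps)
      then have "(1 + z * cnj z) * a = 1" using a0 mult_eq_0_iff by (simp add: mult.commute)
      then show ?thesis using a0 by (simp only: nonzero_eq_divide_eq not_False_eq_True)
    qed
    have zz: "z * cnj z = 1 / a - 1" using N by (simp add: algebra_simps)
    have "1 / (1 / a) = a" "z / (1 / a) = b" using a0 by (simp_all add: z_def)
    moreover have "cnj z / (1 / a) = c" using a0 by (simp add: cz)
    moreover have "z * cnj z / (1 / a) = d" unfolding zz d using a0 by (simp add: field_simps)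
    ultimately have P: "P = rank1_proj (Some z)"
      by (simp only: P rank1_proj_mat22 N)
    show thesis
      by (rule compression_rank1[OF QTQ[unfolded P] hT]) (rule rank1[OF P], simp only: P)
  qed
qed

lemma vertex_cond_dirichlet:
  "vertex_cond (mat 1) 0 (vector [U1, U2]) (vector [V1, V2]) \<longleftrightarrow> U1 = 0 \<and> U2 = 0"
  unfolding vertex_cond_def mat22_simps vector2_zero vector2_eq_iff by simp

lemma vertex_cond_None:
  "vertex_cond (rank1_proj None) (\<mu> *\<^sub>R (mat 1 - rank1_proj None)) (vector [U1, U2]) (vector [V1, V2]) \<longleftrightarrow>
   V1 = of_real \<mu> * U1 \<and> U2 = 0"
  unfolding vertex_cond_def rank1_proj_mat22 mat22_simps vector2_zero vector2_eq_iff
  by (auto simp: scaleR_conv_of_real)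

text \<open>
  The range of \<open>P\<close> is spanned by \<open>(1, cnj z)\<close> and that of \<open>Q\<close> by \<open>(z, -1)\<close>, so each vector equation has
  one scalar content.
\<close>
lemma vertex_cond_Some:
  "vertex_cond (rank1_proj (Some z)) (\<mu> *\<^sub>R (mat 1 - rank1_proj (Some z))) (vector [U1, U2]) (vector [V1, V2]) \<longleftrightarrow>
   U1 + z * U2 = 0 \<and> cnj z * V1 - V2 = of_real \<mu> * (cnj z * U1 - U2)"
proof -
  define N where "N = 1 + z * cnj z"
  have N: "N \<noteq> 0" unfolding N_def by (rule one_plus_norm_nonzero)
  have P: "rank1_proj (Some z) = mat22 (1 / N) (z / N) (cnj z / N) (z * cnj z / N)"
    unfolding rank1_proj_mat22 N_def ..
  have Q: "mat 1 - rank1_proj (Some z) = mat22 (z * cnj z / N) (- z / N) (- cnj z / N) (1 / N)"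
    unfolding P mat22_simps mat22_eq_iff using N by (simp add: field_simps) (simp add: N_def)
  let ?X = "cnj z * V1 - V2" and ?Y = "cnj z * U1 - U2" and ?W = "U1 + z * U2"
  have PU: "rank1_proj (Some z) *v vector [U1, U2] = vector [?W / N, cnj z * ?W / N]"
    unfolding P mat22_simps vector2_eq_iff using N by (simp add: field_simps)
  have QV: "(mat 1 - rank1_proj (Some z)) *v vector [v1, v2] =
      vector [z * (cnj z * v1 - v2) / N, - ((cnj z * v1 - v2) / N)]" for v1 v2
    unfolding Q unfolding mat22_simps vector2_eq_iff by (simp add: algebra_simps diff_divide_distrib)
  have "cnj z * (z * ?Y / N) - - (?Y / N) = (1 + z * cnj z) * ?Y / N"
    by (simp add: algebra_simps add_divide_distrib diff_divide_distrib)
  also have "\<dots> = ?Y" unfolding N_def[symmetric] using N by simp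
  finally have E: "cnj z * (z * ?Y / N) - - (?Y / N) = ?Y" .
  have QQ: "(mat 1 - rank1_proj (Some z)) *v vector [z * ?Y / N, - (?Y / N)] = vector [z * ?Y / N, - (?Y / N)]"
    unfolding QV E ..
  have TQ: "(\<mu> *\<^sub>R (mat 1 - rank1_proj (Some z))) *v x = \<mu> *\<^sub>R ((mat 1 - rank1_proj (Some z)) *v x)" for x
    by (simp add: vec_eq_iff matrix_vector_mult_def scaleR_sum_right)
  have TQU: "(\<mu> *\<^sub>R (mat 1 - rank1_proj (Some z))) *v ((mat 1 - rank1_proj (Some z)) *v vector [U1, U2])
      = vector [of_real \<mu> * (z * ?Y / N), of_real \<mu> * - (?Y / N)]"
    unfolding TQ QV[of U1 U2] QQ by (simp add: vec_eq_iff forall_2) (simp add: scaleR_conv_of_real)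
  have "vertex_cond (rank1_proj (Some z)) (\<mu> *\<^sub>R (mat 1 - rank1_proj (Some z))) (vector [U1, U2]) (vector [V1, V2])
    \<longleftrightarrow> ?W / N = 0 \<and> cnj z * ?W / N = 0 \<and> z * ?X / N = of_real \<mu> * (z * ?Y / N) \<and> - (?X / N) = of_real \<mu> * - (?Y / N)"
    unfolding vertex_cond_def PU TQU unfolding QV vector2_zero vector2_eq_iff by blast
  also have "\<dots> \<longleftrightarrow> ?W = 0 \<and> ?X = of_real \<mu> * ?Y"
  proof -
    have "- (X / N) = u * - (Y / N) \<longleftrightarrow> X = u * Y" for X Y u
    proof -
      have "u * - (Y / N) = - (u * Y / N)" by simp
      then show ?thesis using N by (simp only: neg_equal_iff_equal divide_cancel_right) simp
    qed
    then show ?thesis using N by auto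
  qed
  finally show ?thesis .
qed

lemma vertex_cond_free:
  "vertex_cond 0 (vector [vector [t1, t2], vector [t3, t4]]) (vector [U1, U2]) (vector [V1, V2]) \<longleftrightarrow>
   V1 = t1 * U1 + t2 * U2 \<and> V2 = t3 * U1 + t4 * U2"
  unfolding vertex_cond_def mat22_def[symmetric] mat22_simps vector2_zero vector2_eq_iff by simp

context
  fixes k :: complex
  assumes nonreal: "k\<^sup>2 \<notin> \<real>"
begin

lemma dirichlet_coeffs:
  obtains r p q where "solution_coeffs (mat 1) 0 k r p q" "p 0 0 = 0" "p 1 = (\<lambda>z. 0)"
    "p 2 = (\<lambda>z. 0)" "p 3 = (\<lambda>z. 0)"
proof -
  have rows: "vertex_cond (mat 1) 0 (vector [U1, U2]) (vector [V1, V2]) \<longleftrightarrow>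
      1 * U1 + 0 * U2 + 0 * V1 + 0 * V2 = 0 \<and> 0 * U1 + 1 * U2 + 0 * V1 + 0 * V2 = 0" for U1 U2 V1 V2
    by (simp add: vertex_cond_dirichlet)
  have det: "1 * (1 * sin k - 0 * k * cos k) - 0 * (0 * sin k - 0 * k * cos k) \<noteq> 0"
    using sin_nonzero[OF nonreal] by simp
  show thesis
  proof (rule regular_solution_coeffs[OF rows k_nonzero[OF nonreal] det])
    fix r p q
    assume a: "solution_coeffs (mat 1) 0 k r p q" "p 0 0 = 0" "p 1 0 = 0"
      "(0::complex) = 0 \<Longrightarrow> (0::complex) = 0 \<Longrightarrow> p 2 = (\<lambda>z. 0) \<and> p 3 = (\<lambda>z. 0)"
      "(0::complex) = 0 \<Longrightarrow> (0::complex) = 0 \<Longrightarrow> p 1 = (\<lambda>z. 0)"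
    show thesis by (rule that[OF a(1,2)]) (use a in auto)
  qed
qed

lemma None_coeffs:
  fixes \<mu> :: real
  assumes "\<mu> \<noteq> 0"
  obtains r p q where "solution_coeffs (rank1_proj None) (\<mu> *\<^sub>R (mat 1 - rank1_proj None)) k r p q"
    "p 0 0 = 0" "p 1 0 = 0" "p 2 = (\<lambda>z. 0)" "p 3 = (\<lambda>z. 0)"
proof -
  let ?P = "rank1_proj None"
  have rows: "vertex_cond ?P (\<mu> *\<^sub>R (mat 1 - ?P)) (vector [U1, U2]) (vector [V1, V2]) \<longleftrightarrow>
      - of_real \<mu> * U1 + 0 * U2 + 1 * V1 + 0 * V2 = 0 \<and> 0 * U1 + 1 * U2 + 0 * V1 + 0 * V2 = 0" for U1 U2 V1 V2
    unfolding vertex_cond_None by (auto simp: algebra_simps)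
  have det: "- of_real \<mu> * (1 * sin k - 0 * k * cos k) - 0 * (0 * sin k - 0 * k * cos k) \<noteq> 0"
    using assms sin_nonzero[OF nonreal] by simp
  show thesis
  proof (rule regular_solution_coeffs[OF rows k_nonzero[OF nonreal] det])
    fix r p q
    assume a: "solution_coeffs ?P (\<mu> *\<^sub>R (mat 1 - ?P)) k r p q" "p 0 0 = 0" "p 1 0 = 0"
      "(0::complex) = 0 \<Longrightarrow> (0::complex) = 0 \<Longrightarrow> p 2 = (\<lambda>z. 0) \<and> p 3 = (\<lambda>z. 0)"
      "(1::complex) = 0 \<Longrightarrow> (0::complex) = 0 \<Longrightarrow> p 1 = (\<lambda>z. 0)"
    show thesis by (rule that[OF a(1,2)]) (use a in auto)
  qed
qed

lemma None_neumann_coeffs: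
  obtains r p q where "solution_coeffs (rank1_proj None) 0 k r p q" "p 2 = (\<lambda>z. 0)" "p 3 = (\<lambda>z. 0)"
proof -
  let ?P = "rank1_proj None"
  have "vertex_cond ?P 0 (vector [U1, U2]) (vector [V1, V2]) \<longleftrightarrow>
      V1 = 0 \<and> 1 * U2 + 0 * V2 = 0" for U1 U2 V1 V2
    using vertex_cond_None[of 0] by simp
  moreover have "1 * sin k - 0 * k * cos k \<noteq> 0" using sin_nonzero[OF nonreal] by simp
  ultimately show thesis
    using neumann_solution_coeffs[OF _ k_nonzero[OF nonreal]] that by blast
qed

lemma Some_coeffs:
  fixes \<mu> :: real
  obtains r p q where "solution_coeffs (rank1_proj (Some z)) (\<mu> *\<^sub>R (mat 1 - rank1_proj (Some z))) k r p q"
    "p 1 0 = 0"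
proof -
  let ?P = "rank1_proj (Some z)"
  have rows: "vertex_cond ?P (\<mu> *\<^sub>R (mat 1 - ?P)) (vector [U1, U2]) (vector [V1, V2]) \<longleftrightarrow>
      1 * U1 + z * U2 + 0 * V1 + 0 * V2 = 0 \<and>
      (- of_real \<mu> * cnj z) * U1 + of_real \<mu> * U2 + cnj z * V1 + (- 1) * V2 = 0" for U1 U2 V1 V2
    unfolding vertex_cond_Some by (auto simp: algebra_simps)
  have "1 * (of_real \<mu> * sin k - (- 1) * k * cos k) - (- of_real \<mu> * cnj z) * (z * sin k - 0 * k * cos k)
      = k * cos k + of_real (\<mu> * (1 + (cmod z)\<^sup>2)) * sin k"
    by (simp add: complex_norm_square algebra_simps del: of_real_power)
  also have "\<dots> \<noteq> 0" by (rule robin_nonzero[OF nonreal])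
  finally show thesis
    using regular_solution_coeffs[OF rows k_nonzero[OF nonreal]] that by blast
qed

lemma free_coeffs:
  fixes a b :: real
  assumes "(a, c) \<noteq> (0, 0)"
  obtains r p q where "solution_coeffs 0 (vector [vector [of_real a, c], vector [cnj c, of_real b]]) k r p q"
    "p 1 0 = 0"
proof -
  have rows: "vertex_cond 0 (vector [vector [of_real a, c], vector [cnj c, of_real b]]) (vector [U1, U2]) (vector [V1, V2]) \<longleftrightarrow>
      (- of_real a) * U1 + (- c) * U2 + 1 * V1 + 0 * V2 = 0 \<and>
      (- cnj c) * U1 + (- of_real b) * U2 + 0 * V1 + 1 * V2 = 0" for U1 U2 V1 V2
    unfolding vertex_cond_free by (auto simp: algebra_simps)
  let ?d = "(- of_real a) * ((- of_real b) * sin k - 1 * k * cos k) - (- cnj c) * ((- c) * sin k - 0 * k * cos k)"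
  have "?d \<noteq> 0"
  proof (cases "a = 0")
    case True
    then show ?thesis using assms sin_nonzero[OF nonreal] by simp
  next
    case False
    \<comment> \<open>Completing the pivot \<open>a\<close>: eliminating the short edge leaves a Robin condition with a real constant.\<close>
    have eq: "?d = of_real a * (k * cos k + of_real (b - (cmod c)\<^sup>2 / a) * sin k)"
      using False by (simp add: complex_norm_square field_simps del: of_real_power)
    show ?thesis
      unfolding eq using False robin_nonzero[OF nonreal, of "b - (cmod c)\<^sup>2 / a"]
      by (simp only: mult_eq_0_iff of_real_eq_0_iff simp_thms)
  qed
  then show thesis
    using regular_solution_coeffs[OF rows k_nonzero[OF nonreal]] that by blast
qed

lemma free_neumann_coeffs:
  fixes b :: real
  obtains r p q where "solution_coeffs 0 (vector [vector [0, 0], vector [0, of_real b]]) k r p q"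
    "p 2 = (\<lambda>z. 0)" "p 3 = (\<lambda>z. 0)"
proof -
  have rows: "vertex_cond 0 (vector [vector [0, 0], vector [0, of_real b]]) (vector [U1, U2]) (vector [V1, V2]) \<longleftrightarrow>
      V1 = 0 \<and> of_real b * U2 + (- 1) * V2 = 0" for U1 U2 V1 V2
    unfolding vertex_cond_free by auto
  have "of_real b * sin k - (- 1) * k * cos k \<noteq> 0"
    using robin_nonzero[OF nonreal, of b] by (simp add: add.commute)
  then show thesis
    using neumann_solution_coeffs[OF rows k_nonzero[OF nonreal]] that by blast
qed

lemma solution_coeffs_exist:
  assumes "vertex_conditions P T"
  obtains r p q where "solution_coeffs P T k r p q"
  using assms
proof (cases rule: vertex_conditions_cases)
  case dirichlet
  obtain r p q where "solution_coeffs (mat 1) 0 k r p q" by (rule dirichlet_coeffs)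
  then show thesis by (intro that) (simp only: dirichlet)
next
  case (rank1 oz \<mu>)
  show thesis
  proof (cases oz)
    case None
    show thesis
    proof (cases "\<mu> = 0")
      case True
      obtain r p q where "solution_coeffs (rank1_proj None) 0 k r p q" by (rule None_neumann_coeffs)
      then show thesis by (intro that) (simp only: rank1 None True scaleR_zero_left)
    next
      case False
      obtain r p q where "solution_coeffs (rank1_proj None) (\<mu> *\<^sub>R (mat 1 - rank1_proj None)) k r p q"
        by (rule None_coeffs[OF False])
      then show thesis by (intro that) (simp only: rank1 None)
    qed
  next
    case (Some z)
    obtain r p q where "solution_coeffs (rank1_proj (Some z)) (\<mu> *\<^sub>R (mat 1 - rank1_proj (Some z))) k r p q"
      by (rule Some_coeffs)
    then show thesis by (intro that) (simp only: rank1 Some)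
  qed
next
  case (free a b c)
  show thesis
  proof (cases "(a, c) = (0, 0)")
    case True
    obtain r p q where "solution_coeffs 0 (vector [vector [0, 0], vector [0, of_real b]]) k r p q"
      by (rule free_neumann_coeffs)
    moreover have "T = vector [vector [0, 0], vector [0, of_real b]]" using free True by simp
    ultimately show thesis by (intro that) (simp only: free(1))
  next
    case False
    obtain r p q where "solution_coeffs 0 (vector [vector [of_real a, c], vector [cnj c, of_real b]]) k r p q"
      by (rule free_coeffs[OF False])
    then show thesis by (intro that) (simp only: free)
  qed
qed

end

section \<open>Resolvent formula and Taylor expansion\<close>

text \<open>
  Stretching the short edge to unit length multiplies the frequency by its length. This is where \<open>\<epsilon>\<close> enters
  holomorphically.
\<close>
lemma conv_S_scale:
  assumes f: "f \<in> L2 1" and e: "0 < e" and x: "x \<in> {0..1}"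
  shows "sin_conv k (S_scale e f) (e * x) = of_real e * sin_conv (k * of_real e) f x"
    and "cos_conv k (S_scale e f) (e * x) = of_real e * cos_conv (k * of_real e) f x"
proof -
  have ai: "f absolutely_integrable_on {0..x}"
    using absolutely_integrable_sub[OF L2_absolutely_integrable[OF f], of 0 x] x by auto
  have gen: "integral {0..e * x} (\<lambda>t. \<phi> (k * of_real (e * x - t)) * S_scale e f t)
      = of_real e * integral {0..x} (\<lambda>t. \<phi> (k * of_real e * of_real (x - t)) * f t)"
    if "continuous_on {0..x} (\<lambda>t. \<phi> (k * of_real e * of_real (x - t)))" for \<phi> :: "complex \<Rightarrow> complex"
  proof -
    let ?h = "\<lambda>t. \<phi> (k * of_real e * of_real (x - t)) * f t"
    have "?h integrable_on {0..x}"
      using absolutely_integrable_continuous_mult[OF ai that] by (rule set_lebesgue_integral_eq_integral(1))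
    then have "(?h has_integral integral {0..x} ?h) (cbox 0 x)"
      by (simp add: integrable_integral)
    from has_integral_affinity'[OF this, of "1 / e" 0] e
    have "((\<lambda>t. ?h (t / e)) has_integral of_real e * integral {0..x} ?h) {0..e * x}"
      by (simp add: scaleR_conv_of_real mult.commute)
    moreover have "(\<lambda>t. ?h (t / e)) = (\<lambda>t. \<phi> (k * of_real (e * x - t)) * S_scale e f t)"
    proof
      fix t
      have "of_real e * of_real (x - t / e) = (of_real (e * x - t) :: complex)"
        using e by (simp add: field_simps flip: of_real_mult)
      then show "?h (t / e) = \<phi> (k * of_real (e * x - t)) * S_scale e f t"
        by (simp only: S_scale_def mult.assoc)
    qed
    ultimately show ?thesis by (simp only: integral_unique)
  qed
  show "sin_conv k (S_scale e f) (e * x) = of_real e * sin_conv (k * of_real e) f x"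
    "cos_conv k (S_scale e f) (e * x) = of_real e * cos_conv (k * of_real e) f x"
    unfolding sin_conv_def cos_conv_def by (rule gen, rule continuous_on_trig)+
qed

definition amplitude :: "complex \<Rightarrow> (nat \<Rightarrow> complex \<Rightarrow> complex) \<Rightarrow> complex \<Rightarrow> gfun \<Rightarrow> complex" where
  "amplitude k p z f = lin4 p z (sin_conv (k * z) (fst f) 1) (cos_conv (k * z) (fst f) 1)
      (sin_conv k (snd f) 1) (cos_conv k (snd f) 1)"

text \<open>
  The two components of the resolvent, the short one in the rescaled variable, as functions of a complex parameter
  \<open>z\<close> in place of \<open>\<epsilon>\<close>.
\<close>
definition short_family :: "complex \<Rightarrow> (nat \<Rightarrow> complex \<Rightarrow> complex) \<Rightarrow> complex \<Rightarrow> gop" where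
  "short_family k p z f x = amplitude k p z f * cos (k * z * of_real x) - z / k * sin_conv (k * z) (fst f) x"

definition long_family :: "complex \<Rightarrow> (nat \<Rightarrow> complex \<Rightarrow> complex) \<Rightarrow> complex \<Rightarrow> gop" where
  "long_family k q z f x = amplitude k q z f * sin (k * of_real x) - sin_conv k (snd f) x / k"

lemma inv_S_scale:
  assumes "0 < e"
  shows "inv (S_scale e) h x = h (e * x)"
proof -
  have "inj (S_scale e)"
  proof (rule injI)
    fix u v assume "S_scale e u = S_scale e v"
    then have "u (e * y / e) = v (e * y / e)" for y unfolding S_scale_def by metis
    then show "u = v" using assms by (simp add: fun_eq_iff)
  qed
  moreover have "S_scale e (\<lambda>x. h (e * x)) = h"
    using assms by (simp add: S_scale_def fun_eq_iff)
  ultimately have "inv (S_scale e) h = (\<lambda>x. h (e * x))" by (metis inv_f_f)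
  then show ?thesis by simp
qed

text \<open>
  The resolvent is a choice among the solutions of the boundary value problem. The explicit functions show that there
  is a solution, and uniqueness on each edge together with the equivalence in \<open>solution_coeffs\<close> shows that any solution
  has these values.
\<close>
proposition resolvent_formula:
  assumes sol: "solution_coeffs P T k r p q" and k: "k \<noteq> 0"
    and e: "0 < \<epsilon>" "\<epsilon> < r" and f: "f \<in> L2G 1" and x: "x \<in> {0..1}"
  shows "R_s P T (k\<^sup>2) \<epsilon> f x = short_family k p (of_real \<epsilon>) f x"
    and "R_e P T (k\<^sup>2) \<epsilon> f x = long_family k q (of_real \<epsilon>) f x"
proof -
  let ?g = "S_scale \<epsilon> (fst f)"
  let ?a = "amplitude k p (of_real \<epsilon>) f" and ?b = "amplitude k q (of_real \<epsilon>) f"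
  have fL: "fst f \<in> L2 1" "snd f \<in> L2 1" using f by (auto simp: L2G_def)
  have gL: "?g \<in> L2 \<epsilon>" using L2_scale[OF fL(1) e(1)] .
  define is_resolvent where "is_resolvent = (\<lambda>u. u \<in> H_dom P T \<epsilon> \<and>
     aeq \<epsilon> (\<lambda>x. fst (H_op \<epsilon> u) x - k\<^sup>2 * fst u x) ?g \<and>
     aeq 1 (\<lambda>x. snd (H_op \<epsilon> u) x - k\<^sup>2 * snd u x) (snd f))"
  let ?S = "sin_conv (k * of_real \<epsilon>) (fst f) 1" and ?C = "cos_conv (k * of_real \<epsilon>) (fst f) 1"
  let ?s = "sin_conv k (snd f) 1" and ?c = "cos_conv k (snd f) 1"
  have end_conv: "sin_conv k ?g \<epsilon> = of_real \<epsilon> * ?S" "cos_conv k ?g \<epsilon> = of_real \<epsilon> * ?C"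
    using conv_S_scale[OF fL(1) e(1), of 1 k] by simp_all
  have cond_iff: "vertex_cond P T (ansatz_val k (of_real \<epsilon>) a b ?S ?s) (ansatz_der k (of_real \<epsilon>) a b ?C ?c)
      \<longleftrightarrow> a = ?a \<and> b = ?b" for a b
    using sol e unfolding solution_coeffs_def amplitude_def by blast
  have val: "vector [edge_sol k a 0 ?g \<epsilon>, edge_sol k 0 (b * k) (snd f) 1] = ansatz_val k (of_real \<epsilon>) a b ?S ?s" for a b
    using k by (simp add: edge_sol_def ansatz_val_def end_conv)
  have der: "vector [- edge_sol' k a 0 ?g \<epsilon>, - edge_sol' k 0 (b * k) (snd f) 1] = ansatz_der k (of_real \<epsilon>) a b ?C ?c" for a b
    by (simp add: edge_sol'_def ansatz_der_def end_conv add.commute)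
  have "is_resolvent (edge_sol k ?a 0 ?g, edge_sol k 0 (?b * k) (snd f))" (is "is_resolvent ?w")
  proof -
    note E = edge_sol_edge_equation[OF gL e(1) k, of ?a 0] edge_sol_edge_equation[OF fL(2) _ k, of 0 "?b * k", simplified]
    have "vtx_val \<epsilon> ?w = ansatz_val k (of_real \<epsilon>) ?a ?b ?S ?s"
      by (simp add: vtx_val_def val)
    moreover have "vtx_deriv \<epsilon> ?w = ansatz_der k (of_real \<epsilon>) ?a ?b ?C ?c"
      using edge_sol_deriv1[OF gL e(1) k, of \<epsilon> ?a 0] edge_sol_deriv1[OF fL(2) _ k, of 1 0 "?b * k"] e
      by (simp add: vtx_deriv_def der)
    ultimately have "vertex_cond P T (vtx_val \<epsilon> ?w) (vtx_deriv \<epsilon> ?w)"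
      using cond_iff by simp
    moreover have "deriv1 \<epsilon> (edge_sol k ?a 0 ?g) 0 = 0"
      using edge_sol_deriv1[OF gL e(1) k, of 0 ?a 0] e by (simp add: edge_sol'_def)
    moreover have "edge_sol k 0 (?b * k) (snd f) 0 = 0" by (simp add: edge_sol_def)
    ultimately show ?thesis
      using E unfolding is_resolvent_def H_dom_def H_op_def vertex_cond_def edge_equation_def by simp
  qed
  then have "is_resolvent (SOME u. is_resolvent u)" by (rule someI)
  moreover define u where "u = H_resolvent P T (k\<^sup>2) \<epsilon> (?g, snd f)"
  ultimately have u: "is_resolvent u" by (simp add: H_resolvent_def is_resolvent_def)
  define a where "a = fst u 0"
  define b where "b = deriv1 1 (snd u) 0 / k"
  have E1: "edge_equation \<epsilon> (k\<^sup>2) ?g (fst u)" and E2: "edge_equation 1 (k\<^sup>2) (snd f) (snd u)"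
    and N: "deriv1 \<epsilon> (fst u) 0 = 0" and D: "snd u 0 = 0"
    and vc: "vertex_cond P T (vtx_val \<epsilon> u) (vtx_deriv \<epsilon> u)"
    using u unfolding is_resolvent_def H_dom_def H_op_def vertex_cond_def edge_equation_def by auto
  have fu: "fst u y = edge_sol k a 0 ?g y" "deriv1 \<epsilon> (fst u) y = edge_sol' k a 0 ?g y" if "y \<in> {0..\<epsilon>}" for y
    using edge_equation_unique[OF E1 gL e(1) k that] by (simp_all add: a_def N)
  have su: "snd u y = edge_sol k 0 (b * k) (snd f) y" "deriv1 1 (snd u) y = edge_sol' k 0 (b * k) (snd f) y"
    if "y \<in> {0..1}" for y
    using edge_equation_unique[OF E2 fL(2) _ k that] k by (simp_all add: b_def D)
  have "vtx_val \<epsilon> u = ansatz_val k (of_real \<epsilon>) a b ?S ?s"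
    using fu(1)[of \<epsilon>] su(1)[of 1] e by (simp add: vtx_val_def flip: val)
  moreover have "vtx_deriv \<epsilon> u = ansatz_der k (of_real \<epsilon>) a b ?C ?c"
    using fu(2)[of \<epsilon>] su(2)[of 1] e by (simp add: vtx_deriv_def flip: der)
  ultimately have ab: "a = ?a" "b = ?b" using vc cond_iff by auto
  have "R_s P T (k\<^sup>2) \<epsilon> f x = fst u (\<epsilon> * x)"
    unfolding R_s_def inv_S_scale[OF e(1)] u_def ..
  also have "\<dots> = edge_sol k a 0 ?g (\<epsilon> * x)"
    using e x by (intro fu(1)) (auto intro: mult_left_le)
  also have "\<dots> = short_family k p (of_real \<epsilon>) f x"
    unfolding edge_sol_def short_family_def conv_S_scale(1)[OF fL(1) e(1) x] ab by (simp add: mult.assoc)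
  finally show "R_s P T (k\<^sup>2) \<epsilon> f x = short_family k p (of_real \<epsilon>) f x" .
  have "R_e P T (k\<^sup>2) \<epsilon> f x = snd u x"
    unfolding R_e_def u_def ..
  also have "\<dots> = long_family k q (of_real \<epsilon>) f x"
    unfolding su(1)[OF x] edge_sol_def long_family_def ab using k by simp
  finally show "R_e P T (k\<^sup>2) \<epsilon> f x = long_family k q (of_real \<epsilon>) f x" .
qed

text \<open>
  Passing to the half-size ball provides the uniform bounds that \<open>hol_family\<close> requires of coefficients.
\<close>
lemma holomorphic_bounded_half_ball:
  assumes "h holomorphic_on ball 0 r" "0 < r"
  obtains M where "\<And>z::complex. z \<in> ball 0 (r/2) \<Longrightarrow> cmod (h z) \<le> M"
proof -
  have "cball 0 (r/2) \<subseteq> ball (0::complex) r" using assms(2) by auto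
  then have "bounded (h ` cball 0 (r/2))"
    using holomorphic_on_imp_continuous_on[OF assms(1)]
    by (intro compact_imp_bounded compact_continuous_image) (auto elim: continuous_on_subset)
  then obtain M where "\<forall>z\<in>cball 0 (r/2). cmod (h z) \<le> M" unfolding bounded_iff by blast
  then show thesis by (intro that[of M]) auto
qed

lemma hol_family_scalar:
  assumes F: "hol_family F (r/2)" and h: "h holomorphic_on ball 0 r" and r: "0 < r"
  shows "hol_family (\<lambda>z f x. h z * F z f x) (r/2)"
proof -
  obtain M where M: "\<And>z. z \<in> ball 0 (r/2) \<Longrightarrow> cmod (h z) \<le> M"
    using holomorphic_bounded_half_ball[OF h r] by blast
  have "ball 0 (r/2) \<subseteq> ball (0::complex) r" using r by auto
  then show ?thesis
    using hol_family_mult[OF F, of "\<lambda>z x. h z" M] M holomorphic_on_subset[OF h] by auto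
qed

lemma scaled_conv_hol_family:
  assumes r: "0 < r" and b: "b = (\<lambda>x. x) \<or> b = (\<lambda>x. 1)"
  shows "hol_family (\<lambda>z f x. sin_conv (k * z) (fst f) (b x)) (r/2)"
    and "hol_family (\<lambda>z f x. cos_conv (k * z) (fst f) (b x)) (r/2)"
    and "hol_family (\<lambda>z f x. sin_conv k (snd f) (b x)) (r/2)"
    and "hol_family (\<lambda>z f x. cos_conv k (snd f) (b x)) (r/2)"
proof -
  have "(\<lambda>z. k * z) holomorphic_on ball 0 (r/2)" by (intro holomorphic_intros)
  moreover have "cmod (k * z) \<le> cmod k * r" if "z \<in> ball 0 (r/2)" for z
    using that r by (simp add: norm_mult mult_left_mono)
  ultimately show "hol_family (\<lambda>z f x. sin_conv (k * z) (fst f) (b x)) (r/2)"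
    "hol_family (\<lambda>z f x. cos_conv (k * z) (fst f) (b x)) (r/2)"
    using hol_family_conv[of fst b "\<lambda>z. k * z" "r/2" "cmod k * r"] b by auto
  show "hol_family (\<lambda>z f x. sin_conv k (snd f) (b x)) (r/2)"
    "hol_family (\<lambda>z f x. cos_conv k (snd f) (b x)) (r/2)"
    using hol_family_conv[of snd b "\<lambda>z. k" "r/2" "cmod k"] b by auto
qed

lemma amplitude_hol_family:
  assumes r: "0 < r" and p: "\<And>i. i < 4 \<Longrightarrow> p i holomorphic_on ball 0 r"
  shows "hol_family (\<lambda>z f x. amplitude k p z f) (r/2)"
proof -
  have 1: "(\<lambda>x. 1) = (\<lambda>x. x) \<or> (\<lambda>x. 1) = (\<lambda>x::real. 1::real)" by simp
  note F = scaled_conv_hol_family[OF r 1, of k]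
  note p4 = p[of 0] p[of 1] p[of 2] p[of 3]
  have "hol_family (\<lambda>z f x. p 0 z * sin_conv (k * z) (fst f) 1) (r/2)"
    "hol_family (\<lambda>z f x. p 1 z * cos_conv (k * z) (fst f) 1) (r/2)"
    "hol_family (\<lambda>z f x. p 2 z * sin_conv k (snd f) 1) (r/2)"
    "hol_family (\<lambda>z f x. p 3 z * cos_conv k (snd f) 1) (r/2)"
    using hol_family_scalar[OF F(1) p4(1) r] hol_family_scalar[OF F(2) p4(2) r]
      hol_family_scalar[OF F(3) p4(3) r] hol_family_scalar[OF F(4) p4(4) r] by simp_all
  from hol_family_add[OF hol_family_add[OF hol_family_add[OF this(1) this(2)] this(3)] this(4)]
  show ?thesis unfolding amplitude_def lin4_def .
qed

lemma short_family_hol: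
  assumes r: "0 < r" and p: "\<And>i. i < 4 \<Longrightarrow> p i holomorphic_on ball 0 r"
  shows "hol_family (short_family k p) (r/2)"
proof -
  have "bounded ((cos :: complex \<Rightarrow> complex) ` cball 0 (cmod k * r))"
    by (intro compact_imp_bounded compact_continuous_image continuous_intros) auto
  then obtain M where M: "\<And>z. z \<in> cball 0 (cmod k * r) \<Longrightarrow> cmod (cos z) \<le> M"
    unfolding bounded_iff by blast
  have "hol_family (\<lambda>z f x. cos (k * z * of_real x) * amplitude k p z f) (r/2)"
  proof (rule hol_family_mult[OF amplitude_hol_family[OF r p]])
    show "(\<lambda>z. cos (k * z * of_real x)) holomorphic_on ball 0 (r/2)" for x :: real
      by (intro holomorphic_intros)
    show "(\<lambda>x. cos (k * z * of_real x)) \<in> borel_measurable (lebesgue_on {0<..<1})" for z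
      by (intro continuous_imp_measurable_on_sets_lebesgue continuous_intros) auto
    fix z :: complex and x :: real assume "z \<in> ball 0 (r/2)" "x \<in> {0<..<1}"
    then have "cmod k * (cmod z * \<bar>x\<bar>) \<le> cmod k * (r * 1)"
      using r by (intro mult_left_mono mult_mono) auto
    then show "cmod (cos (k * z * of_real x)) \<le> M"
      by (intro M) (simp add: norm_mult mult.assoc)
  qed
  moreover have "hol_family (\<lambda>z f x. (- z / k) * sin_conv (k * z) (fst f) x) (r/2)"
  proof (rule hol_family_scalar)
    show "hol_family (\<lambda>z f x. sin_conv (k * z) (fst f) x) (r/2)"
      by (rule scaled_conv_hol_family(1)[OF r]) simp
    show "(\<lambda>z. - z / k) holomorphic_on ball 0 r"
      unfolding divide_inverse by (intro holomorphic_intros)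
  qed (rule r)
  ultimately have "hol_family (\<lambda>z f x. cos (k * z * of_real x) * amplitude k p z f
      + (- z / k) * sin_conv (k * z) (fst f) x) (r/2)"
    by (rule hol_family_add)
  moreover have "(\<lambda>z f x. cos (k * z * of_real x) * amplitude k p z f
      + (- z / k) * sin_conv (k * z) (fst f) x) = short_family k p"
    by (simp add: fun_eq_iff short_family_def mult.commute)
  ultimately show ?thesis by simp
qed

lemma long_family_hol:
  assumes r: "0 < r" and q: "\<And>i. i < 4 \<Longrightarrow> q i holomorphic_on ball 0 r"
  shows "hol_family (long_family k q) (r/2)"
proof -
  have "bounded ((\<lambda>x::real. sin (k * of_real x)) ` {0..1})"
    by (intro compact_imp_bounded compact_continuous_image continuous_intros) auto
  then obtain M where M: "\<And>x::real. x \<in> {0..1} \<Longrightarrow> cmod (sin (k * of_real x)) \<le> M"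
    unfolding bounded_iff by blast
  have "hol_family (\<lambda>z f x. sin (k * of_real x) * amplitude k q z f) (r/2)"
  proof (rule hol_family_mult[OF amplitude_hol_family[OF r q]])
    show "(\<lambda>x. sin (k * of_real x)) \<in> borel_measurable (lebesgue_on {0<..<1})"
      by (intro continuous_imp_measurable_on_sets_lebesgue continuous_intros) auto
    show "\<And>x. x \<in> {0<..<1} \<Longrightarrow> cmod (sin (k * of_real x)) \<le> M" using M by auto
  qed auto
  moreover have "hol_family (\<lambda>z f x. (- 1 / k) * sin_conv k (snd f) x) (r/2)"
  proof (rule hol_family_scalar)
    show "hol_family (\<lambda>z f x. sin_conv k (snd f) x) (r/2)"
      by (rule scaled_conv_hol_family(3)[OF r]) simp
  qed (use r in auto)
  ultimately have "hol_family (\<lambda>z f x. sin (k * of_real x) * amplitude k q z f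
      + (- 1 / k) * sin_conv k (snd f) x) (r/2)"
    by (rule hol_family_add)
  moreover have "(\<lambda>z f x. sin (k * of_real x) * amplitude k q z f
      + (- 1 / k) * sin_conv k (snd f) x) = long_family k q"
    by (simp add: fun_eq_iff long_family_def mult.commute)
  ultimately show ?thesis by simp
qed

lemma sin_conv_zero [simp]: "sin_conv 0 f x = 0"
  by (simp add: sin_conv_def)

lemma bounded_functional_conv:
  "bounded_functional (\<lambda>f. a * sin_conv \<kappa> f 1 + b * cos_conv \<kappa> f 1)"
proof -
  obtain B where B: "\<And>f. f \<in> L2 1 \<Longrightarrow> cmod (sin_conv \<kappa> f 1) \<le> B * norm_L2 1 f \<and> cmod (cos_conv \<kappa> f 1) \<le> B * norm_L2 1 f"
    using conv_bound[of "cmod \<kappa>"] by (metis atLeastAtMost_iff order_refl zero_le_one)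
  have "cmod (a * sin_conv \<kappa> f 1 + b * cos_conv \<kappa> f 1) \<le> ((cmod a + cmod b) * B) * norm_L2 1 f"
    if "f \<in> L2 1" for f
  proof -
    have "cmod (a * sin_conv \<kappa> f 1 + b * cos_conv \<kappa> f 1)
        \<le> cmod a * cmod (sin_conv \<kappa> f 1) + cmod b * cmod (cos_conv \<kappa> f 1)"
      by (metis norm_mult norm_triangle_ineq)
    also have "\<dots> \<le> cmod a * (B * norm_L2 1 f) + cmod b * (B * norm_L2 1 f)"
      using B[OF that] by (intro add_mono mult_left_mono) auto
    finally show ?thesis by (simp add: algebra_simps)
  qed
  moreover have "a * sin_conv \<kappa> (\<lambda>x. c * f x + g x) 1 + b * cos_conv \<kappa> (\<lambda>x. c * f x + g x) 1
      = c * (a * sin_conv \<kappa> f 1 + b * cos_conv \<kappa> f 1) + (a * sin_conv \<kappa> g 1 + b * cos_conv \<kappa> g 1)"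
    if "f \<in> L2 1" "g \<in> L2 1" for f g c
    using conv_linear[OF that, of 1] by (simp add: algebra_simps)
  ultimately show ?thesis
    unfolding bounded_functional_def by blast
qed

context
  fixes P T :: "complex^2^2" and k :: complex and r :: real and p q :: "nat \<Rightarrow> complex \<Rightarrow> complex"
  assumes sol: "solution_coeffs P T k r p q" and k: "k \<noteq> 0"
begin

lemma r_pos: "0 < r / 2" "0 < r"
  and hol: "i < 4 \<Longrightarrow> p i holomorphic_on ball 0 r" "i < 4 \<Longrightarrow> q i holomorphic_on ball 0 r"
  and q0: "q 0 0 = 0" "q (Suc 0) 0 = 0"
  using sol by (auto simp: solution_coeffs_def)

lemma R_s_eq: "R_s P T (k\<^sup>2) \<epsilon> f x = short_family k p (of_real \<epsilon>) f x"
  and R_e_eq: "R_e P T (k\<^sup>2) \<epsilon> f x = long_family k q (of_real \<epsilon>) f x"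
  if "0 < \<epsilon>" "\<epsilon> < r/2" "f \<in> L2G 1" "x \<in> {0<..<1}"
  using resolvent_formula[OF sol k, of \<epsilon> f x] that by auto

lemma R_s_holomorphic: "op_holomorphic_at_0 (R_s P T (k\<^sup>2))"
  by (rule op_holomorphic_at_0I[OF short_family_hol[where k = k, OF r_pos(2) hol(1)] r_pos(1) R_s_eq])

lemma R_e_holomorphic: "op_holomorphic_at_0 (R_e P T (k\<^sup>2))"
  by (rule op_holomorphic_at_0I[OF long_family_hol[where k = k, OF r_pos(2) hol(2)] r_pos(1) R_e_eq])

text \<open>
  At \<open>z = 0\<close> the coefficients of the functionals of \<open>f\<^sub>s\<close> vanish, and what remains of the amplitude is \<open>B\<close>.
\<close>
lemma R_e_leading:
  "\<exists>B. bounded_functional B \<and>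
        op_bigO 1 (\<lambda>\<epsilon> f x. R_e P T (k\<^sup>2) \<epsilon> f x - (B (snd f) * sin (k * of_real x) + L_op k (snd f) x))"
proof (intro exI conjI)
  show "bounded_functional (\<lambda>f. q 2 0 * sin_conv k f 1 + q 3 0 * cos_conv k f 1)"
    by (rule bounded_functional_conv)
  show "op_bigO 1 (\<lambda>\<epsilon> f x. R_e P T (k\<^sup>2) \<epsilon> f x - ((q 2 0 * sin_conv k (snd f) 1 + q 3 0 * cos_conv k (snd f) 1)
      * sin (k * of_real x) + L_op k (snd f) x))"
  proof (rule hol_family_op_bigO_1[OF long_family_hol[where k = k, OF r_pos(2) hol(2)] r_pos(1)])
    fix \<epsilon> x :: real and f :: gfun
    assume a: "0 < \<epsilon>" "\<epsilon> < r/2" "f \<in> L2G 1" "x \<in> {0<..<1}"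
    have "long_family k q 0 f x = (q 2 0 * sin_conv k (snd f) 1 + q 3 0 * cos_conv k (snd f) 1)
        * sin (k * of_real x) + L_op k (snd f) x"
      by (simp add: long_family_def amplitude_def lin4_def q0 L_op_eq_edge_sol edge_sol_def)
    then show "R_e P T (k\<^sup>2) \<epsilon> f x - ((q 2 0 * sin_conv k (snd f) 1 + q 3 0 * cos_conv k (snd f) 1)
        * sin (k * of_real x) + L_op k (snd f) x) = long_family k q (of_real \<epsilon>) f x - long_family k q 0 f x"
      by (simp only: R_e_eq[OF a])
  qed
qed

text \<open>
  At \<open>z = 0\<close> the cosine on the short edge is identically one, so the limit is the constant amplitude. Its part
  coming from \<open>f\<^sub>s\<close> is \<open>p 1 0\<close> times the integral of \<open>f\<^sub>s\<close>, since \<open>sin_conv 0\<close> is zero.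
\<close>
lemma R_s_leading_long_edge:
  assumes "p 1 0 = 0"
  shows "\<exists>B. bounded_functional B \<and> op_bigO 1 (\<lambda>\<epsilon> f x. R_s P T (k\<^sup>2) \<epsilon> f x - B (snd f))"
proof (intro exI conjI)
  show "bounded_functional (\<lambda>f. p 2 0 * sin_conv k f 1 + p 3 0 * cos_conv k f 1)"
    by (rule bounded_functional_conv)
  show "op_bigO 1 (\<lambda>\<epsilon> f x. R_s P T (k\<^sup>2) \<epsilon> f x - (p 2 0 * sin_conv k (snd f) 1 + p 3 0 * cos_conv k (snd f) 1))"
  proof (rule hol_family_op_bigO_1[OF short_family_hol[where k = k, OF r_pos(2) hol(1)] r_pos(1)])
    fix \<epsilon> x :: real and f :: gfun
    assume a: "0 < \<epsilon>" "\<epsilon> < r/2" "f \<in> L2G 1" "x \<in> {0<..<1}"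
    have "short_family k p 0 f x = p 2 0 * sin_conv k (snd f) 1 + p 3 0 * cos_conv k (snd f) 1"
      using assms by (simp add: short_family_def amplitude_def lin4_def)
    then show "R_s P T (k\<^sup>2) \<epsilon> f x - (p 2 0 * sin_conv k (snd f) 1 + p 3 0 * cos_conv k (snd f) 1)
        = short_family k p (of_real \<epsilon>) f x - short_family k p 0 f x"
      by (simp only: R_s_eq[OF a])
  qed
qed

lemma R_s_leading_short_edge:
  assumes "p 2 = (\<lambda>z. 0)" "p 3 = (\<lambda>z. 0)"
  shows "\<exists>B. bounded_functional B \<and> op_bigO 1 (\<lambda>\<epsilon> f x. R_s P T (k\<^sup>2) \<epsilon> f x - B (fst f))"
proof (intro exI conjI)
  show "bounded_functional (\<lambda>f. 0 * sin_conv 0 f 1 + p 1 0 * cos_conv 0 f 1)"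
    by (rule bounded_functional_conv)
  show "op_bigO 1 (\<lambda>\<epsilon> f x. R_s P T (k\<^sup>2) \<epsilon> f x - (0 * sin_conv 0 (fst f) 1 + p 1 0 * cos_conv 0 (fst f) 1))"
  proof (rule hol_family_op_bigO_1[OF short_family_hol[where k = k, OF r_pos(2) hol(1)] r_pos(1)])
    fix \<epsilon> x :: real and f :: gfun
    assume a: "0 < \<epsilon>" "\<epsilon> < r/2" "f \<in> L2G 1" "x \<in> {0<..<1}"
    have "short_family k p 0 f x = 0 * sin_conv 0 (fst f) 1 + p 1 0 * cos_conv 0 (fst f) 1"
      using assms by (simp add: short_family_def amplitude_def lin4_def)
    then show "R_s P T (k\<^sup>2) \<epsilon> f x - (0 * sin_conv 0 (fst f) 1 + p 1 0 * cos_conv 0 (fst f) 1)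
        = short_family k p (of_real \<epsilon>) f x - short_family k p 0 f x"
      by (simp only: R_s_eq[OF a])
  qed
qed

text \<open>
  The convolution term of the short edge is of second order, since \<open>sin_conv (k z)\<close> itself vanishes at \<open>z = 0\<close>; so is
  \<open>p 0 z\<close> times the sine convolution. The derivative at \<open>0\<close> therefore comes only from \<open>p 1\<close>, in front of
  \<open>cos_conv 0 f\<^sub>s 1\<close>, which is the integral of \<open>f\<^sub>s\<close>.
\<close>
lemma R_s_second_order:
  assumes p: "p 0 0 = 0" "p 1 0 = 0" "p 2 = (\<lambda>z. 0)" "p 3 = (\<lambda>z. 0)"
  shows "op_bigO 2 (\<lambda>\<epsilon> f x. R_s P T (k\<^sup>2) \<epsilon> f x - of_real \<epsilon> * (deriv (p 1) 0 * cos_conv 0 (fst f) 1))"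
proof (rule hol_family_op_bigO_2[OF short_family_hol[where k = k, OF r_pos(2) hol(1)] r_pos(1)])
  fix f :: gfun and x :: real
  assume f: "f \<in> L2G 1" and x: "x \<in> {0<..<1}"
  show "short_family k p 0 f x = 0"
    using p by (simp add: short_family_def amplitude_def lin4_def)
  have fL: "fst f \<in> L2 1" using f by (simp add: L2G_def mem_Times_iff)
  have x1: "x \<in> {0..1}" using x by simp
  let ?S = "\<lambda>y z. sin_conv (k * z) (fst f) y" and ?C = "\<lambda>z. cos_conv (k * z) (fst f) 1"
  have holS: "?S y holomorphic_on UNIV" if "y \<in> {0..1}" for y
    using holomorphic_on_compose_gen[OF _ conv_holomorphic(1)[OF fL that, of UNIV], of "\<lambda>z. k * z" UNIV]
    by (auto simp: o_def intro!: holomorphic_intros)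
  have holC: "?C holomorphic_on UNIV"
    using holomorphic_on_compose_gen[OF _ conv_holomorphic(2)[OF fL, of 1 UNIV], of "\<lambda>z. k * z" UNIV]
    by (auto simp: o_def intro!: holomorphic_intros)
  obtain S' where S': "(?S 1 has_field_derivative S') (at 0)"
    using holomorphic_derivI[OF holS[of 1], of 0] by auto
  obtain Sx' where Sx': "(?S x has_field_derivative Sx') (at 0)"
    using holomorphic_derivI[OF holS[OF x1], of 0] by auto
  obtain C' where C': "(?C has_field_derivative C') (at 0)"
    using holomorphic_derivI[OF holC, of 0] by auto
  have p0': "(p 0 has_field_derivative deriv (p 0) 0) (at 0)"
    and p1': "(p 1 has_field_derivative deriv (p 1) 0) (at 0)"
    using holomorphic_derivI[OF hol(1) open_ball, of _ 0] r_pos by auto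
  have "((\<lambda>z. (p 0 z * ?S 1 z + p 1 z * ?C z) * cos (k * z * of_real x) - z / k * ?S x z)
      has_field_derivative deriv (p 1) 0 * cos_conv 0 (fst f) 1) (at 0)"
    using k p by (auto intro!: derivative_eq_intros S' Sx' C' p0' p1'[unfolded One_nat_def])
  then show "((\<lambda>z. short_family k p z f x) has_field_derivative deriv (p 1) 0 * cos_conv 0 (fst f) 1) (at 0)"
    using p by (simp add: short_family_def amplitude_def lin4_def)
next
  fix \<epsilon> x :: real and f :: gfun
  assume a: "0 < \<epsilon>" "\<epsilon> < r/2" "f \<in> L2G 1" "x \<in> {0<..<1}"
  show "R_s P T (k\<^sup>2) \<epsilon> f x - of_real \<epsilon> * (deriv (p 1) 0 * cos_conv 0 (fst f) 1) =
      short_family k p (of_real \<epsilon>) f x - of_real \<epsilon> * (deriv (p 1) 0 * cos_conv 0 (fst f) 1)"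
    by (simp only: R_s_eq[OF a])
qed

end

theorem theorem3:
  fixes P T :: "complex^2^2" and lam k :: complex
  assumes vertex: "vertex_conditions P T"
    and nonreal: "lam \<notin> \<real>"
    and sqrt_lam: "k\<^sup>2 = lam"
  shows
    "op_holomorphic_at_0 (R_s P T lam) \<and>
     op_holomorphic_at_0 (R_e P T lam) \<and>
     (\<forall>g\<in>L2 1. L_op k g \<in> H2 1) \<and>
     (\<exists>B. bounded_functional B \<and>
        op_bigO 1 (\<lambda>\<epsilon> f x. R_e P T lam \<epsilon> f x -
                      (B (snd f) * sin (k * of_real x) + L_op k (snd f) x))) \<and>
     (rank P = 2 \<longrightarrow> op_bigO 2 (R_s P T lam)) \<and>
     (\<forall>\<mu>::real. rank P = 1 \<and> P = rank1_proj None \<and> T = \<mu> *\<^sub>R (mat 1 - P) \<and> \<mu> \<noteq> 0 \<longrightarrow>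
        (\<exists>Bs. bounded_functional Bs \<and>
           op_bigO 2 (\<lambda>\<epsilon> f x. R_s P T lam \<epsilon> f x - of_real \<epsilon> * Bs (fst f)))) \<and>
     (\<forall>(\<mu>::real) (a::real) (b::real) (c::complex).
        (rank P = 1 \<and> P = rank1_proj None \<and> T = \<mu> *\<^sub>R (mat 1 - P) \<and> \<mu> = 0) \<or>
        (rank P = 0 \<and> T = vector [vector [of_real a, c], vector [cnj c, of_real b]] \<and>
           a = 0 \<and> c = 0) \<longrightarrow>
        (\<exists>Bs. bounded_functional Bs \<and>
           op_bigO 1 (\<lambda>\<epsilon> f x. R_s P T lam \<epsilon> f x - Bs (fst f)))) \<and>
     (\<forall>(z::complex) (a::real) (b::real) (c::complex).
        (rank P = 1 \<and> P = rank1_proj (Some z)) \<or>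
        (rank P = 0 \<and> T = vector [vector [of_real a, c], vector [cnj c, of_real b]] \<and>
           (a, c) \<noteq> (0, 0)) \<longrightarrow>
        (\<exists>Be. bounded_functional Be \<and>
           op_bigO 1 (\<lambda>\<epsilon> f x. R_s P T lam \<epsilon> f x - Be (snd f))))"
proof -
  have k2: "k\<^sup>2 \<notin> \<real>" using nonreal sqrt_lam by simp
  note k0 = k_nonzero[OF k2]
  have PP: "P ** P = P" and hT: "hermitian T" and QTQ: "(mat 1 - P) ** T ** (mat 1 - P) = T"
    using vertex by (auto simp: vertex_conditions_def)
  obtain r p q where sol: "solution_coeffs P T k r p q"
    using solution_coeffs_exist[OF k2 vertex] .
  have dirichlet: "op_bigO 2 (R_s P T (k\<^sup>2))" if "rank P = 2"
  proof -
    have P: "P = mat 1" using rank_2_idempotent[OF that PP] .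
    have T: "T = 0" using QTQ unfolding P by (simp add: matrix_matrix_mult_def vec_eq_iff)
    obtain r p q where s: "solution_coeffs (mat 1) 0 k r p q" and p: "p 0 0 = 0" "p 1 = (\<lambda>z. 0)"
      "p 2 = (\<lambda>z. 0)" "p 3 = (\<lambda>z. 0)"
      by (rule dirichlet_coeffs[OF k2])
    have "p 1 0 = 0" "deriv (p 1) 0 = 0" unfolding p(2) by simp_all
    with R_s_second_order[OF s k0 p(1) _ p(3,4)] show ?thesis
      unfolding P T by simp
  qed
  have infinity: "\<exists>Bs. bounded_functional Bs \<and>
      op_bigO 2 (\<lambda>\<epsilon> f x. R_s P T (k\<^sup>2) \<epsilon> f x - of_real \<epsilon> * Bs (fst f))"
    if P: "P = rank1_proj None" and T: "T = \<mu> *\<^sub>R (mat 1 - P)" and \<mu>: "\<mu> \<noteq> 0" for \<mu> :: real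
  proof -
    obtain r p q where s: "solution_coeffs (rank1_proj None) (\<mu> *\<^sub>R (mat 1 - rank1_proj None)) k r p q"
      and p: "p 0 0 = 0" "p 1 0 = 0" "p 2 = (\<lambda>z. 0)" "p 3 = (\<lambda>z. 0)"
      by (rule None_coeffs[OF k2 \<mu>])
    show ?thesis
      using R_s_second_order[OF s k0 p] bounded_functional_conv[of 0 0 "deriv (p 1) 0"]
      unfolding P T by auto
  qed
  have neumann: "\<exists>Bs. bounded_functional Bs \<and> op_bigO 1 (\<lambda>\<epsilon> f x. R_s P T (k\<^sup>2) \<epsilon> f x - Bs (fst f))"
    if "(P = rank1_proj None \<and> T = \<mu> *\<^sub>R (mat 1 - P) \<and> \<mu> = 0) \<or>
        (rank P = 0 \<and> T = vector [vector [of_real a, c], vector [cnj c, of_real b]] \<and> a = 0 \<and> c = 0)"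
    for \<mu> a b :: real and c
    using that
  proof (elim disjE conjE)
    assume "P = rank1_proj None" "T = \<mu> *\<^sub>R (mat 1 - P)" "\<mu> = 0"
    then have P: "P = rank1_proj None" "T = 0" by simp_all
    show ?thesis
      unfolding P by (rule None_neumann_coeffs[OF k2]) (rule R_s_leading_short_edge[OF _ k0])
  next
    assume "rank P = 0" "T = vector [vector [of_real a, c], vector [cnj c, of_real b]]" "a = 0" "c = 0"
    then have P: "P = 0" "T = vector [vector [0, 0], vector [0, of_real b]]"
      using rank_0_imp_zero by simp_all
    show ?thesis
      unfolding P by (rule free_neumann_coeffs[OF k2]) (rule R_s_leading_short_edge[OF _ k0])
  qed
  have coupled: "\<exists>Be. bounded_functional Be \<and> op_bigO 1 (\<lambda>\<epsilon> f x. R_s P T (k\<^sup>2) \<epsilon> f x - Be (snd f))"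
    if "P = rank1_proj (Some z) \<or>
        (rank P = 0 \<and> T = vector [vector [of_real a, c], vector [cnj c, of_real b]] \<and> (a, c) \<noteq> (0, 0))"
    for a b :: real and c z
    using that
  proof (elim disjE conjE)
    assume P: "P = rank1_proj (Some z)"
    obtain \<mu> :: real where T: "T = \<mu> *\<^sub>R (mat 1 - rank1_proj (Some z))"
      by (rule compression_rank1[OF QTQ[unfolded P] hT])
    show ?thesis
      unfolding P T by (rule Some_coeffs[OF k2]) (rule R_s_leading_long_edge[OF _ k0])
  next
    assume "rank P = 0" and T: "T = vector [vector [of_real a, c], vector [cnj c, of_real b]]"
      and ac: "(a, c) \<noteq> (0, 0)"
    then have P: "P = 0" using rank_0_imp_zero by blast
    show ?thesis
      unfolding P T by (rule free_coeffs[OF k2 ac]) (rule R_s_leading_long_edge[OF _ k0])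
  qed
  have "op_holomorphic_at_0 (R_s P T lam)" "op_holomorphic_at_0 (R_e P T lam)"
    using R_s_holomorphic[OF sol k0] R_e_holomorphic[OF sol k0] sqrt_lam by simp_all
  moreover have "\<forall>g\<in>L2 1. L_op k g \<in> H2 1" using L_op_in_H2[OF k0] by blast
  ultimately show ?thesis
    using R_e_leading[OF sol k0] dirichlet infinity neumann coupled unfolding sqrt_lam by blast
qed

end
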